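(* Let $R$ be a unital ring and let $\mathcal{B}$ be an additive full subcategory of the category of finitely presented left $R$-modules. A left $R$-module $F$ is in $\varinjlim\mathcal{B}$ if and only if the right $R$-module $\operatorname{Hom}_{\mathbb{Z}}(F,\mathbb{Q}/\mathbb{Z})$ is in $(\mathrm{Mod}\text{-}R)^{\mathcal{B}}$.
   Context: $\varinjlim\mathcal{B}$ is the class of left $R$-modules that are filtered colimits of modules from $\mathcal{B}$. $(\mathrm{Mod}\text{-}R)^{\mathcal{B}}$ is the full subcategory of the category $\mathrm{Mod}\text{-}R$ of right $R$-modules whose objects are the direct summands of arbitrary set-indexed products of modules of the form $\operatorname{Hom}_{\mathbb{Z}}(B,\mathbb{Q}/\mathbb{Z})$ with $B\in\mathcal{B}$. *)

theory Defs
  imports "HOL-Algebra.Algebra"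
begin

section \<open>Modules over a not necessarily commutative ring\<close>

text \<open>
  The library locale \<^locale>\<open>module\<close> is restricted to commutative rings.  The library record is
  reused for one-sided modules; for a right module, \<open>a \<odot>\<^bsub>M\<^esub> x\<close> stands for \<open>x \<cdot> a\<close>, so that only
  the associativity law differs.  The ring-multiplication fields of a module record are never used.
\<close>

locale left_module = R?: ring R + M?: abelian_group M
  for R :: "('r, 'q) ring_scheme" (structure) and M :: "('r, 'a, 'z) module_scheme" (structure) +
  assumes smult_closed:
      "\<lbrakk>a \<in> carrier R; x \<in> carrier M\<rbrakk> \<Longrightarrow> a \<odot>\<^bsub>M\<^esub> x \<in> carrier M"
    and smult_l_distr:
      "\<lbrakk>a \<in> carrier R; b \<in> carrier R; x \<in> carrier M\<rbrakk> \<Longrightarrow>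
        (a \<oplus> b) \<odot>\<^bsub>M\<^esub> x = a \<odot>\<^bsub>M\<^esub> x \<oplus>\<^bsub>M\<^esub> b \<odot>\<^bsub>M\<^esub> x"
    and smult_r_distr:
      "\<lbrakk>a \<in> carrier R; x \<in> carrier M; y \<in> carrier M\<rbrakk> \<Longrightarrow>
        a \<odot>\<^bsub>M\<^esub> (x \<oplus>\<^bsub>M\<^esub> y) = a \<odot>\<^bsub>M\<^esub> x \<oplus>\<^bsub>M\<^esub> a \<odot>\<^bsub>M\<^esub> y"
    and smult_assoc:
      "\<lbrakk>a \<in> carrier R; b \<in> carrier R; x \<in> carrier M\<rbrakk> \<Longrightarrow>
        (a \<otimes> b) \<odot>\<^bsub>M\<^esub> x = a \<odot>\<^bsub>M\<^esub> (b \<odot>\<^bsub>M\<^esub> x)"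
    and smult_one:
      "x \<in> carrier M \<Longrightarrow> \<one> \<odot>\<^bsub>M\<^esub> x = x"

locale right_module = R?: ring R + M?: abelian_group M
  for R :: "('r, 'q) ring_scheme" (structure) and M :: "('r, 'a, 'z) module_scheme" (structure) +
  assumes smult_closed:
      "\<lbrakk>a \<in> carrier R; x \<in> carrier M\<rbrakk> \<Longrightarrow> a \<odot>\<^bsub>M\<^esub> x \<in> carrier M"
    and smult_l_distr:
      "\<lbrakk>a \<in> carrier R; b \<in> carrier R; x \<in> carrier M\<rbrakk> \<Longrightarrow>
        (a \<oplus> b) \<odot>\<^bsub>M\<^esub> x = a \<odot>\<^bsub>M\<^esub> x \<oplus>\<^bsub>M\<^esub> b \<odot>\<^bsub>M\<^esub> x"
    and smult_r_distr:
      "\<lbrakk>a \<in> carrier R; x \<in> carrier M; y \<in> carrier M\<rbrakk> \<Longrightarrow>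
        a \<odot>\<^bsub>M\<^esub> (x \<oplus>\<^bsub>M\<^esub> y) = a \<odot>\<^bsub>M\<^esub> x \<oplus>\<^bsub>M\<^esub> a \<odot>\<^bsub>M\<^esub> y"
    and smult_assoc:
      "\<lbrakk>a \<in> carrier R; b \<in> carrier R; x \<in> carrier M\<rbrakk> \<Longrightarrow>
        (a \<otimes> b) \<odot>\<^bsub>M\<^esub> x = b \<odot>\<^bsub>M\<^esub> (a \<odot>\<^bsub>M\<^esub> x)"
    and smult_one:
      "x \<in> carrier M \<Longrightarrow> \<one> \<odot>\<^bsub>M\<^esub> x = x"

definition mod_hom ::
  "('r, 'q) ring_scheme \<Rightarrow> ('r, 'a, 'y) module_scheme \<Rightarrow> ('r, 'b, 'z) module_scheme \<Rightarrow> ('a \<Rightarrow> 'b) set"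
  where "mod_hom R M N =
    {h \<in> hom (add_monoid M) (add_monoid N).
      \<forall>a\<in>carrier R. \<forall>x\<in>carrier M. h (a \<odot>\<^bsub>M\<^esub> x) = a \<odot>\<^bsub>N\<^esub> h x}"

definition mod_iso ::
  "('r, 'q) ring_scheme \<Rightarrow> ('r, 'a, 'y) module_scheme \<Rightarrow> ('r, 'b, 'z) module_scheme \<Rightarrow> bool"
  where "mod_iso R M N \<longleftrightarrow> (\<exists>h\<in>mod_hom R M N. bij_betw h (carrier M) (carrier N))"

definition product_module ::
  "'i set \<Rightarrow> ('i \<Rightarrow> ('r, 'a, 'z) module_scheme) \<Rightarrow> ('r, 'i \<Rightarrow> 'a) module"
  where "product_module I M =
    \<lparr>carrier = (\<Pi>\<^sub>E i\<in>I. carrier (M i)),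
     monoid.mult = undefined, one = undefined,
     ring.zero = (\<lambda>i\<in>I. \<zero>\<^bsub>M i\<^esub>),
     ring.add = (\<lambda>x y. \<lambda>i\<in>I. x i \<oplus>\<^bsub>M i\<^esub> y i),
     smult = (\<lambda>a x. \<lambda>i\<in>I. a \<odot>\<^bsub>M i\<^esub> x i)\<rparr>"

definition direct_sum_module ::
  "'i set \<Rightarrow> ('i \<Rightarrow> ('r, 'a, 'z) module_scheme) \<Rightarrow> ('r, 'i \<Rightarrow> 'a) module"
  where "direct_sum_module I M =
    (product_module I M)
      \<lparr>carrier := {x \<in> carrier (product_module I M). finite {i \<in> I. x i \<noteq> \<zero>\<^bsub>M i\<^esub>}}\<rparr>"

definition coproj :: "'i set \<Rightarrow> ('i \<Rightarrow> ('r, 'a, 'z) module_scheme) \<Rightarrow> 'i \<Rightarrow> 'a \<Rightarrow> 'i \<Rightarrow> 'a"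
  where "coproj I M i x = (\<lambda>k\<in>I. if k = i then x else \<zero>\<^bsub>M k\<^esub>)"

definition pair_module ::
  "('r, 'a, 'y) module_scheme \<Rightarrow> ('r, 'b, 'z) module_scheme \<Rightarrow> ('r, 'a \<times> 'b) module"
  where "pair_module M N =
    \<lparr>carrier = carrier M \<times> carrier N,
     monoid.mult = undefined, one = undefined,
     ring.zero = (\<zero>\<^bsub>M\<^esub>, \<zero>\<^bsub>N\<^esub>),
     ring.add = (\<lambda>(x, y) (x', y'). (x \<oplus>\<^bsub>M\<^esub> x', y \<oplus>\<^bsub>N\<^esub> y')),
     smult = (\<lambda>a (x, y). (a \<odot>\<^bsub>M\<^esub> x, a \<odot>\<^bsub>N\<^esub> y))\<rparr>"

definition submodule_span ::
  "('r, 'q) ring_scheme \<Rightarrow> ('r, 'a, 'z) module_scheme \<Rightarrow> 'a set \<Rightarrow> 'a set"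
  where "submodule_span R M S = \<Inter>{H. submodule H R M \<and> S \<subseteq> H}"

definition quotient_module ::
  "('r, 'a, 'z) module_scheme \<Rightarrow> 'a set \<Rightarrow> ('r, 'a set) module"
  where "quotient_module M K =
    \<lparr>carrier = a_rcosets\<^bsub>M\<^esub> K,
     monoid.mult = undefined, one = undefined,
     ring.zero = K,
     ring.add = set_add M,
     smult = (\<lambda>a Y. \<Union>x\<in>Y. K +>\<^bsub>M\<^esub> (a \<odot>\<^bsub>M\<^esub> x))\<rparr>"

definition regular_module :: "('r, 'q) ring_scheme \<Rightarrow> ('r, 'r) module"
  where "regular_module R =
    \<lparr>carrier = carrier R, monoid.mult = undefined, one = undefined,
     ring.zero = \<zero>\<^bsub>R\<^esub>, ring.add = ring.add R, smult = monoid.mult R\<rparr>"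

definition free_module :: "('r, 'q) ring_scheme \<Rightarrow> nat \<Rightarrow> ('r, nat \<Rightarrow> 'r) module"
  where "free_module R n = product_module {..<n} (\<lambda>_. regular_module R)"

definition finitely_presented ::
  "('r, 'q) ring_scheme \<Rightarrow> ('r, 'a, 'z) module_scheme \<Rightarrow> bool"
  where "finitely_presented R M \<longleftrightarrow> left_module R M \<and>
    (\<exists>n S. finite S \<and> S \<subseteq> carrier (free_module R n) \<and>
      mod_iso R (quotient_module (free_module R n) (submodule_span R (free_module R n) S)) M)"

text \<open>
  A full subcategory is given by its objects.  It is additive iff it has a zero object and
  binary biproducts; as it is full, these are zero modules and direct sums in the module category.
  The set need not be closed under isomorphism.
\<close>

definition additive_subcategory ::
  "('r, 'q) ring_scheme \<Rightarrow> ('r, 'b) module set \<Rightarrow> bool"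
  where "additive_subcategory R \<B> \<longleftrightarrow>
    (\<exists>Z\<in>\<B>. carrier Z = {\<zero>\<^bsub>Z\<^esub>}) \<and>
    (\<forall>M\<in>\<B>. \<forall>N\<in>\<B>. \<exists>P\<in>\<B>. mod_iso R (pair_module M N) P)"


lemma (in left_module) smult_zero_right:
  assumes "a \<in> carrier R" shows "a \<odot>\<^bsub>M\<^esub> \<zero>\<^bsub>M\<^esub> = \<zero>\<^bsub>M\<^esub>"
proof -
  have "a \<odot>\<^bsub>M\<^esub> \<zero>\<^bsub>M\<^esub> \<oplus>\<^bsub>M\<^esub> a \<odot>\<^bsub>M\<^esub> \<zero>\<^bsub>M\<^esub> = a \<odot>\<^bsub>M\<^esub> \<zero>\<^bsub>M\<^esub>"
    using smult_r_distr[of a "\<zero>\<^bsub>M\<^esub>" "\<zero>\<^bsub>M\<^esub>"] assms by simp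
  then show ?thesis
    using smult_closed[OF assms, of "\<zero>\<^bsub>M\<^esub>"] by (metis M.add.l_cancel_one M.zero_closed)
qed

lemma (in left_module) smult_minus_right:
  assumes "a \<in> carrier R" "x \<in> carrier M"
  shows "a \<odot>\<^bsub>M\<^esub> (\<ominus>\<^bsub>M\<^esub> x) = \<ominus>\<^bsub>M\<^esub> (a \<odot>\<^bsub>M\<^esub> x)"
proof -
  have "a \<odot>\<^bsub>M\<^esub> (\<ominus>\<^bsub>M\<^esub> x) \<oplus>\<^bsub>M\<^esub> a \<odot>\<^bsub>M\<^esub> x = \<zero>\<^bsub>M\<^esub>"
    using smult_r_distr[of a "\<ominus>\<^bsub>M\<^esub> x" x] assms by (simp add: M.l_neg smult_zero_right)
  then show ?thesis
    using assms by (simp add: M.minus_equality smult_closed)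
qed

lemma (in left_module) finsum_smult:
  assumes "finite A" "a \<in> carrier R" "f \<in> A \<rightarrow> carrier M"
  shows "a \<odot>\<^bsub>M\<^esub> (\<Oplus>\<^bsub>M\<^esub>i\<in>A. f i) = (\<Oplus>\<^bsub>M\<^esub>i\<in>A. a \<odot>\<^bsub>M\<^esub> f i)"
  using assms
proof (induct set: finite)
  case empty then show ?case by (simp add: smult_zero_right)
next
  case (insert x A)
  then have "f x \<in> carrier M" "f \<in> A \<rightarrow> carrier M" by auto
  with insert show ?case
    by (simp add: smult_r_distr smult_closed Pi_def)
qed

lemma mod_homD:
  assumes "h \<in> mod_hom R M N"
  shows mod_hom_closed: "x \<in> carrier M \<Longrightarrow> h x \<in> carrier N"
    and mod_hom_add: "\<lbrakk>x \<in> carrier M; y \<in> carrier M\<rbrakk> \<Longrightarrow> h (x \<oplus>\<^bsub>M\<^esub> y) = h x \<oplus>\<^bsub>N\<^esub> h y"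
    and mod_hom_smult:
      "\<lbrakk>a \<in> carrier R; x \<in> carrier M\<rbrakk> \<Longrightarrow> h (a \<odot>\<^bsub>M\<^esub> x) = a \<odot>\<^bsub>N\<^esub> h x"
  using assms by (auto simp: mod_hom_def hom_def)

lemma mod_homI:
  assumes "\<And>x. x \<in> carrier M \<Longrightarrow> h x \<in> carrier N"
    and "\<And>x y. \<lbrakk>x \<in> carrier M; y \<in> carrier M\<rbrakk> \<Longrightarrow> h (x \<oplus>\<^bsub>M\<^esub> y) = h x \<oplus>\<^bsub>N\<^esub> h y"
    and "\<And>a x. \<lbrakk>a \<in> carrier R; x \<in> carrier M\<rbrakk> \<Longrightarrow> h (a \<odot>\<^bsub>M\<^esub> x) = a \<odot>\<^bsub>N\<^esub> h x"
  shows "h \<in> mod_hom R M N"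
  using assms by (auto simp: mod_hom_def hom_def)

lemma mod_hom_zero:
  assumes "h \<in> mod_hom R M N" "abelian_group M" "abelian_group N"
  shows "h \<zero>\<^bsub>M\<^esub> = \<zero>\<^bsub>N\<^esub>"
proof -
  interpret M: abelian_group M by fact
  interpret N: abelian_group N by fact
  have "h \<zero>\<^bsub>M\<^esub> \<oplus>\<^bsub>N\<^esub> h \<zero>\<^bsub>M\<^esub> = h \<zero>\<^bsub>M\<^esub>"
    using mod_hom_add[OF assms(1), of "\<zero>\<^bsub>M\<^esub>" "\<zero>\<^bsub>M\<^esub>"] by simp
  then show ?thesis
    using mod_hom_closed[OF assms(1) M.zero_closed] by (metis N.add.l_cancel_one N.zero_closed)
qed

lemma mod_hom_minus:
  assumes "h \<in> mod_hom R M N" "abelian_group M" "abelian_group N" "x \<in> carrier M"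
  shows "h (\<ominus>\<^bsub>M\<^esub> x) = \<ominus>\<^bsub>N\<^esub> h x"
proof -
  interpret M: abelian_group M by fact
  interpret N: abelian_group N by fact
  have "h (\<ominus>\<^bsub>M\<^esub> x) \<oplus>\<^bsub>N\<^esub> h x = \<zero>\<^bsub>N\<^esub>"
    using mod_hom_add[OF assms(1), of "\<ominus>\<^bsub>M\<^esub> x" x] assms
    by (simp add: M.l_neg mod_hom_zero)
  then show ?thesis
    using mod_hom_closed[OF assms(1)] assms(4) by (simp add: N.minus_equality)
qed

lemma left_module_direct_sum:
  assumes "ring R" and D: "\<And>i. i \<in> I \<Longrightarrow> left_module R (D i)"
  shows "left_module R (direct_sum_module I D)"
proof -
  let ?S = "direct_sum_module I D"
  have car: "x \<in> carrier ?S \<longleftrightarrow>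
      x \<in> (\<Pi>\<^sub>E i\<in>I. carrier (D i)) \<and> finite {i \<in> I. x i \<noteq> \<zero>\<^bsub>D i\<^esub>}" for x
    by (simp add: direct_sum_module_def product_module_def)
  have ops: "\<zero>\<^bsub>?S\<^esub> = (\<lambda>i\<in>I. \<zero>\<^bsub>D i\<^esub>)"
      "x \<oplus>\<^bsub>?S\<^esub> y = (\<lambda>i\<in>I. x i \<oplus>\<^bsub>D i\<^esub> y i)"
      "a \<odot>\<^bsub>?S\<^esub> x = (\<lambda>i\<in>I. a \<odot>\<^bsub>D i\<^esub> x i)" for x y a
    by (simp_all add: direct_sum_module_def product_module_def)
  have ag: "abelian_group (D i)" if "i \<in> I" for i
    using D[OF that] by (simp add: left_module_def)
  note am = abelian_group.axioms(1)[OF ag]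
  have c: "x i \<in> carrier (D i)" if "x \<in> carrier ?S" "i \<in> I" for x i
    using that by (auto simp: car)
  have add_closed: "x \<oplus>\<^bsub>?S\<^esub> y \<in> carrier ?S" if x: "x \<in> carrier ?S" and y: "y \<in> carrier ?S" for x y
  proof -
    have "finite ({i \<in> I. x i \<noteq> \<zero>\<^bsub>D i\<^esub>} \<union> {i \<in> I. y i \<noteq> \<zero>\<^bsub>D i\<^esub>})"
      using x y by (simp add: car)
    moreover have "{i \<in> I. (x \<oplus>\<^bsub>?S\<^esub> y) i \<noteq> \<zero>\<^bsub>D i\<^esub>} \<subseteq>
        {i \<in> I. x i \<noteq> \<zero>\<^bsub>D i\<^esub>} \<union> {i \<in> I. y i \<noteq> \<zero>\<^bsub>D i\<^esub>}"
      by (auto simp: ops am abelian_monoid.l_zero abelian_monoid.zero_closed)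
    ultimately have "finite {i \<in> I. (x \<oplus>\<^bsub>?S\<^esub> y) i \<noteq> \<zero>\<^bsub>D i\<^esub>}"
      by (rule rev_finite_subset)
    then show ?thesis
      unfolding car using c[OF x] c[OF y] am by (auto simp: ops abelian_monoid.a_closed)
  qed
  have fin_map: "(\<lambda>i\<in>I. f i (x i)) \<in> carrier ?S"
    if x: "x \<in> carrier ?S" and f: "\<And>i z. i \<in> I \<Longrightarrow> z \<in> carrier (D i) \<Longrightarrow> f i z \<in> carrier (D i)"
      "\<And>i. i \<in> I \<Longrightarrow> f i \<zero>\<^bsub>D i\<^esub> = \<zero>\<^bsub>D i\<^esub>" for x f
  proof -
    have "finite {i \<in> I. x i \<noteq> \<zero>\<^bsub>D i\<^esub>}" using x by (simp add: car)
    then have "finite {i \<in> I. (\<lambda>i\<in>I. f i (x i)) i \<noteq> \<zero>\<^bsub>D i\<^esub>}"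
      by (rule rev_finite_subset) (auto simp: f)
    then show ?thesis unfolding car using c[OF x] f(1) by auto
  qed
  have smult_closed: "a \<odot>\<^bsub>?S\<^esub> x \<in> carrier ?S" if "a \<in> carrier R" "x \<in> carrier ?S" for a x
    unfolding ops using that D
    by (intro fin_map) (auto intro: left_module.smult_closed left_module.smult_zero_right)
  have zero: "\<zero>\<^bsub>?S\<^esub> \<in> carrier ?S"
    unfolding car ops using am by (auto simp: abelian_monoid.zero_closed)
  have "abelian_group ?S"
  proof (rule abelian_groupI)
    fix x assume x: "x \<in> carrier ?S"
    have "(\<lambda>i\<in>I. \<ominus>\<^bsub>D i\<^esub> x i) \<oplus>\<^bsub>?S\<^esub> x = \<zero>\<^bsub>?S\<^esub>"
      unfolding ops using c[OF x] ag by (auto simp: abelian_group.l_neg intro!: restrict_ext)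
    moreover have "(\<lambda>i\<in>I. \<ominus>\<^bsub>D i\<^esub> x i) \<in> carrier ?S"
      using x ag by (intro fin_map) (auto simp: abelian_group.a_inv_closed abelian_group.minus_equality abelian_monoid.l_zero am abelian_monoid.zero_closed)
    ultimately show "\<exists>y\<in>carrier ?S. y \<oplus>\<^bsub>?S\<^esub> x = \<zero>\<^bsub>?S\<^esub>" by blast
    have "x \<in> extensional I" using x by (simp add: car PiE_def)
    then show "\<zero>\<^bsub>?S\<^esub> \<oplus>\<^bsub>?S\<^esub> x = x"
      unfolding ops using c[OF x] am
      by (intro extensionalityI[where A=I]) (auto simp: abelian_monoid.l_zero)
  next
    fix x y assume "x \<in> carrier ?S" "y \<in> carrier ?S"
    then show "x \<oplus>\<^bsub>?S\<^esub> y = y \<oplus>\<^bsub>?S\<^esub> x"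
      unfolding ops using am c by (intro restrict_ext) (blast intro: abelian_monoid.a_comm)
  next
    fix x y z assume "x \<in> carrier ?S" "y \<in> carrier ?S" "z \<in> carrier ?S"
    then show "x \<oplus>\<^bsub>?S\<^esub> y \<oplus>\<^bsub>?S\<^esub> z = x \<oplus>\<^bsub>?S\<^esub> (y \<oplus>\<^bsub>?S\<^esub> z)"
      unfolding ops using abelian_monoid.a_assoc[OF am] c by (auto intro!: restrict_ext)
  qed (use add_closed zero in auto)
  moreover have "left_module_axioms R ?S"
  proof
    fix a b x assume "a \<in> carrier R" "b \<in> carrier R" and x: "x \<in> carrier ?S"
    then show "(a \<oplus>\<^bsub>R\<^esub> b) \<odot>\<^bsub>?S\<^esub> x = a \<odot>\<^bsub>?S\<^esub> x \<oplus>\<^bsub>?S\<^esub> b \<odot>\<^bsub>?S\<^esub> x"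
      "(a \<otimes>\<^bsub>R\<^esub> b) \<odot>\<^bsub>?S\<^esub> x = a \<odot>\<^bsub>?S\<^esub> (b \<odot>\<^bsub>?S\<^esub> x)"
      unfolding ops using D c[OF x]
      by (auto simp: left_module.smult_l_distr left_module.smult_assoc intro!: restrict_ext)
  next
    fix a x y assume "a \<in> carrier R" "x \<in> carrier ?S" "y \<in> carrier ?S"
    then show "a \<odot>\<^bsub>?S\<^esub> (x \<oplus>\<^bsub>?S\<^esub> y) = a \<odot>\<^bsub>?S\<^esub> x \<oplus>\<^bsub>?S\<^esub> a \<odot>\<^bsub>?S\<^esub> y"
      unfolding ops using left_module.smult_r_distr[OF D] c by (auto intro!: restrict_ext)
  next
    fix x assume x: "x \<in> carrier ?S"
    then have "x \<in> extensional I" by (simp add: car PiE_def)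
    then show "\<one>\<^bsub>R\<^esub> \<odot>\<^bsub>?S\<^esub> x = x"
      unfolding ops using c[OF x] D
      by (intro extensionalityI[where A=I]) (auto simp: left_module.smult_one)
  qed (use smult_closed in auto)
  ultimately show ?thesis using assms(1) by (simp add: left_module_def)
qed

lemma submodule_span_least:
  assumes "submodule H R M" "S \<subseteq> H" shows "submodule_span R M S \<subseteq> H"
  using assms by (auto simp: submodule_span_def)

lemma (in left_module) submodule_carrier: "submodule (carrier M) R M"
  by (intro submodule.intro submodule_axioms.intro M.add.subgroup_self)
     (auto intro: smult_closed)

lemma (in left_module) submodule_submodule_span:
  assumes "S \<subseteq> carrier M" shows "submodule (submodule_span R M S) R M"
proof
  show "submodule_span R M S \<subseteq> carrier (add_monoid M)"
    using submodule_span_least[OF submodule_carrier assms] by simp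
  fix x y assume "x \<in> submodule_span R M S" "y \<in> submodule_span R M S"
  then show "x \<otimes>\<^bsub>add_monoid M\<^esub> y \<in> submodule_span R M S"
    unfolding submodule_span_def
    by (auto simp: submodule_def dest!: subgroup.m_closed[of _ "add_monoid M" x y, rotated 1])
next
  show "\<one>\<^bsub>add_monoid M\<^esub> \<in> submodule_span R M S"
    unfolding submodule_span_def by (auto simp: submodule_def subgroup_def)
next
  fix x assume "x \<in> submodule_span R M S"
  then show "inv\<^bsub>add_monoid M\<^esub> x \<in> submodule_span R M S"
    unfolding submodule_span_def by (auto simp: submodule_def subgroup_def)
next
  fix a x assume "a \<in> carrier R" "x \<in> submodule_span R M S"
  then show "a \<odot>\<^bsub>M\<^esub> x \<in> submodule_span R M S"
    unfolding submodule_span_def by (auto intro: submodule.smult_closed)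
qed

lemma (in left_module) quotient_module_facts:
  assumes K: "submodule K R M"
  shows "carrier (quotient_module M K) = (\<lambda>x. K +>\<^bsub>M\<^esub> x) ` carrier M"
    and "\<lbrakk>x \<in> carrier M; y \<in> carrier M\<rbrakk> \<Longrightarrow>
      (K +>\<^bsub>M\<^esub> x) \<oplus>\<^bsub>quotient_module M K\<^esub> (K +>\<^bsub>M\<^esub> y) = K +>\<^bsub>M\<^esub> (x \<oplus>\<^bsub>M\<^esub> y)"
    and "\<lbrakk>a \<in> carrier R; x \<in> carrier M\<rbrakk> \<Longrightarrow>
      a \<odot>\<^bsub>quotient_module M K\<^esub> (K +>\<^bsub>M\<^esub> x) = K +>\<^bsub>M\<^esub> (a \<odot>\<^bsub>M\<^esub> x)"
    and "\<lbrakk>x \<in> carrier M; y \<in> carrier M\<rbrakk> \<Longrightarrow>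
      K +>\<^bsub>M\<^esub> x = K +>\<^bsub>M\<^esub> y \<longleftrightarrow> x \<ominus>\<^bsub>M\<^esub> y \<in> K"
    and "left_module R (quotient_module M K)"
proof -
  let ?Q = "quotient_module M K"
  have "subgroup K (add_monoid M)" using K by (simp add: submodule_def)
  then interpret K: abelian_subgroup K M
    by (rule abelian_subgroupI2[OF M.a_comm_group])
  show car: "carrier ?Q = (\<lambda>x. K +>\<^bsub>M\<^esub> x) ` carrier M"
    by (auto simp: quotient_module_def A_RCOSETS_def' a_r_coset_def')
  show add: "(K +>\<^bsub>M\<^esub> x) \<oplus>\<^bsub>?Q\<^esub> (K +>\<^bsub>M\<^esub> y) = K +>\<^bsub>M\<^esub> (x \<oplus>\<^bsub>M\<^esub> y)"
    if "x \<in> carrier M" "y \<in> carrier M" for x y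
    using K.a_rcos_sum[OF that] by (simp add: quotient_module_def)
  show eq: "K +>\<^bsub>M\<^esub> x = K +>\<^bsub>M\<^esub> y \<longleftrightarrow> x \<ominus>\<^bsub>M\<^esub> y \<in> K"
    if "x \<in> carrier M" "y \<in> carrier M" for x y
    using that K.a_rcos_module K.a_repr_independence' K.a_rcos_self unfolding M.minus_eq by metis
  show smult: "a \<odot>\<^bsub>?Q\<^esub> (K +>\<^bsub>M\<^esub> x) = K +>\<^bsub>M\<^esub> (a \<odot>\<^bsub>M\<^esub> x)"
    if a: "a \<in> carrier R" and x: "x \<in> carrier M" for a x
  proof -
    have "K +>\<^bsub>M\<^esub> (a \<odot>\<^bsub>M\<^esub> y) = K +>\<^bsub>M\<^esub> (a \<odot>\<^bsub>M\<^esub> x)" if y: "y \<in> K +>\<^bsub>M\<^esub> x" for y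
    proof -
      have yc: "y \<in> carrier M" using y x by (rule K.a_elemrcos_carrier[rotated])
      have "y \<ominus>\<^bsub>M\<^esub> x \<in> K" using y yc x K.a_rcos_module by (simp add: M.minus_eq)
      then have "a \<odot>\<^bsub>M\<^esub> (y \<ominus>\<^bsub>M\<^esub> x) \<in> K" using a K by (simp add: submodule.smult_closed)
      also have "a \<odot>\<^bsub>M\<^esub> (y \<ominus>\<^bsub>M\<^esub> x) = a \<odot>\<^bsub>M\<^esub> y \<ominus>\<^bsub>M\<^esub> a \<odot>\<^bsub>M\<^esub> x"
        using a x yc by (simp add: M.minus_eq smult_r_distr smult_minus_right)
      finally show ?thesis using eq a x yc by (simp add: smult_closed)
    qed
    moreover have "x \<in> K +>\<^bsub>M\<^esub> x" using x by (rule K.a_rcos_self)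
    ultimately have "(\<Union>y\<in>K +>\<^bsub>M\<^esub> x. K +>\<^bsub>M\<^esub> (a \<odot>\<^bsub>M\<^esub> y)) = K +>\<^bsub>M\<^esub> (a \<odot>\<^bsub>M\<^esub> x)"
      by (intro SUP_eq_const) blast+
    then show ?thesis by (simp add: quotient_module_def)
  qed
  have zero: "\<zero>\<^bsub>?Q\<^esub> = K +>\<^bsub>M\<^esub> \<zero>\<^bsub>M\<^esub>"
    using K.a_subset by (simp add: quotient_module_def)
  have "abelian_group ?Q"
  proof (rule abelian_groupI)
    fix x assume "x \<in> carrier ?Q"
    then obtain x' where x': "x' \<in> carrier M" "x = K +>\<^bsub>M\<^esub> x'" by (auto simp: car)
    then have "(K +>\<^bsub>M\<^esub> (\<ominus>\<^bsub>M\<^esub> x')) \<oplus>\<^bsub>?Q\<^esub> x = \<zero>\<^bsub>?Q\<^esub>"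
      by (simp add: add zero M.l_neg)
    with x' show "\<exists>y\<in>carrier ?Q. y \<oplus>\<^bsub>?Q\<^esub> x = \<zero>\<^bsub>?Q\<^esub>" by (auto simp: car)
  qed (auto simp: car add zero M.a_ac)
  moreover have "left_module_axioms R ?Q"
    by standard
      (auto simp: car add smult smult_closed smult_l_distr smult_r_distr smult_assoc smult_one)
  ultimately show "left_module R ?Q"
    by (simp add: left_module_def R.ring_axioms)
qed


section \<open>Filtered colimits\<close>

record ('i, 'a) small_cat =
  Obj :: "'i set"
  Arr :: "'a set"
  Dom :: "'a \<Rightarrow> 'i"
  Cod :: "'a \<Rightarrow> 'i"
  Ident :: "'i \<Rightarrow> 'a"
  Comp :: "'a \<Rightarrow> 'a \<Rightarrow> 'a"  \<comment> \<open>\<open>Comp C v u\<close> is \<open>v\<close> after \<open>u\<close>\<close>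

definition Hom_set :: "('i, 'a) small_cat \<Rightarrow> 'i \<Rightarrow> 'i \<Rightarrow> 'a set"
  where "Hom_set C i j = {u \<in> Arr C. Dom C u = i \<and> Cod C u = j}"

locale small_category =
  fixes C :: "('i, 'a) small_cat"
  assumes dom_obj: "u \<in> Arr C \<Longrightarrow> Dom C u \<in> Obj C"
    and cod_obj: "u \<in> Arr C \<Longrightarrow> Cod C u \<in> Obj C"
    and ident_hom: "i \<in> Obj C \<Longrightarrow> Ident C i \<in> Hom_set C i i"
    and comp_hom: "\<lbrakk>u \<in> Hom_set C i j; v \<in> Hom_set C j k\<rbrakk> \<Longrightarrow> Comp C v u \<in> Hom_set C i k"
    and ident_left: "u \<in> Hom_set C i j \<Longrightarrow> Comp C (Ident C j) u = u"
    and ident_right: "u \<in> Hom_set C i j \<Longrightarrow> Comp C u (Ident C i) = u"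
    and comp_assoc:
      "\<lbrakk>u \<in> Hom_set C i j; v \<in> Hom_set C j k; w \<in> Hom_set C k l\<rbrakk> \<Longrightarrow>
        Comp C w (Comp C v u) = Comp C (Comp C w v) u"

locale filtered_category = small_category C for C :: "('i, 'a) small_cat" +
  assumes nonempty: "Obj C \<noteq> {}"
    and upper_bound:
      "\<lbrakk>i \<in> Obj C; j \<in> Obj C\<rbrakk> \<Longrightarrow>
        \<exists>k\<in>Obj C. Hom_set C i k \<noteq> {} \<and> Hom_set C j k \<noteq> {}"
    and coequalize:
      "\<lbrakk>u \<in> Hom_set C i j; v \<in> Hom_set C i j\<rbrakk> \<Longrightarrow>
        \<exists>k\<in>Obj C. \<exists>w\<in>Hom_set C j k. Comp C w u = Comp C w v"

text \<open>A functor from \<open>C\<close> to left modules, with object map \<open>D\<close> and arrow map \<open>T\<close>.\<close>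

locale module_diagram = small_category C for C :: "('i, 'a) small_cat" +
  fixes R :: "('r, 'q) ring_scheme"
    and D :: "'i \<Rightarrow> ('r, 'b, 'z) module_scheme"
    and T :: "'a \<Rightarrow> 'b \<Rightarrow> 'b"
  assumes obj_module: "i \<in> Obj C \<Longrightarrow> left_module R (D i)"
    and arr_hom: "u \<in> Hom_set C i j \<Longrightarrow> T u \<in> mod_hom R (D i) (D j)"
    and map_ident: "\<lbrakk>i \<in> Obj C; x \<in> carrier (D i)\<rbrakk> \<Longrightarrow> T (Ident C i) x = x"
    and map_comp:
      "\<lbrakk>u \<in> Hom_set C i j; v \<in> Hom_set C j k; x \<in> carrier (D i)\<rbrakk> \<Longrightarrow>
        T (Comp C v u) x = T v (T u x)"

text \<open>
  The colimit of a diagram of modules, as the standard quotient of the direct sum of all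
  \<open>D i\<close> by the relations identifying \<open>x \<in> D i\<close> with \<open>T u x \<in> D j\<close> for every arrow
  \<open>u : i \<rightarrow> j\<close>.  The universal property is not used as the definition because a predicate of
  higher-order logic can only test it on modules over one fixed carrier type; for this construction
  it holds over all carrier types, see \<open>colim_universal\<close> below.
\<close>

definition colim_relations ::
  "('i, 'a) small_cat \<Rightarrow> ('i \<Rightarrow> ('r, 'b, 'z) module_scheme) \<Rightarrow> ('a \<Rightarrow> 'b \<Rightarrow> 'b) \<Rightarrow> ('i \<Rightarrow> 'b) set"
  where "colim_relations C D T =
    {coproj (Obj C) D (Cod C u) (T u x) \<ominus>\<^bsub>direct_sum_module (Obj C) D\<^esub> coproj (Obj C) D (Dom C u) x
      | u x. u \<in> Arr C \<and> x \<in> carrier (D (Dom C u))}"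

definition colim_kernel ::
  "('r, 'q) ring_scheme \<Rightarrow> ('i, 'a) small_cat \<Rightarrow> ('i \<Rightarrow> ('r, 'b, 'z) module_scheme)
    \<Rightarrow> ('a \<Rightarrow> 'b \<Rightarrow> 'b) \<Rightarrow> ('i \<Rightarrow> 'b) set"
  where "colim_kernel R C D T =
    submodule_span R (direct_sum_module (Obj C) D) (colim_relations C D T)"

definition colim ::
  "('r, 'q) ring_scheme \<Rightarrow> ('i, 'a) small_cat \<Rightarrow> ('i \<Rightarrow> ('r, 'b, 'z) module_scheme)
    \<Rightarrow> ('a \<Rightarrow> 'b \<Rightarrow> 'b) \<Rightarrow> ('r, ('i \<Rightarrow> 'b) set) module"
  where "colim R C D T =
    quotient_module (direct_sum_module (Obj C) D) (colim_kernel R C D T)"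

definition colim_inj ::
  "('r, 'q) ring_scheme \<Rightarrow> ('i, 'a) small_cat \<Rightarrow> ('i \<Rightarrow> ('r, 'b, 'z) module_scheme)
    \<Rightarrow> ('a \<Rightarrow> 'b \<Rightarrow> 'b) \<Rightarrow> 'i \<Rightarrow> 'b \<Rightarrow> ('i \<Rightarrow> 'b) set"
  where "colim_inj R C D T i x =
    colim_kernel R C D T +>\<^bsub>direct_sum_module (Obj C) D\<^esub> coproj (Obj C) D i x"

context module_diagram
begin

abbreviation (input) "dsm \<equiv> direct_sum_module (Obj C) D"

lemma coproj_hom:
  assumes "ring R" "i \<in> Obj C"
  shows "coproj (Obj C) D i \<in> mod_hom R (D i) dsm"
proof (rule mod_homI)
  have am: "abelian_monoid (D k)" if "k \<in> Obj C" for k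
    using obj_module[OF that] by (simp add: left_module_def abelian_group_def)
  show "coproj (Obj C) D i x \<in> carrier dsm" if "x \<in> carrier (D i)" for x
  proof -
    have "finite {k \<in> Obj C. coproj (Obj C) D i x k \<noteq> \<zero>\<^bsub>D k\<^esub>}"
      by (rule finite_subset[of _ "{i}"]) (auto simp: coproj_def)
    then show ?thesis
      using that am
      by (auto simp: direct_sum_module_def product_module_def coproj_def abelian_monoid.zero_closed)
  qed
  show "coproj (Obj C) D i (x \<oplus>\<^bsub>D i\<^esub> y) = coproj (Obj C) D i x \<oplus>\<^bsub>dsm\<^esub> coproj (Obj C) D i y" for x y
    by (auto simp: direct_sum_module_def product_module_def coproj_def am abelian_monoid.l_zero
        abelian_monoid.zero_closed intro!: restrict_ext)
  show "coproj (Obj C) D i (a \<odot>\<^bsub>D i\<^esub> x) = a \<odot>\<^bsub>dsm\<^esub> coproj (Obj C) D i x" if "a \<in> carrier R" for a x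
    using that
    by (auto simp: direct_sum_module_def product_module_def coproj_def
        left_module.smult_zero_right[OF obj_module] intro!: restrict_ext)
qed

lemma colim_relations_subset:
  assumes "ring R" shows "colim_relations C D T \<subseteq> carrier dsm"
proof -
  interpret S: left_module R dsm
    using assms obj_module by (rule left_module_direct_sum)
  show ?thesis
  proof
    fix r assume "r \<in> colim_relations C D T"
    then obtain u x where u: "u \<in> Arr C" and x: "x \<in> carrier (D (Dom C u))"
      and r: "r = coproj (Obj C) D (Cod C u) (T u x) \<ominus>\<^bsub>dsm\<^esub> coproj (Obj C) D (Dom C u) x"
      by (auto simp: colim_relations_def)
    have "T u x \<in> carrier (D (Cod C u))"
      using u x by (intro mod_hom_closed[OF arr_hom]) (auto simp: Hom_set_def)
    then show "r \<in> carrier dsm"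
      unfolding r using u x dom_obj cod_obj
      by (intro S.M.minus_closed mod_hom_closed[OF coproj_hom[OF assms]])
  qed
qed

lemma left_module_colim:
  assumes "ring R" shows "left_module R (colim R C D T)"
proof -
  interpret S: left_module R dsm
    using assms obj_module by (rule left_module_direct_sum)
  show ?thesis
    unfolding colim_def colim_kernel_def
    by (rule S.quotient_module_facts(5)[OF S.submodule_submodule_span[OF colim_relations_subset[OF assms]]])
qed

lemma colim_inj_cocone:
  assumes "ring R"
  shows "i \<in> Obj C \<Longrightarrow> colim_inj R C D T i \<in> mod_hom R (D i) (colim R C D T)"
    and "\<lbrakk>u \<in> Hom_set C i j; x \<in> carrier (D i)\<rbrakk> \<Longrightarrow>
      colim_inj R C D T j (T u x) = colim_inj R C D T i x"
proof -
  interpret S: left_module R dsm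
    using assms obj_module by (rule left_module_direct_sum)
  let ?K = "colim_kernel R C D T"
  have K: "submodule ?K R dsm"
    unfolding colim_kernel_def
    by (rule S.submodule_submodule_span[OF colim_relations_subset[OF assms]])
  note q = S.quotient_module_facts[OF K]
  show "colim_inj R C D T i \<in> mod_hom R (D i) (colim R C D T)" if "i \<in> Obj C"
    using mod_homD[OF coproj_hom[OF assms that]]
    by (intro mod_homI) (simp_all add: colim_inj_def colim_def q(1-3))
  show "colim_inj R C D T j (T u x) = colim_inj R C D T i x"
    if u: "u \<in> Hom_set C i j" and x: "x \<in> carrier (D i)"
  proof -
    have "i \<in> Obj C" "j \<in> Obj C" using u dom_obj cod_obj by (auto simp: Hom_set_def)
    moreover have "T u x \<in> carrier (D j)" using arr_hom[OF u] x by (rule mod_hom_closed)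
    moreover have "coproj (Obj C) D j (T u x) \<ominus>\<^bsub>dsm\<^esub> coproj (Obj C) D i x \<in> colim_relations C D T"
      using u x by (auto simp: colim_relations_def Hom_set_def)
    then have "coproj (Obj C) D j (T u x) \<ominus>\<^bsub>dsm\<^esub> coproj (Obj C) D i x \<in> ?K"
      by (auto simp: colim_kernel_def submodule_span_def)
    ultimately show ?thesis
      using x mod_hom_closed[OF coproj_hom[OF assms]] by (simp add: colim_inj_def q(4))
  qed
qed

theorem colim_universal:
  fixes N :: "('r, 'n, 'w) module_scheme"
  assumes N: "left_module R N"
    and g: "\<And>i. i \<in> Obj C \<Longrightarrow> g i \<in> mod_hom R (D i) N"
    and cocone: "\<And>i j u x. \<lbrakk>u \<in> Hom_set C i j; x \<in> carrier (D i)\<rbrakk> \<Longrightarrow> g j (T u x) = g i x"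
  shows "\<exists>h\<in>mod_hom R (colim R C D T) N.
      \<forall>i\<in>Obj C. \<forall>x\<in>carrier (D i). h (colim_inj R C D T i x) = g i x" (is ?ex)
    and "\<lbrakk>h \<in> mod_hom R (colim R C D T) N; h' \<in> mod_hom R (colim R C D T) N;
        \<And>i x. \<lbrakk>i \<in> Obj C; x \<in> carrier (D i)\<rbrakk> \<Longrightarrow>
          h (colim_inj R C D T i x) = h' (colim_inj R C D T i x);
        y \<in> carrier (colim R C D T)\<rbrakk> \<Longrightarrow> h y = h' y"
proof -
  interpret N: left_module R N by fact
  interpret S: left_module R dsm
    using N.R.ring_axioms obj_module by (rule left_module_direct_sum)
  let ?K = "colim_kernel R C D T"
  have R: "ring R" by (rule N.R.ring_axioms)
  have K: "submodule ?K R dsm"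
    unfolding colim_kernel_def
    by (rule S.submodule_submodule_span[OF colim_relations_subset[OF R]])
  note q = S.quotient_module_facts[OF K]
  have ag: "abelian_group (D k)" if "k \<in> Obj C" for k
    using obj_module[OF that] by (simp add: left_module_def)
  note am = abelian_group.axioms(1)[OF ag]
  have gz: "g k \<zero>\<^bsub>D k\<^esub> = \<zero>\<^bsub>N\<^esub>" if "k \<in> Obj C" for k
    using g[OF that] ag[OF that] N.M.abelian_group_axioms by (rule mod_hom_zero)
  have car: "x \<in> carrier dsm \<longleftrightarrow>
      x \<in> (\<Pi>\<^sub>E i\<in>Obj C. carrier (D i)) \<and> finite {i \<in> Obj C. x i \<noteq> \<zero>\<^bsub>D i\<^esub>}" for x
    by (simp add: direct_sum_module_def product_module_def)
  have ops: "x \<oplus>\<^bsub>dsm\<^esub> y = (\<lambda>i\<in>Obj C. x i \<oplus>\<^bsub>D i\<^esub> y i)"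
      "a \<odot>\<^bsub>dsm\<^esub> x = (\<lambda>i\<in>Obj C. a \<odot>\<^bsub>D i\<^esub> x i)"
      "\<zero>\<^bsub>dsm\<^esub> = (\<lambda>i\<in>Obj C. \<zero>\<^bsub>D i\<^esub>)" for x y a
    by (simp_all add: direct_sum_module_def product_module_def)
  have c: "x i \<in> carrier (D i)" if "x \<in> carrier dsm" "i \<in> Obj C" for x i
    using that by (auto simp: car)
  define supp where "supp x = {i \<in> Obj C. x i \<noteq> \<zero>\<^bsub>D i\<^esub>}" for x
  have supp: "finite (supp x)" "supp x \<subseteq> Obj C" if "x \<in> carrier dsm" for x
    using that by (auto simp: car supp_def)
  define s where "s x = (\<Oplus>\<^bsub>N\<^esub>i\<in>supp x. g i (x i))" for x
  have gc: "g i (x i) \<in> carrier N" if "x \<in> carrier dsm" "i \<in> Obj C" for x i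
    using that c g by (blast intro: mod_hom_closed)
  have s_eq: "s x = (\<Oplus>\<^bsub>N\<^esub>i\<in>A. g i (x i))"
    if x: "x \<in> carrier dsm" and A: "finite A" "supp x \<subseteq> A" "A \<subseteq> Obj C" for x A
    unfolding s_def
  proof (rule N.M.add.finprod_mono_neutral_cong_left)
    show "g i (x i) = \<zero>\<^bsub>N\<^esub>" if "i \<in> A - supp x" for i
      using that A gz by (auto simp: supp_def)
    show "(\<lambda>i. g i (x i)) \<in> A \<rightarrow> carrier N" using gc[OF x] A by auto
  qed (use A in auto)
  have s_hom: "s \<in> mod_hom R dsm N"
  proof (rule mod_homI)
    show "s x \<in> carrier N" if "x \<in> carrier dsm" for x
      unfolding s_def using gc[OF that] supp[OF that] by (intro N.M.finsum_closed) auto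
    show "s (x \<oplus>\<^bsub>dsm\<^esub> y) = s x \<oplus>\<^bsub>N\<^esub> s y" if x: "x \<in> carrier dsm" and y: "y \<in> carrier dsm" for x y
    proof -
      let ?A = "supp x \<union> supp y \<union> supp (x \<oplus>\<^bsub>dsm\<^esub> y)"
      have xy: "x \<oplus>\<^bsub>dsm\<^esub> y \<in> carrier dsm" using x y by simp
      have A: "finite ?A" "?A \<subseteq> Obj C" using supp[OF x] supp[OF y] supp[OF xy] by auto
      have "s (x \<oplus>\<^bsub>dsm\<^esub> y) = (\<Oplus>\<^bsub>N\<^esub>i\<in>?A. g i ((x \<oplus>\<^bsub>dsm\<^esub> y) i))" using A by (intro s_eq xy) auto
      also have "\<dots> = (\<Oplus>\<^bsub>N\<^esub>i\<in>?A. g i (x i) \<oplus>\<^bsub>N\<^esub> g i (y i))"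
      proof (rule N.M.finsum_cong')
        show "g i ((x \<oplus>\<^bsub>dsm\<^esub> y) i) = g i (x i) \<oplus>\<^bsub>N\<^esub> g i (y i)" if "i \<in> ?A" for i
          using that A mod_hom_add[OF g c[OF x] c[OF y]] by (auto simp: ops)
      qed (use gc[OF x] gc[OF y] A in auto)
      also have "\<dots> = (\<Oplus>\<^bsub>N\<^esub>i\<in>?A. g i (x i)) \<oplus>\<^bsub>N\<^esub> (\<Oplus>\<^bsub>N\<^esub>i\<in>?A. g i (y i))"
        using gc[OF x] gc[OF y] A by (intro N.M.finsum_addf) auto
      also have "(\<Oplus>\<^bsub>N\<^esub>i\<in>?A. g i (x i)) = s x" using A by (intro s_eq[symmetric] x) auto
      also have "(\<Oplus>\<^bsub>N\<^esub>i\<in>?A. g i (y i)) = s y" using A by (intro s_eq[symmetric] y) auto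
      finally show ?thesis .
    qed
    show "s (a \<odot>\<^bsub>dsm\<^esub> x) = a \<odot>\<^bsub>N\<^esub> s x" if a: "a \<in> carrier R" and x: "x \<in> carrier dsm" for a x
    proof -
      let ?A = "supp x \<union> supp (a \<odot>\<^bsub>dsm\<^esub> x)"
      have ax: "a \<odot>\<^bsub>dsm\<^esub> x \<in> carrier dsm" using a x by (rule S.smult_closed)
      have A: "finite ?A" "?A \<subseteq> Obj C" using supp[OF x] supp[OF ax] by auto
      have "s (a \<odot>\<^bsub>dsm\<^esub> x) = (\<Oplus>\<^bsub>N\<^esub>i\<in>?A. g i ((a \<odot>\<^bsub>dsm\<^esub> x) i))" using A by (intro s_eq ax) auto
      also have "\<dots> = (\<Oplus>\<^bsub>N\<^esub>i\<in>?A. a \<odot>\<^bsub>N\<^esub> g i (x i))"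
      proof (rule N.M.finsum_cong')
        show "g i ((a \<odot>\<^bsub>dsm\<^esub> x) i) = a \<odot>\<^bsub>N\<^esub> g i (x i)" if "i \<in> ?A" for i
          using that A mod_hom_smult[OF g a c[OF x]] by (auto simp: ops)
        show "(\<lambda>i. a \<odot>\<^bsub>N\<^esub> g i (x i)) \<in> ?A \<rightarrow> carrier N"
          using gc[OF x] A a by (auto intro!: N.smult_closed)
      qed auto
      also have "\<dots> = a \<odot>\<^bsub>N\<^esub> (\<Oplus>\<^bsub>N\<^esub>i\<in>?A. g i (x i))"
        using gc[OF x] A a by (intro N.finsum_smult[symmetric]) auto
      also have "(\<Oplus>\<^bsub>N\<^esub>i\<in>?A. g i (x i)) = s x" using A by (intro s_eq[symmetric] x) auto
      finally show ?thesis .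
    qed
  qed
  have s_coproj: "s (coproj (Obj C) D i x) = g i x" if i: "i \<in> Obj C" and x: "x \<in> carrier (D i)" for i x
  proof -
    have "s (coproj (Obj C) D i x) = (\<Oplus>\<^bsub>N\<^esub>k\<in>{i}. g k (coproj (Obj C) D i x k))"
      using i by (intro s_eq mod_hom_closed[OF coproj_hom[OF R i] x]) (auto simp: supp_def coproj_def)
    also have "\<dots> = g i x"
      using i mod_hom_closed[OF g[OF i] x] by (simp add: coproj_def)
    finally show ?thesis .
  qed
  have s_minus: "s (x \<ominus>\<^bsub>dsm\<^esub> y) = s x \<ominus>\<^bsub>N\<^esub> s y" if "x \<in> carrier dsm" "y \<in> carrier dsm" for x y
    using that mod_hom_add[OF s_hom]
      mod_hom_minus[OF s_hom S.M.abelian_group_axioms N.M.abelian_group_axioms]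
    by (simp add: a_minus_def)
  have "submodule {x \<in> carrier dsm. s x = \<zero>\<^bsub>N\<^esub>} R dsm"
  proof
    show "inv\<^bsub>add_monoid dsm\<^esub> x \<in> {x \<in> carrier dsm. s x = \<zero>\<^bsub>N\<^esub>}" if "x \<in> {x \<in> carrier dsm. s x = \<zero>\<^bsub>N\<^esub>}" for x
      using that mod_hom_minus[OF s_hom S.M.abelian_group_axioms N.M.abelian_group_axioms, of x]
      by (simp flip: a_inv_def)
  qed (auto simp: mod_hom_add[OF s_hom] mod_hom_smult[OF s_hom] S.smult_closed N.smult_zero_right
        mod_hom_zero[OF s_hom S.M.abelian_group_axioms N.M.abelian_group_axioms])
  moreover have "colim_relations C D T \<subseteq> {x \<in> carrier dsm. s x = \<zero>\<^bsub>N\<^esub>}"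
  proof
    fix r assume r: "r \<in> colim_relations C D T"
    then obtain u x where u: "u \<in> Arr C" and x: "x \<in> carrier (D (Dom C u))"
      and rr: "r = coproj (Obj C) D (Cod C u) (T u x) \<ominus>\<^bsub>dsm\<^esub> coproj (Obj C) D (Dom C u) x"
      by (auto simp: colim_relations_def)
    have uh: "u \<in> Hom_set C (Dom C u) (Cod C u)" using u by (simp add: Hom_set_def)
    have Tx: "T u x \<in> carrier (D (Cod C u))" using arr_hom[OF uh] x by (rule mod_hom_closed)
    have "s r = g (Cod C u) (T u x) \<ominus>\<^bsub>N\<^esub> g (Dom C u) x"
      unfolding rr using u x Tx dom_obj cod_obj
      by (simp add: s_minus s_coproj mod_hom_closed[OF coproj_hom[OF R]])
    also have "\<dots> = \<zero>\<^bsub>N\<^esub>"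
      using cocone[OF uh x] mod_hom_closed[OF g[OF dom_obj[OF u]] x]
      by (simp add: N.M.r_neg a_minus_def)
    finally show "r \<in> {x \<in> carrier dsm. s x = \<zero>\<^bsub>N\<^esub>}"
      using r colim_relations_subset[OF R] by auto
  qed
  ultimately have "?K \<subseteq> {x \<in> carrier dsm. s x = \<zero>\<^bsub>N\<^esub>}"
    unfolding colim_kernel_def by (rule submodule_span_least)
  then have wd: "s x = s y"
    if xy: "x \<in> carrier dsm" "y \<in> carrier dsm" and e: "?K +>\<^bsub>dsm\<^esub> x = ?K +>\<^bsub>dsm\<^esub> y" for x y
  proof -
    have "s (x \<ominus>\<^bsub>dsm\<^esub> y) = \<zero>\<^bsub>N\<^esub>"
      using q(4)[OF xy] e \<open>?K \<subseteq> _\<close> by blast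
    then have "s x \<oplus>\<^bsub>N\<^esub> \<ominus>\<^bsub>N\<^esub> s y = \<zero>\<^bsub>N\<^esub>"
      using s_minus[OF xy] by (simp add: N.M.minus_eq)
    then have "\<ominus>\<^bsub>N\<^esub> (\<ominus>\<^bsub>N\<^esub> s y) = s x"
      using xy mod_hom_closed[OF s_hom] by (intro N.M.minus_equality) auto
    then show ?thesis using xy mod_hom_closed[OF s_hom] by simp
  qed
  define h where "h Y = s (SOME x. x \<in> carrier dsm \<and> Y = ?K +>\<^bsub>dsm\<^esub> x)" for Y
  have h: "h (?K +>\<^bsub>dsm\<^esub> x) = s x" if "x \<in> carrier dsm" for x
  proof -
    let ?x = "SOME z. z \<in> carrier dsm \<and> ?K +>\<^bsub>dsm\<^esub> x = ?K +>\<^bsub>dsm\<^esub> z"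
    have "?x \<in> carrier dsm \<and> ?K +>\<^bsub>dsm\<^esub> x = ?K +>\<^bsub>dsm\<^esub> ?x"
      by (rule someI[of _ x]) (use that in simp)
    then show ?thesis unfolding h_def by (intro wd[symmetric] that) simp_all
  qed
  have "h \<in> mod_hom R (colim R C D T) N"
    by (rule mod_homI)
      (auto simp: colim_def q(1-3) h mod_homD[OF s_hom] S.smult_closed)
  moreover have "h (colim_inj R C D T i x) = g i x" if "i \<in> Obj C" "x \<in> carrier (D i)" for i x
    using that mod_hom_closed[OF coproj_hom[OF R]] by (simp add: colim_inj_def h s_coproj)
  ultimately show ?ex by blast

  show "h y = h' y"
    if hh: "h \<in> mod_hom R (colim R C D T) N" and hh': "h' \<in> mod_hom R (colim R C D T) N"
      and eq: "\<And>i x. \<lbrakk>i \<in> Obj C; x \<in> carrier (D i)\<rbrakk> \<Longrightarrow>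
          h (colim_inj R C D T i x) = h' (colim_inj R C D T i x)"
      and y: "y \<in> carrier (colim R C D T)" for h h' y
  proof -
    have colim_ag: "abelian_group (colim R C D T)"
      using left_module_colim[OF R] by (simp add: left_module_def)
    have step: "h (?K +>\<^bsub>dsm\<^esub> x) = h' (?K +>\<^bsub>dsm\<^esub> x)" if "finite A" "x \<in> carrier dsm" "supp x = A" for x A
      using that
    proof (induction A arbitrary: x rule: finite_induct)
      case empty
      have "x i = \<zero>\<^bsub>dsm\<^esub> i" for i
        using empty by (cases "i \<in> Obj C") (auto simp: supp_def ops car)
      then have "x = \<zero>\<^bsub>dsm\<^esub>" by (rule ext)
      moreover have "?K \<subseteq> carrier dsm"
        using K by (simp add: submodule_def subgroup_def)
      ultimately have "?K +>\<^bsub>dsm\<^esub> x = \<zero>\<^bsub>colim R C D T\<^esub>"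
        by (simp add: colim_def quotient_module_def)
      then show ?case
        by (simp add: mod_hom_zero[OF hh colim_ag N.M.abelian_group_axioms]
            mod_hom_zero[OF hh' colim_ag N.M.abelian_group_axioms])
    next
      case (insert i A)
      have i: "i \<in> Obj C" using insert.prems by (auto simp: supp_def)
      define z where "z = x(i := \<zero>\<^bsub>D i\<^esub>)"
      have suppz: "supp z = A" using insert by (auto simp: supp_def z_def)
      have z: "z \<in> carrier dsm"
        unfolding car using insert.hyps(1) suppz insert.prems(1) i am
        by (auto simp: z_def supp_def car PiE_def Pi_def extensional_def abelian_monoid.zero_closed)
      have xi: "x i \<in> carrier (D i)" using insert.prems(1) i by (rule c)
      have co: "coproj (Obj C) D i (x i) \<in> carrier dsm"
        using coproj_hom[OF R i] xi by (rule mod_hom_closed)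
      have "x \<in> extensional (Obj C)" using insert.prems(1) by (simp add: car PiE_def)
      then have x: "x = coproj (Obj C) D i (x i) \<oplus>\<^bsub>dsm\<^esub> z"
        using am c[OF insert.prems(1)]
        by (intro extensionalityI[where A="Obj C"])
          (auto simp: ops coproj_def z_def abelian_monoid.l_zero abelian_monoid.r_zero)
      have Kx: "?K +>\<^bsub>dsm\<^esub> x = colim_inj R C D T i (x i) \<oplus>\<^bsub>colim R C D T\<^esub> (?K +>\<^bsub>dsm\<^esub> z)"
        by (subst x) (simp add: colim_inj_def colim_def q(2)[OF co z])
      have "colim_inj R C D T i (x i) \<in> carrier (colim R C D T)" "?K +>\<^bsub>dsm\<^esub> z \<in> carrier (colim R C D T)"
        using co z by (auto simp: colim_inj_def colim_def q(1))
      then show ?case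
        unfolding Kx by (simp add: mod_hom_add[OF hh] mod_hom_add[OF hh'] eq[OF i xi] insert.IH[OF z suppz])
    qed
    obtain x where "x \<in> carrier dsm" "y = ?K +>\<^bsub>dsm\<^esub> x"
      using y by (auto simp: colim_def q(1))
    then show ?thesis using step[OF supp(1)] by blast
  qed
qed

end

text \<open>
  \<open>lim_closure TYPE('i) TYPE('a) R \<B>\<close> is the class of filtered colimits of modules from \<open>\<B>\<close>,
  where the objects and arrows of the indexing categories range over sets in \<open>'i\<close> and \<open>'a\<close>.
  Since a definition cannot quantify over types, these play the role of the universe of small sets:
  the class is the full one once the types are large enough.  For \<open>F\<close> with carrier type \<open>'f\<close> this is
  the case as soon as \<open>'i\<close> contains a copy of \<open>('r, 'b) module \<times> ('b \<Rightarrow> 'f)\<close>, in which the pairs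
  \<open>(B, B \<rightarrow> F)\<close> live, and \<open>'a\<close> a copy of \<open>'i \<times> 'i \<times> ('b \<Rightarrow> 'b)\<close>, for source, target and underlying
  map of a morphism between such pairs.
\<close>

definition lim_closure ::
  "'i itself \<Rightarrow> 'a itself \<Rightarrow> ('r, 'q) ring_scheme \<Rightarrow> ('r, 'b) module set \<Rightarrow> ('r, 'f) module set"
  where "lim_closure _ _ R \<B> =
    {F. left_module R F \<and>
      (\<exists>(C :: ('i, 'a) small_cat) D T.
        filtered_category C \<and> module_diagram C R D T \<and> (\<forall>i\<in>Obj C. D i \<in> \<B>) \<and>
        mod_iso R (colim R C D T) F)}"


section \<open>Character modules\<close>

definition rat_group :: "rat monoid"
  where "rat_group = \<lparr>carrier = UNIV, monoid.mult = (+), one = 0\<rparr>"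

definition QZ :: "rat set monoid"
  where "QZ = rat_group Mod \<int>"

text \<open>
  \<open>Hom\<^sub>\<int>(M, \<rat>/\<int>)\<close> for a left module \<open>M\<close>, as a right module via \<open>(f \<cdot> a)(x) = f (a x)\<close>.
  Restricting to extensional functions makes equality in the carrier equality on \<open>M\<close>.
\<close>

definition character_module ::
  "('r, 'a, 'z) module_scheme \<Rightarrow> ('r, 'a \<Rightarrow> rat set) module"
  where "character_module M =
    \<lparr>carrier = hom (add_monoid M) QZ \<inter> extensional (carrier M),
     monoid.mult = undefined, one = undefined,
     ring.zero = (\<lambda>x\<in>carrier M. \<one>\<^bsub>QZ\<^esub>),
     ring.add = (\<lambda>f g. \<lambda>x\<in>carrier M. f x \<otimes>\<^bsub>QZ\<^esub> g x),
     smult = (\<lambda>a f. \<lambda>x\<in>carrier M. f (a \<odot>\<^bsub>M\<^esub> x))\<rparr>"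

lemma comm_group_QZ: "comm_group QZ"
proof -
  interpret G: comm_group rat_group
    by (rule comm_groupI) (auto simp: rat_group_def intro: left_minus)
  have "subgroup \<int> rat_group"
  proof
    show "inv\<^bsub>rat_group\<^esub> x \<in> \<int>" if "x \<in> \<int>" for x
    proof -
      have "inv\<^bsub>rat_group\<^esub> x = - x"
        by (rule G.inv_equality) (simp_all add: rat_group_def)
      then show ?thesis using that by simp
    qed
  qed (auto simp: rat_group_def)
  then show ?thesis
    unfolding QZ_def by (rule G.abelian_FactGroup)
qed

lemma right_module_character_module:
  assumes "left_module R M"
  shows "right_module R (character_module M)"
proof -
  interpret left_module R M by fact
  interpret Q: comm_group QZ by (rule comm_group_QZ)
  let ?H = "character_module M"
  have car: "f \<in> carrier ?H \<longleftrightarrow> f \<in> extensional (carrier M) \<and> (\<forall>x\<in>carrier M. f x \<in> carrier QZ) \<and>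
      (\<forall>x\<in>carrier M. \<forall>y\<in>carrier M. f (x \<oplus>\<^bsub>M\<^esub> y) = f x \<otimes>\<^bsub>QZ\<^esub> f y)" for f
    by (auto simp: character_module_def hom_def)
  have ops: "\<zero>\<^bsub>?H\<^esub> = (\<lambda>x\<in>carrier M. \<one>\<^bsub>QZ\<^esub>)"
      "f \<oplus>\<^bsub>?H\<^esub> g = (\<lambda>x\<in>carrier M. f x \<otimes>\<^bsub>QZ\<^esub> g x)"
      "a \<odot>\<^bsub>?H\<^esub> f = (\<lambda>x\<in>carrier M. f (a \<odot>\<^bsub>M\<^esub> x))" for f g a
    by (simp_all add: character_module_def)
  have "abelian_group ?H"
  proof (rule abelian_groupI)
    fix f assume f: "f \<in> carrier ?H"
    have "(\<lambda>x\<in>carrier M. inv\<^bsub>QZ\<^esub> f x) \<in> carrier ?H"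
      using f by (simp add: car Q.inv_mult)
    moreover have "(\<lambda>x\<in>carrier M. inv\<^bsub>QZ\<^esub> f x) \<oplus>\<^bsub>?H\<^esub> f = \<zero>\<^bsub>?H\<^esub>"
      unfolding ops using f by (auto simp: car intro!: restrict_ext)
    ultimately show "\<exists>g\<in>carrier ?H. g \<oplus>\<^bsub>?H\<^esub> f = \<zero>\<^bsub>?H\<^esub>" by blast
    show "\<zero>\<^bsub>?H\<^esub> \<oplus>\<^bsub>?H\<^esub> f = f"
      unfolding ops using f by (intro extensionalityI[where A="carrier M"]) (auto simp: car)
  next
    fix f g assume "f \<in> carrier ?H" "g \<in> carrier ?H"
    then show "f \<oplus>\<^bsub>?H\<^esub> g \<in> carrier ?H" "f \<oplus>\<^bsub>?H\<^esub> g = g \<oplus>\<^bsub>?H\<^esub> f"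
      by (auto simp: car ops Q.m_ac intro!: restrict_ext)
  next
    fix f g h assume "f \<in> carrier ?H" "g \<in> carrier ?H" "h \<in> carrier ?H"
    then show "f \<oplus>\<^bsub>?H\<^esub> g \<oplus>\<^bsub>?H\<^esub> h = f \<oplus>\<^bsub>?H\<^esub> (g \<oplus>\<^bsub>?H\<^esub> h)"
      by (auto simp: car ops Q.m_assoc intro!: restrict_ext)
  qed (auto simp: car ops)
  moreover have "right_module_axioms R ?H"
  proof
    fix a b f assume "a \<in> carrier R" "b \<in> carrier R" "f \<in> carrier ?H"
    then show "(a \<oplus>\<^bsub>R\<^esub> b) \<odot>\<^bsub>?H\<^esub> f = a \<odot>\<^bsub>?H\<^esub> f \<oplus>\<^bsub>?H\<^esub> b \<odot>\<^bsub>?H\<^esub> f"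
      "(a \<otimes>\<^bsub>R\<^esub> b) \<odot>\<^bsub>?H\<^esub> f = b \<odot>\<^bsub>?H\<^esub> (a \<odot>\<^bsub>?H\<^esub> f)"
      by (auto simp: car ops smult_l_distr smult_assoc smult_closed intro!: restrict_ext)
  next
    fix f assume "f \<in> carrier ?H"
    then show "\<one>\<^bsub>R\<^esub> \<odot>\<^bsub>?H\<^esub> f = f"
      unfolding ops
      by (intro extensionalityI[where A="carrier M"]) (auto simp: car smult_one)
  qed (auto simp: car ops smult_r_distr smult_closed intro!: restrict_ext)
  ultimately show ?thesis by (simp add: right_module_def R.ring_axioms)
qed

definition is_direct_summand ::
  "('r, 'q) ring_scheme \<Rightarrow> ('r, 'a, 'y) module_scheme \<Rightarrow> ('r, 'b, 'z) module_scheme \<Rightarrow> bool"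
  where "is_direct_summand R N P \<longleftrightarrow>
    (\<exists>A A'. submodule A R P \<and> submodule A' R P \<and>
      A <+>\<^bsub>P\<^esub> A' = carrier P \<and> A \<inter> A' = {\<zero>\<^bsub>P\<^esub>} \<and>
      mod_iso R N (P\<lparr>carrier := A\<rparr>))"

text \<open>
  The objects of \<open>(Mod-R)\<^sup>\<B>\<close>: direct summands, up to isomorphism, of products of character modules
  of modules from \<open>\<B>\<close>, where the index sets of the products range over sets in \<open>'i\<close>.
\<close>

definition char_product_summands ::
  "'i itself \<Rightarrow> ('r, 'q) ring_scheme \<Rightarrow> ('r, 'b) module set \<Rightarrow> ('r, 'n) module set"
  where "char_product_summands _ R \<B> =
    {N. right_module R N \<and>
      (\<exists>(I :: 'i set) B. (\<forall>i\<in>I. B i \<in> \<B>) \<and>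
        is_direct_summand R N (product_module I (\<lambda>i. character_module (B i))))}"

end

theory Submission
  imports Defs
begin

text \<open>
  Write \<open>M\<^sup>+\<close> for the character module of \<open>M\<close>.

  Let \<open>F\<close> be the colimit of modules \<open>D i\<close> over a filtered category.  Restricting a character of \<open>F\<close>
  to every \<open>D i\<close> is a homomorphism \<open>j : F\<^sup>+ \<rightarrow> P = \<Prod>\<^sub>i (D i)\<^sup>+\<close>, and the task is to find a
  retraction of \<open>j\<close>.  By adjunction, a homomorphism \<open>P \<rightarrow> F\<^sup>+\<close> is a homomorphism \<open>F \<rightarrow> P\<^sup>+\<close>, that is,
  a cocone from the \<open>D i\<close> to \<open>P\<^sup>+\<close>.  It should send \<open>b \<in> D i\<close> to the character
  \<open>t \<mapsto> lim t\<^sub>k(u b)\<close>, where \<open>u : i \<rightarrow> k\<close> goes further and further along the category.  As the category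
  is filtered, the choices of an object \<open>k\<close> and of arrows to \<open>k\<close> that are compatible with any
  finitely many given arrows generate a proper filter (\<open>cocone_filter_nontrivial\<close>).
  As \<open>\<rat>/\<int>\<close> is injective, the limit of eventually constant functions along a filter extends to an
  additive operation on all functions with values in \<open>\<rat>/\<int>\<close> (\<open>QZ_limit_exists\<close>).
  On the image of \<open>j\<close> the functions involved are eventually constant, so that
  the resulting map is a retraction (\<open>filtered_colimit_character_module\<close>).

  For the converse, a homomorphism from a finitely presented module to \<open>F\<close> is a
  solution in \<open>F\<close> of a finite system of linear equations.  Suppose that \<open>F\<^sup>+\<close> is a direct summand of
  \<open>\<Prod>\<^sub>i (D i)\<^sup>+\<close> with \<open>D i \<in> \<B>\<close>, and that some solution \<open>y \<in> F\<^sup>n\<close> is not the image of a solution in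
  a module of \<open>\<B>\<close>.  As \<open>\<B>\<close> is additive, the solutions that are such images form a group,
  so that a character of \<open>F\<^sup>n\<close>, which is an \<open>n\<close>-tuple \<open>c\<close> of characters of \<open>F\<close>, kills all of them but
  not \<open>y\<close>.  As \<open>D i\<close> is finitely presented, every homomorphism \<open>F\<^sup>+ \<rightarrow> (D i)\<^sup>+\<close> maps \<open>c\<close> to a tuple that
  kills all solutions in \<open>D i\<close> (\<open>character_hom_annihilates\<close>).  By duality, such a tuple is a
  combination of the equations with coefficients in \<open>(D i)\<^sup>+\<close> (\<open>solutions_annihilator\<close>).  For all \<open>i\<close>
  together these coefficients are elements of the product.  The retraction maps them to \<open>F\<^sup>+\<close>
  and shows that \<open>c\<close> itself is a combination of the equations, hence kills \<open>y\<close>, a contradiction.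
  So all solutions in \<open>F\<close> come from \<open>\<B>\<close> (\<open>summand_solutions_factor\<close>), and this makes the category of
  pairs \<open>(B, B \<rightarrow> F)\<close> with \<open>B \<in> \<B>\<close> filtered with colimit \<open>F\<close> (\<open>solutions_factor_imp_lim_closure\<close>).

  In other terms, the second half rests on the isomorphism \<open>M\<^sup>+ \<otimes> Q \<cong> Hom(Q, M)\<^sup>+\<close> for finitely
  presented \<open>Q\<close>; working with tuples of characters avoids tensor products.
\<close>

section \<open>Injectivity of the group of rationals modulo integers\<close>

definition qz :: "rat \<Rightarrow> rat set"
  where "qz r = \<int> #>\<^bsub>rat_group\<^esub> r"

interpretation QZ: comm_group QZ
  by (rule comm_group_QZ)

interpretation rat_group: comm_group rat_group
  by (rule comm_groupI) (auto simp: rat_group_def intro: left_minus)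

lemma subgroup_Ints: "subgroup \<int> rat_group"
proof
  show "inv\<^bsub>rat_group\<^esub> x \<in> \<int>" if "x \<in> \<int>" for x
  proof -
    have "inv\<^bsub>rat_group\<^esub> x = - x"
      by (rule rat_group.inv_equality) (simp_all add: rat_group_def)
    then show ?thesis using that by simp
  qed
qed (auto simp: rat_group_def)

lemma normal_Ints: "\<int> \<lhd> rat_group"
  using subgroup_Ints by (simp add: rat_group.normal_iff_subgroup)

lemma carrier_QZ: "carrier QZ = range qz"
  by (auto simp: QZ_def FactGroup_def RCOSETS_def qz_def rat_group_def)

lemma qz_add: "qz (r + s) = qz r \<otimes>\<^bsub>QZ\<^esub> qz s"
  using normal.rcos_sum[OF normal_Ints, of r s]
  by (simp add: QZ_def FactGroup_def qz_def rat_group_def)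

lemma qz_closed: "qz r \<in> carrier QZ"
  by (simp add: carrier_QZ)

lemma qz_eq_one_iff: "qz r = \<one>\<^bsub>QZ\<^esub> \<longleftrightarrow> r \<in> \<int>"
proof -
  have "\<one>\<^bsub>QZ\<^esub> = \<int>" by (simp add: QZ_def FactGroup_def)
  moreover have "qz r = \<int> \<longleftrightarrow> r \<in> \<int>"
    using rat_group.coset_join1[OF _ _ subgroup_Ints, of r] rat_group.coset_join2[OF _ subgroup_Ints, of r]
    unfolding qz_def by (auto simp: rat_group_def)
  ultimately show ?thesis by simp
qed

lemma qz_int_mult: "qz (of_int n * r) = qz r [^]\<^bsub>QZ\<^esub> (n::int)"
proof -
  have hom: "qz \<in> hom rat_group QZ"
    by (auto simp: hom_def qz_closed qz_add rat_group_def simp flip: qz_add)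
  have carrier: "x \<in> carrier rat_group" for x by (simp add: rat_group_def)
  have nat: "r [^]\<^bsub>rat_group\<^esub> (k::nat) = of_nat k * r" for k r
    by (induction k) (auto simp: rat_group_def algebra_simps)
  have inv: "inv\<^bsub>rat_group\<^esub> x = - x" for x
    by (rule rat_group.inv_equality) (simp_all add: rat_group_def)
  have "r [^]\<^bsub>rat_group\<^esub> n = of_int n * r"
    by (cases n rule: int_cases2) (simp_all add: int_pow_int rat_group.int_pow_neg_int nat inv carrier)
  moreover have "qz (r [^]\<^bsub>rat_group\<^esub> n) = qz r [^]\<^bsub>QZ\<^esub> n"
    using hom group_hom.hom_int_pow[of rat_group QZ qz r n]
    by (simp add: group_hom_def group_hom_axioms_def rat_group.is_group QZ.is_group carrier)
  ultimately show ?thesis by simp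
qed

lemma QZ_divisible:
  assumes "q \<in> carrier QZ" "n \<noteq> (0::int)"
  shows "\<exists>r\<in>carrier QZ. r [^]\<^bsub>QZ\<^esub> n = q"
proof -
  obtain s where "q = qz s" using assms(1) by (auto simp: carrier_QZ)
  then have "qz (s / of_int n) [^]\<^bsub>QZ\<^esub> n = q"
    using assms(2) by (simp flip: qz_int_mult)
  then show ?thesis using qz_closed by blast
qed

text \<open>
  A cyclic group of order \<open>d \<noteq> \<plusminus>1\<close> (infinite if \<open>d = 0\<close>) has a nontrivial character; \<open>q\<close> is the value on
  a generator.
\<close>

lemma QZ_torsion_element:
  assumes "\<not> d dvd (1::int)"
  obtains q where "q \<in> carrier QZ" "q \<noteq> \<one>\<^bsub>QZ\<^esub>" "\<And>n. d dvd n \<Longrightarrow> q [^]\<^bsub>QZ\<^esub> n = \<one>\<^bsub>QZ\<^esub>"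
proof (cases "d = 0")
  case True
  have "(1/2 :: rat) \<notin> \<int>"
  proof
    assume "(1/2 :: rat) \<in> \<int>"
    then obtain k :: int where "1/2 = (of_int k :: rat)" by (auto elim: Ints_cases)
    then have "of_int (2 * k) = (of_int 1 :: rat)" by simp
    then have "2 * k = 1" by (simp only: of_int_eq_iff)
    then show False by presburger
  qed
  then show thesis using that[of "qz (1/2)"] True by (simp add: qz_closed qz_eq_one_iff)
next
  case False
  have "(1 / of_int d :: rat) \<notin> \<int>"
  proof
    assume "(1 / of_int d :: rat) \<in> \<int>"
    then obtain k :: int where "1 / of_int d = (of_int k :: rat)" by (auto elim: Ints_cases)
    then have "of_int (d * k) = (of_int 1 :: rat)" using False by (simp add: field_simps)
    then have "d * k = 1" by (simp only: of_int_eq_iff)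
    then show False using assms by (metis dvd_triv_left)
  qed
  moreover have "qz (1 / of_int d) [^]\<^bsub>QZ\<^esub> n = \<one>\<^bsub>QZ\<^esub>" if "d dvd n" for n
    using that False by (auto simp: qz_eq_one_iff simp flip: qz_int_mult)
  ultimately show thesis using that[of "qz (1 / of_int d)"] by (simp add: qz_closed qz_eq_one_iff)
qed

text \<open>
  Partial homomorphisms into \<open>\<rat>/\<int>\<close> are handled as their graphs, subgroups of the product
  that are single-valued: extending them is then a matter of enlarging subgroups.
\<close>

definition partial_char :: "('g, 'z) monoid_scheme \<Rightarrow> ('g \<times> rat set) set \<Rightarrow> bool"
  where "partial_char G \<Gamma> \<longleftrightarrow>
    subgroup \<Gamma> (G \<times>\<times> QZ) \<and> (\<forall>q. (\<one>\<^bsub>G\<^esub>, q) \<in> \<Gamma> \<longrightarrow> q = \<one>\<^bsub>QZ\<^esub>)"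

lemma int_pow_multiples:
  assumes "group G" "x \<in> carrier G" "subgroup H G"
  obtains d :: int where "\<And>n. x [^]\<^bsub>G\<^esub> n \<in> H \<longleftrightarrow> d dvd n"
proof -
  interpret G: group G by fact
  interpret H: subgroup H G by fact
  let ?I = "{n :: int. x [^]\<^bsub>G\<^esub> n \<in> H}"
  have add: "m + n \<in> ?I" if "m \<in> ?I" "n \<in> ?I" for m n
    using that assms(2) by (simp add: G.int_pow_mult H.m_closed)
  have mult: "k * n \<in> ?I" if "n \<in> ?I" for k n
    using that assms(2) G.subgroup_int_pow_closed[OF assms(3), of "x [^]\<^bsub>G\<^esub> n" k]
    by (simp add: G.int_pow_pow mult.commute)
  show thesis
  proof (cases "?I = {0}")
    case True
    then show thesis using that[of 0] by auto
  next
    case False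
    have "0 \<in> ?I" by simp
    with False obtain m where m: "m \<in> ?I" "m \<noteq> 0" by blast
    define P :: "nat \<Rightarrow> bool" where "P k \<longleftrightarrow> 0 < k \<and> int k \<in> ?I" for k
    have "P (nat \<bar>m\<bar>)" using m mult[of m "-1"] by (auto simp: P_def abs_if)
    define d where "d = Least P"
    have d: "P d" and least: "\<And>k. P k \<Longrightarrow> d \<le> k"
      unfolding d_def using LeastI[of P, OF \<open>P _\<close>] Least_le[of P] by auto
    have "int d dvd n" if n: "n \<in> ?I" for n
    proof -
      have "n + (- (n div int d)) * int d \<in> ?I"
        using n d by (intro add mult) (auto simp: P_def)
      then have "n mod int d \<in> ?I" by (simp add: minus_div_mult_eq_mod)
      moreover have "0 \<le> n mod int d" "n mod int d < int d" using d by (auto simp: P_def)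
      ultimately have "\<not> 0 < n mod int d"
        using least[of "nat (n mod int d)"] unfolding P_def by fastforce
      then have "n mod int d = 0" using \<open>0 \<le> n mod int d\<close> by linarith
      then show ?thesis by (simp add: dvd_eq_mod_eq_0)
    qed
    moreover have "n \<in> ?I" if "int d dvd n" for n
      using that d mult[of "int d"] by (auto simp: P_def dvd_def mult.commute)
    ultimately show thesis using that[of "int d"] by blast
  qed
qed

text \<open>
  The enlarged graph consists of the points \<open>(g x\<^sup>n, r q\<^sup>n)\<close> with \<open>(g, r) \<in> \<Gamma>\<close>; compatibility of \<open>q\<close> with
  the values on those powers of \<open>x\<close> where \<open>\<Gamma>\<close> is already defined keeps it single-valued.
\<close>

lemma partial_char_adjoin:
  assumes G: "comm_group G" and \<Gamma>: "partial_char G \<Gamma>"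
    and x: "x \<in> carrier G" and q: "q \<in> carrier QZ"
    and compat: "\<And>n r. (x [^]\<^bsub>G\<^esub> (n::int), r) \<in> \<Gamma> \<Longrightarrow> r = q [^]\<^bsub>QZ\<^esub> n"
  obtains \<Delta> where "partial_char G \<Delta>" "\<Gamma> \<subseteq> \<Delta>" "(x, q) \<in> \<Delta>"
proof -
  interpret G: comm_group G by fact
  interpret GQ: group "G \<times>\<times> QZ" by (intro DirProd_group G.is_group QZ.is_group)
  have sub: "subgroup \<Gamma> (G \<times>\<times> QZ)" and one: "\<And>r. (\<one>\<^bsub>G\<^esub>, r) \<in> \<Gamma> \<Longrightarrow> r = \<one>\<^bsub>QZ\<^esub>"
    using \<Gamma> by (auto simp: partial_char_def)
  interpret S: subgroup \<Gamma> "G \<times>\<times> QZ" by fact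
  have car: "g \<in> carrier G" "r \<in> carrier QZ" if "(g, r) \<in> \<Gamma>" for g r
    using S.mem_carrier[OF that] by auto
  define \<Delta> where "\<Delta> = {(g \<otimes>\<^bsub>G\<^esub> x [^]\<^bsub>G\<^esub> n, r \<otimes>\<^bsub>QZ\<^esub> q [^]\<^bsub>QZ\<^esub> n) | g r (n::int). (g, r) \<in> \<Gamma>}"
  have mem: "(g \<otimes>\<^bsub>G\<^esub> x [^]\<^bsub>G\<^esub> n, r \<otimes>\<^bsub>QZ\<^esub> q [^]\<^bsub>QZ\<^esub> n) \<in> \<Delta>" if "(g, r) \<in> \<Gamma>" for g r and n :: int
    using that by (auto simp: \<Delta>_def)
  have sub\<Delta>: "subgroup \<Delta> (G \<times>\<times> QZ)"
  proof
    show "\<Delta> \<subseteq> carrier (G \<times>\<times> QZ)" using x q car by (auto simp: \<Delta>_def)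
    show "\<one>\<^bsub>G \<times>\<times> QZ\<^esub> \<in> \<Delta>"
      using mem[of "\<one>\<^bsub>G\<^esub>" "\<one>\<^bsub>QZ\<^esub>" 0] S.one_closed by simp
  next
    fix a b assume "a \<in> \<Delta>" "b \<in> \<Delta>"
    then obtain g r g' r' and n n' :: int where
      a: "a = (g \<otimes>\<^bsub>G\<^esub> x [^]\<^bsub>G\<^esub> n, r \<otimes>\<^bsub>QZ\<^esub> q [^]\<^bsub>QZ\<^esub> n)" "(g, r) \<in> \<Gamma>" and
      b: "b = (g' \<otimes>\<^bsub>G\<^esub> x [^]\<^bsub>G\<^esub> n', r' \<otimes>\<^bsub>QZ\<^esub> q [^]\<^bsub>QZ\<^esub> n')" "(g', r') \<in> \<Gamma>"
      by (auto simp: \<Delta>_def)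
    have "(g \<otimes>\<^bsub>G\<^esub> g', r \<otimes>\<^bsub>QZ\<^esub> r') \<in> \<Gamma>" using S.m_closed[OF a(2) b(2)] by simp
    from mem[OF this, of "n + n'"] show "a \<otimes>\<^bsub>G \<times>\<times> QZ\<^esub> b \<in> \<Delta>"
      using a b x q car by (simp add: G.int_pow_mult QZ.int_pow_mult G.m_ac QZ.m_ac)
  next
    fix a assume "a \<in> \<Delta>"
    then obtain g r and n :: int where
      a: "a = (g \<otimes>\<^bsub>G\<^esub> x [^]\<^bsub>G\<^esub> n, r \<otimes>\<^bsub>QZ\<^esub> q [^]\<^bsub>QZ\<^esub> n)" "(g, r) \<in> \<Gamma>"
      by (auto simp: \<Delta>_def)
    have "(inv\<^bsub>G\<^esub> g, inv\<^bsub>QZ\<^esub> r) \<in> \<Gamma>"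
      using S.m_inv_closed[OF a(2)] car[OF a(2)] G.is_group QZ.is_group by simp
    from mem[OF this, of "- n"] show "inv\<^bsub>G \<times>\<times> QZ\<^esub> a \<in> \<Delta>"
      using a x q car[OF a(2)] G.is_group QZ.is_group
      by (simp add: G.int_pow_neg QZ.int_pow_neg G.inv_mult QZ.inv_mult)
  qed
  have "s = \<one>\<^bsub>QZ\<^esub>" if "(\<one>\<^bsub>G\<^esub>, s) \<in> \<Delta>" for s
  proof -
    from that obtain g r and n :: int where
      a: "\<one>\<^bsub>G\<^esub> = g \<otimes>\<^bsub>G\<^esub> x [^]\<^bsub>G\<^esub> n" "s = r \<otimes>\<^bsub>QZ\<^esub> q [^]\<^bsub>QZ\<^esub> n" "(g, r) \<in> \<Gamma>"
      by (auto simp: \<Delta>_def)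
    have "g = x [^]\<^bsub>G\<^esub> (- n)"
      using a(1) car[OF a(3)] x by (metis G.int_pow_closed G.int_pow_neg G.inv_equality)
    then have "r = q [^]\<^bsub>QZ\<^esub> (- n)" using compat a(3) by blast
    then show ?thesis using a(2) q by (simp add: QZ.int_pow_neg)
  qed
  then have "partial_char G \<Delta>" using sub\<Delta> by (simp add: partial_char_def)
  moreover have "\<Gamma> \<subseteq> \<Delta>"
  proof
    fix z assume z: "z \<in> \<Gamma>"
    obtain g r where "z = (g, r)" by (cases z)
    then show "z \<in> \<Delta>" using mem[of g r 0] z car[of g r] by simp
  qed
  moreover have "(x, q) \<in> \<Delta>"
    using mem[of "\<one>\<^bsub>G\<^esub>" "\<one>\<^bsub>QZ\<^esub>" 1] S.one_closed x q by (simp add: G.int_pow_1 QZ.int_pow_1)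
  ultimately show thesis by (rule that)
qed

lemma partial_char_functional:
  assumes "group G" "partial_char G \<Gamma>" "(g, q) \<in> \<Gamma>" "(g, r) \<in> \<Gamma>"
  shows "q = r"
proof -
  interpret G: group G by fact
  interpret S: subgroup \<Gamma> "G \<times>\<times> QZ" using assms(2) by (simp add: partial_char_def)
  have c: "g \<in> carrier G" "q \<in> carrier QZ" "r \<in> carrier QZ"
    using S.mem_carrier assms(3,4) by auto
  have "(g, q) \<otimes>\<^bsub>G \<times>\<times> QZ\<^esub> inv\<^bsub>G \<times>\<times> QZ\<^esub> (g, r) \<in> \<Gamma>"
    by (intro S.m_closed S.m_inv_closed assms(3,4))
  then have "q \<otimes>\<^bsub>QZ\<^esub> inv\<^bsub>QZ\<^esub> r = \<one>\<^bsub>QZ\<^esub>"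
    using assms(2) c G.is_group QZ.is_group by (simp add: partial_char_def)
  then show ?thesis using c by (metis QZ.inv_equality QZ.inv_inv QZ.inv_closed)
qed

text \<open>
  Injectivity of \<open>\<rat>/\<int>\<close>: a maximal extension is total, because the powers of a further element
  \<open>x\<close> on which it is defined are those with exponent divisible by some \<open>d\<close>, and divisibility of \<open>\<rat>/\<int>\<close>
  provides a value at \<open>x\<close>.
\<close>

proposition partial_char_extends:
  assumes G: "comm_group G" and \<Gamma>: "partial_char G \<Gamma>"
  shows "\<exists>\<psi>\<in>hom G QZ. \<forall>g q. (g, q) \<in> \<Gamma> \<longrightarrow> \<psi> g = q"
proof -
  interpret G: comm_group G by fact
  define \<A> where "\<A> = {\<Delta>. partial_char G \<Delta> \<and> \<Gamma> \<subseteq> \<Delta>}"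
  have "\<exists>M\<in>\<A>. \<forall>\<Delta>\<in>\<A>. M \<subseteq> \<Delta> \<longrightarrow> \<Delta> = M"
  proof (rule subset_Zorn_nonempty)
    show "\<A> \<noteq> {}" using \<Gamma> by (auto simp: \<A>_def)
    fix \<C> assume ne: "\<C> \<noteq> {}" and ch: "subset.chain \<A> \<C>"
    have C: "partial_char G \<Delta>" "\<Gamma> \<subseteq> \<Delta>" if "\<Delta> \<in> \<C>" for \<Delta>
      using ch that by (auto simp: subset_chain_def \<A>_def)
    then have S: "subgroup \<Delta> (G \<times>\<times> QZ)" if "\<Delta> \<in> \<C>" for \<Delta>
      using that by (simp add: partial_char_def)
    have "subgroup (\<Union>\<C>) (G \<times>\<times> QZ)"
    proof
      show "\<Union>\<C> \<subseteq> carrier (G \<times>\<times> QZ)" using subgroup.subset[OF S] by (intro Union_least)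
      show "\<one>\<^bsub>G \<times>\<times> QZ\<^esub> \<in> \<Union>\<C>" using subgroup.one_closed[OF S] ne by auto
      show "inv\<^bsub>G \<times>\<times> QZ\<^esub> x \<in> \<Union>\<C>" if "x \<in> \<Union>\<C>" for x
        using that subgroup.m_inv_closed[OF S] by blast
      fix x y assume "x \<in> \<Union>\<C>" "y \<in> \<Union>\<C>"
      then obtain \<Delta> \<Delta>' where XY: "\<Delta> \<in> \<C>" "\<Delta>' \<in> \<C>" "x \<in> \<Delta>" "y \<in> \<Delta>'" by blast
      then have "\<Delta> \<subseteq> \<Delta>' \<or> \<Delta>' \<subseteq> \<Delta>" using ch by (auto simp: subset_chain_def)
      then show "x \<otimes>\<^bsub>G \<times>\<times> QZ\<^esub> y \<in> \<Union>\<C>"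
        using XY subgroup.m_closed[OF S] by (meson UnionI subsetD)
    qed
    moreover have "\<Gamma> \<subseteq> \<Union>\<C>" using C(2) ne by blast
    moreover have "q = \<one>\<^bsub>QZ\<^esub>" if "(\<one>\<^bsub>G\<^esub>, q) \<in> \<Union>\<C>" for q
      using that C(1) unfolding partial_char_def by blast
    ultimately show "\<Union>\<C> \<in> \<A>" by (simp add: partial_char_def \<A>_def)
  qed
  then obtain M where M: "partial_char G M" "\<Gamma> \<subseteq> M"
    and max: "\<And>\<Delta>. partial_char G \<Delta> \<Longrightarrow> M \<subseteq> \<Delta> \<Longrightarrow> \<Delta> = M"
    unfolding \<A>_def by (metis (no_types, lifting) mem_Collect_eq order_trans)
  interpret S: subgroup M "G \<times>\<times> QZ" using M(1) by (simp add: partial_char_def)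
  have car: "g \<in> carrier G" "r \<in> carrier QZ" if "(g, r) \<in> M" for g r
    using S.mem_carrier[OF that] by auto
  interpret GQ: group "G \<times>\<times> QZ" by (intro DirProd_group G.is_group QZ.is_group)
  have pow: "(x [^]\<^bsub>G\<^esub> n, r [^]\<^bsub>QZ\<^esub> n) \<in> M" if "(x, r) \<in> M" for x r and n :: int
  proof -
    have np: "(x, r) [^]\<^bsub>G \<times>\<times> QZ\<^esub> k = (x [^]\<^bsub>G\<^esub> k, r [^]\<^bsub>QZ\<^esub> k)" for k :: nat
      by (induction k) auto
    have "(x, r) [^]\<^bsub>G \<times>\<times> QZ\<^esub> n = (x [^]\<^bsub>G\<^esub> n, r [^]\<^bsub>QZ\<^esub> n)"
      using car[OF that]
      by (cases n rule: int_cases2)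
        (simp_all add: int_pow_int GQ.int_pow_neg_int G.int_pow_neg_int QZ.int_pow_neg_int np
          inv_DirProd[OF G.is_group QZ.is_group])
    then show ?thesis
      using GQ.subgroup_int_pow_closed[OF S.subgroup_axioms that, of n] by simp
  qed
  have total: "\<exists>q. (x, q) \<in> M" if x: "x \<in> carrier G" for x
  proof -
    have sg: "subgroup (fst ` M) G"
    proof
      show "fst ` M \<subseteq> carrier G" using car by auto
      show "\<one>\<^bsub>G\<^esub> \<in> fst ` M" using S.one_closed by force
      show "inv\<^bsub>G\<^esub> g \<in> fst ` M" if "g \<in> fst ` M" for g
        using that S.m_inv_closed car G.is_group QZ.is_group by (force simp: inv_DirProd)
      show "g \<otimes>\<^bsub>G\<^esub> h \<in> fst ` M" if "g \<in> fst ` M" "h \<in> fst ` M" for g h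
        using that S.m_closed by (force simp: mult_DirProd')
    qed
    obtain d :: int where d: "\<And>n. x [^]\<^bsub>G\<^esub> n \<in> fst ` M \<longleftrightarrow> d dvd n"
      using int_pow_multiples[OF G.is_group x sg] by blast
    obtain s where s: "(x [^]\<^bsub>G\<^esub> d, s) \<in> M" using d[of d] by force
    \<comment> \<open>the value at \<open>x\<close> has to be a \<open>d\<close>-th root of the value at \<open>x\<^sup>d\<close>\<close>
    obtain q where q: "q \<in> carrier QZ" "q [^]\<^bsub>QZ\<^esub> d = s"
    proof (cases "d = 0")
      case True
      then have "s = \<one>\<^bsub>QZ\<^esub>" using s M(1) by (simp add: partial_char_def)
      then show thesis using that[of "\<one>\<^bsub>QZ\<^esub>"] True by simp
    next
      case False
      then show thesis using QZ_divisible[OF car(2)[OF s] False] that by blast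
    qed
    have "r = q [^]\<^bsub>QZ\<^esub> n" if r: "(x [^]\<^bsub>G\<^esub> n, r) \<in> M" for n :: int and r
    proof -
      from r have "d dvd n" using d[of n] by force
      then obtain k where k: "n = d * k" by (auto simp: dvd_def)
      have "(x [^]\<^bsub>G\<^esub> n, s [^]\<^bsub>QZ\<^esub> k) \<in> M"
        using pow[OF s, of k] x by (simp add: G.int_pow_pow k)
      then have "r = s [^]\<^bsub>QZ\<^esub> k" using partial_char_functional[OF G.is_group M(1) r] by blast
      then show ?thesis using q by (auto simp: QZ.int_pow_pow k)
    qed
    then obtain \<Delta> where "partial_char G \<Delta>" "M \<subseteq> \<Delta>" "(x, q) \<in> \<Delta>"
      using partial_char_adjoin[OF G M(1) x q(1)] by blast
    then show ?thesis using max by blast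
  qed
  define \<psi> where "\<psi> g = (SOME q. (g, q) \<in> M)" for g
  have \<psi>: "(g, \<psi> g) \<in> M" if "g \<in> carrier G" for g
    unfolding \<psi>_def using total[OF that] by (rule someI_ex)
  have \<psi>_eq: "\<psi> g = q" if "(g, q) \<in> M" for g q
    using partial_char_functional[OF G.is_group M(1) \<psi> that] car that by blast
  have "\<psi> \<in> hom G QZ"
    using \<psi> car S.m_closed by (intro homI \<psi>_eq) force+
  then show ?thesis using \<psi>_eq M(2) by blast
qed

corollary char_extends_along:
  assumes A: "group A" and G: "comm_group G" and \<rho>: "\<rho> \<in> hom A G" and \<chi>: "\<chi> \<in> hom A QZ"
    and ker: "\<And>a. \<lbrakk>a \<in> carrier A; \<rho> a = \<one>\<^bsub>G\<^esub>\<rbrakk> \<Longrightarrow> \<chi> a = \<one>\<^bsub>QZ\<^esub>"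
  shows "\<exists>\<psi>\<in>hom G QZ. \<forall>a\<in>carrier A. \<psi> (\<rho> a) = \<chi> a"
proof -
  interpret A: group A by fact
  interpret G: comm_group G by fact
  interpret GQ: group "G \<times>\<times> QZ" by (intro DirProd_group G.is_group QZ.is_group)
  have "(\<lambda>a. (\<rho> a, \<chi> a)) \<in> hom A (G \<times>\<times> QZ)"
    using \<rho> \<chi> by (auto simp: hom_def)
  then have "subgroup ((\<lambda>a. (\<rho> a, \<chi> a)) ` carrier A) (G \<times>\<times> QZ)"
    by (intro group_hom.img_is_subgroup)
      (simp add: group_hom_def group_hom_axioms_def A.is_group GQ.is_group)
  then have "partial_char G ((\<lambda>a. (\<rho> a, \<chi> a)) ` carrier A)"
    using ker by (auto simp: partial_char_def)
  from partial_char_extends[OF G this] show ?thesis by (auto intro!: imageI)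
qed

text \<open>
  The subgroup generated by \<open>x\<close> modulo \<open>Y\<close> is a nontrivial cyclic group, so some value other than
  the neutral element may be prescribed at \<open>x\<close> together with the neutral element on \<open>Y\<close>.
\<close>

corollary char_separates:
  assumes G: "comm_group G" and Y: "subgroup Y G" and x: "x \<in> carrier G" "x \<notin> Y"
  shows "\<exists>\<psi>\<in>hom G QZ. (\<forall>y\<in>Y. \<psi> y = \<one>\<^bsub>QZ\<^esub>) \<and> \<psi> x \<noteq> \<one>\<^bsub>QZ\<^esub>"
proof -
  interpret G: comm_group G by fact
  have "partial_char G (Y \<times> {\<one>\<^bsub>QZ\<^esub>})"
    using DirProd_subgroups[OF G.is_group Y QZ.is_group QZ.triv_subgroup]
    by (simp add: partial_char_def)
  moreover obtain d :: int where d: "\<And>n. x [^]\<^bsub>G\<^esub> n \<in> Y \<longleftrightarrow> d dvd n"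
    using int_pow_multiples[OF G.is_group x(1) Y] by blast
  moreover have "\<not> d dvd 1" using d[of 1] x by (simp add: G.int_pow_1)
  then obtain q where q: "q \<in> carrier QZ" "q \<noteq> \<one>\<^bsub>QZ\<^esub>" "\<And>n. d dvd n \<Longrightarrow> q [^]\<^bsub>QZ\<^esub> n = \<one>\<^bsub>QZ\<^esub>"
    using QZ_torsion_element by blast
  ultimately obtain \<Delta> where \<Delta>: "partial_char G \<Delta>" "Y \<times> {\<one>\<^bsub>QZ\<^esub>} \<subseteq> \<Delta>" "(x, q) \<in> \<Delta>"
    using partial_char_adjoin[OF G _ x(1) q(1), of "Y \<times> {\<one>\<^bsub>QZ\<^esub>}"] by (auto simp: q(3))
  from partial_char_extends[OF G \<Delta>(1)] obtain \<psi>
    where \<psi>: "\<psi> \<in> hom G QZ" "\<And>g r. (g, r) \<in> \<Delta> \<Longrightarrow> \<psi> g = r" by auto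
  have "\<psi> y = \<one>\<^bsub>QZ\<^esub>" if "y \<in> Y" for y using \<psi>(2) \<Delta>(2) that by auto
  then show ?thesis using \<psi>(1) \<psi>(2)[OF \<Delta>(3)] q(2) by auto
qed

section \<open>Character modules and products of modules\<close>

lemma character_module_simps:
  "f \<in> carrier (character_module M) \<longleftrightarrow> f \<in> extensional (carrier M) \<and> f \<in> hom (add_monoid M) QZ"
  "\<zero>\<^bsub>character_module M\<^esub> = (\<lambda>x\<in>carrier M. \<one>\<^bsub>QZ\<^esub>)"
  "f \<oplus>\<^bsub>character_module M\<^esub> g = (\<lambda>x\<in>carrier M. f x \<otimes>\<^bsub>QZ\<^esub> g x)"
  "a \<odot>\<^bsub>character_module M\<^esub> f = (\<lambda>x\<in>carrier M. f (a \<odot>\<^bsub>M\<^esub> x))"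
  by (auto simp: character_module_def)

lemma character_closed: "\<lbrakk>c \<in> carrier (character_module M); x \<in> carrier M\<rbrakk> \<Longrightarrow> c x \<in> carrier QZ"
  by (auto simp: character_module_simps hom_def)

lemma character_add:
  "\<lbrakk>c \<in> carrier (character_module M); x \<in> carrier M; y \<in> carrier M\<rbrakk> \<Longrightarrow>
    c (x \<oplus>\<^bsub>M\<^esub> y) = c x \<otimes>\<^bsub>QZ\<^esub> c y"
  by (auto simp: character_module_simps hom_def)

lemma character_zero:
  assumes "c \<in> carrier (character_module M)" "abelian_group M"
  shows "c \<zero>\<^bsub>M\<^esub> = \<one>\<^bsub>QZ\<^esub>"
  using assms hom_one[of c "add_monoid M" QZ]
  by (simp add: character_module_simps abelian_group.a_group QZ.is_group)

lemma product_module_simps: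
  "x \<in> carrier (product_module I M) \<longleftrightarrow> x \<in> (\<Pi>\<^sub>E i\<in>I. carrier (M i))"
  "\<zero>\<^bsub>product_module I M\<^esub> = (\<lambda>i\<in>I. \<zero>\<^bsub>M i\<^esub>)"
  "x \<oplus>\<^bsub>product_module I M\<^esub> y = (\<lambda>i\<in>I. x i \<oplus>\<^bsub>M i\<^esub> y i)"
  "a \<odot>\<^bsub>product_module I M\<^esub> x = (\<lambda>i\<in>I. a \<odot>\<^bsub>M i\<^esub> x i)"
  by (simp_all add: product_module_def)

lemma abelian_group_product_module:
  assumes "\<And>i. i \<in> I \<Longrightarrow> abelian_group (M i)"
  shows "abelian_group (product_module I M)"
proof -
  note am = abelian_group.axioms(1)[OF assms]
  note ps = product_module_simps
  show ?thesis
  proof (rule abelian_groupI)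
    show "\<zero>\<^bsub>product_module I M\<^esub> \<in> carrier (product_module I M)"
      using am by (auto simp: ps abelian_monoid.zero_closed)
  next
    fix x y assume "x \<in> carrier (product_module I M)" "y \<in> carrier (product_module I M)"
    then show "x \<oplus>\<^bsub>product_module I M\<^esub> y \<in> carrier (product_module I M)"
        "x \<oplus>\<^bsub>product_module I M\<^esub> y = y \<oplus>\<^bsub>product_module I M\<^esub> x"
      using abelian_monoid.a_closed[OF am] abelian_monoid.a_comm[OF am]
      by (auto simp: ps PiE_iff intro!: restrict_ext)
  next
    fix x y z
    assume "x \<in> carrier (product_module I M)" "y \<in> carrier (product_module I M)"
      "z \<in> carrier (product_module I M)"
    then show "x \<oplus>\<^bsub>product_module I M\<^esub> y \<oplus>\<^bsub>product_module I M\<^esub> z =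
        x \<oplus>\<^bsub>product_module I M\<^esub> (y \<oplus>\<^bsub>product_module I M\<^esub> z)"
      using abelian_monoid.a_assoc[OF am] by (auto simp: ps PiE_iff intro!: restrict_ext)
  next
    fix x assume x: "x \<in> carrier (product_module I M)"
    show "\<zero>\<^bsub>product_module I M\<^esub> \<oplus>\<^bsub>product_module I M\<^esub> x = x"
      using x am by (intro extensionalityI[where A=I]) (auto simp: ps PiE_iff abelian_monoid.l_zero)
    have "(\<lambda>i\<in>I. \<ominus>\<^bsub>M i\<^esub> x i) \<in> carrier (product_module I M)"
      using x abelian_group.a_inv_closed[OF assms] by (auto simp: ps PiE_iff)
    moreover have "(\<lambda>i\<in>I. \<ominus>\<^bsub>M i\<^esub> x i) \<oplus>\<^bsub>product_module I M\<^esub> x = \<zero>\<^bsub>product_module I M\<^esub>"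
      using x abelian_group.l_neg[OF assms] by (auto simp: ps PiE_iff intro!: restrict_ext)
    ultimately show "\<exists>y\<in>carrier (product_module I M).
        y \<oplus>\<^bsub>product_module I M\<^esub> x = \<zero>\<^bsub>product_module I M\<^esub>" by blast
  qed
qed

lemma right_module_product_module:
  assumes "ring R" and M: "\<And>i. i \<in> I \<Longrightarrow> right_module R (M i)"
  shows "right_module R (product_module I M)"
proof -
  note ps = product_module_simps
  have "right_module_axioms R (product_module I M)"
  proof
    show "\<one>\<^bsub>R\<^esub> \<odot>\<^bsub>product_module I M\<^esub> x = x" if "x \<in> carrier (product_module I M)" for x
      using that M
      by (intro extensionalityI[where A=I]) (auto simp: ps PiE_iff right_module.smult_one)
  qed (auto simp: ps PiE_iff right_module.smult_closed[OF M] right_module.smult_l_distr[OF M]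
        right_module.smult_r_distr[OF M] right_module.smult_assoc[OF M] intro!: restrict_ext)
  moreover have "abelian_group (product_module I M)"
    using M by (intro abelian_group_product_module) (simp add: right_module_def)
  ultimately show ?thesis using assms(1) by (simp add: right_module_def)
qed

text \<open>
  Right modules are left modules over the opposite ring.  This transfers the construction of character
  modules from left to right modules.
\<close>

definition opposite_ring :: "('r, 'q) ring_scheme \<Rightarrow> ('r, 'q) ring_scheme"
  where "opposite_ring R = R\<lparr>monoid.mult := \<lambda>a b. b \<otimes>\<^bsub>R\<^esub> a\<rparr>"

lemma opposite_ring_simps [simp]:
  "carrier (opposite_ring R) = carrier R" "\<zero>\<^bsub>opposite_ring R\<^esub> = \<zero>\<^bsub>R\<^esub>"
  "\<one>\<^bsub>opposite_ring R\<^esub> = \<one>\<^bsub>R\<^esub>" "a \<oplus>\<^bsub>opposite_ring R\<^esub> b = a \<oplus>\<^bsub>R\<^esub> b"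
  "a \<otimes>\<^bsub>opposite_ring R\<^esub> b = b \<otimes>\<^bsub>R\<^esub> a"
  by (simp_all add: opposite_ring_def)

lemma ring_opposite_ring:
  assumes "ring R" shows "ring (opposite_ring R)"
proof -
  interpret ring R by fact
  show ?thesis
  proof (rule ringI)
    show "abelian_group (opposite_ring R)"
      by (rule abelian_groupI) (auto simp: a_ac intro: bexI[OF _ a_inv_closed] l_neg)
    show "Group.monoid (opposite_ring R)" by (rule monoidI) (auto simp: m_assoc)
  qed (auto simp: l_distr r_distr)
qed

lemma left_module_opposite_ring:
  assumes "right_module R M" shows "left_module (opposite_ring R) M"
proof -
  interpret right_module R M by fact
  show ?thesis
    using smult_closed smult_l_distr smult_r_distr smult_assoc smult_one
    by (simp add: left_module_def left_module_axioms_def ring_opposite_ring R.ring_axioms M.abelian_group_axioms)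
qed

lemma right_module_opposite_ring:
  assumes "right_module (opposite_ring R) M" "ring R" shows "left_module R M"
proof -
  interpret right_module "opposite_ring R" M by fact
  show ?thesis
    using smult_closed smult_l_distr smult_r_distr smult_assoc smult_one assms(2)
    by (simp add: left_module_def left_module_axioms_def M.abelian_group_axioms)
qed

lemma left_module_character_module:
  assumes "right_module R M" shows "left_module R (character_module M)"
  using assms right_module_character_module[OF left_module_opposite_ring[OF assms]]
  by (intro right_module_opposite_ring) (auto simp: right_module_def)

lemma product_module_a_inv:
  assumes "\<And>i. i \<in> I \<Longrightarrow> abelian_group (M i)" and x: "x \<in> carrier (product_module I M)"
  shows "\<ominus>\<^bsub>product_module I M\<^esub> x = (\<lambda>i\<in>I. \<ominus>\<^bsub>M i\<^esub> x i)"
proof -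
  interpret P: abelian_group "product_module I M"
    using assms(1) by (rule abelian_group_product_module)
  have c: "x i \<in> carrier (M i)" if "i \<in> I" for i using x that by (auto simp: product_module_simps)
  show ?thesis
  proof (rule P.minus_equality)
    show "(\<lambda>i\<in>I. \<ominus>\<^bsub>M i\<^esub> x i) \<oplus>\<^bsub>product_module I M\<^esub> x = \<zero>\<^bsub>product_module I M\<^esub>"
      using abelian_group.l_neg[OF assms(1) c] by (auto simp: product_module_simps intro!: restrict_ext)
    show "(\<lambda>i\<in>I. \<ominus>\<^bsub>M i\<^esub> x i) \<in> carrier (product_module I M)"
      using abelian_group.a_inv_closed[OF assms(1) c] by (simp add: product_module_simps)
  qed (rule x)
qed

section \<open>Module homomorphisms and direct summands\<close>

lemma hom_finprod:
  assumes "comm_group G" "comm_group H" "h \<in> hom G H" "f \<in> A \<rightarrow> carrier G"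
  shows "h (finprod G f A) = finprod H (\<lambda>i. h (f i)) A"
proof -
  interpret G: comm_group G by fact
  interpret H: comm_group H by fact
  interpret h: group_hom G H h
    using assms(3) by (simp add: group_hom_def group_hom_axioms_def G.is_group H.is_group)
  show ?thesis
    using assms(4)
  proof (induction A rule: infinite_finite_induct)
    case (insert x A)
    then have "(\<lambda>i. h (f i)) \<in> A \<rightarrow> carrier H"
      using hom_in_carrier[OF assms(3)] by (auto simp: Pi_def)
    with insert show ?case by (simp add: Pi_def)
  qed simp_all
qed

lemma mod_hom_imp_hom: "h \<in> mod_hom R M N \<Longrightarrow> h \<in> hom (add_monoid M) (add_monoid N)"
  by (simp add: mod_hom_def)

lemma mod_hom_compose:
  assumes "f \<in> mod_hom R M N" "g \<in> mod_hom R N P"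
  shows "(\<lambda>x. g (f x)) \<in> mod_hom R M P"
  using mod_homD[OF assms(1)] mod_homD[OF assms(2)] by (intro mod_homI) simp_all

lemma mod_hom_cong:
  assumes "f \<in> mod_hom R M N" "\<And>x. x \<in> carrier M \<Longrightarrow> g x = f x" "left_module R M"
  shows "g \<in> mod_hom R M N"
proof -
  interpret left_module R M by fact
  show ?thesis using mod_homD[OF assms(1)] assms(2) by (intro mod_homI) (simp_all add: smult_closed)
qed

lemma mod_hom_finsum:
  assumes "h \<in> mod_hom R M N" "abelian_group M" "abelian_group N" "f \<in> A \<rightarrow> carrier M"
  shows "h (\<Oplus>\<^bsub>M\<^esub>i\<in>A. f i) = (\<Oplus>\<^bsub>N\<^esub>i\<in>A. h (f i))"
  using hom_finprod[OF abelian_group.a_comm_group abelian_group.a_comm_group mod_hom_imp_hom, of M N h R f A]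
    assms by (simp add: finsum_def)

lemma mod_hom_uminus:
  assumes h: "h \<in> mod_hom R M N" and N: "left_module R N"
  shows "(\<lambda>x. \<ominus>\<^bsub>N\<^esub> h x) \<in> mod_hom R M N"
proof -
  interpret N: left_module R N by fact
  show ?thesis
    using mod_hom_closed[OF h]
    by (intro mod_homI)
      (simp_all add: mod_hom_add[OF h] mod_hom_smult[OF h] N.M.minus_add N.smult_minus_right)
qed

lemma mod_hom_inv_into:
  assumes h: "h \<in> mod_hom R M N" and bij: "bij_betw h (carrier M) (carrier N)"
    and "\<And>x y. \<lbrakk>x \<in> carrier M; y \<in> carrier M\<rbrakk> \<Longrightarrow> x \<oplus>\<^bsub>M\<^esub> y \<in> carrier M"
    and "\<And>a x. \<lbrakk>a \<in> carrier R; x \<in> carrier M\<rbrakk> \<Longrightarrow> a \<odot>\<^bsub>M\<^esub> x \<in> carrier M"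
  shows "inv_into (carrier M) h \<in> mod_hom R N M"
proof -
  have inj: "inj_on h (carrier M)" and im: "h ` carrier M = carrier N"
    using bij by (auto simp: bij_betw_def)
  have c: "inv_into (carrier M) h y \<in> carrier M" "h (inv_into (carrier M) h y) = y"
    if "y \<in> carrier N" for y
    using that im by (auto intro: inv_into_into f_inv_into_f)
  show ?thesis
    by (rule mod_homI)
      (auto simp: c mod_homD[OF h] assms(3,4) intro!: inv_into_f_eq[OF inj])
qed

text \<open>
  The form in which direct summands are used: the inclusion and the projection determine the
  two complements as an image and a kernel.
\<close>

lemma direct_summand_iff_retract:
  assumes N: "right_module R N" and P: "right_module R P"
  shows "is_direct_summand R N P \<longleftrightarrow>
    (\<exists>j\<in>mod_hom R N P. \<exists>p\<in>mod_hom R P N. \<forall>x\<in>carrier N. p (j x) = x)"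
proof -
  interpret N: right_module R N by fact
  interpret P: right_module R P by fact
  note NP = N.M.abelian_group_axioms P.M.abelian_group_axioms
  note PN = P.M.abelian_group_axioms N.M.abelian_group_axioms
  show ?thesis
  proof
    assume "is_direct_summand R N P"
    then obtain A A' h where A: "submodule A R P" and A': "submodule A' R P"
      and sum: "A <+>\<^bsub>P\<^esub> A' = carrier P" and int: "A \<inter> A' = {\<zero>\<^bsub>P\<^esub>}"
      and h: "h \<in> mod_hom R N (P\<lparr>carrier := A\<rparr>)" and bij: "bij_betw h (carrier N) A"
      by (auto simp: is_direct_summand_def mod_iso_def)
    interpret A: submodule A R P by fact
    interpret A': submodule A' R P by fact
    have AP: "a \<in> carrier P" if "a \<in> A" for a using that A.subset by auto
    have A'P: "a \<in> carrier P" if "a \<in> A'" for a using that A'.subset by auto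
    have Aadd: "a \<oplus>\<^bsub>P\<^esub> b \<in> A" if "a \<in> A" "b \<in> A" for a b using A.m_closed that by simp
    have A'add: "a \<oplus>\<^bsub>P\<^esub> b \<in> A'" if "a \<in> A'" "b \<in> A'" for a b using A'.m_closed that by simp
    have Ainv: "\<ominus>\<^bsub>P\<^esub> a \<in> A" if "a \<in> A" for a using A.m_inv_closed[OF that] by (simp add: a_inv_def)
    have A'inv: "\<ominus>\<^bsub>P\<^esub> a \<in> A'" if "a \<in> A'" for a using A'.m_inv_closed[OF that] by (simp add: a_inv_def)
    have uniq: "a = b" if "a \<in> A" "b \<in> A" "a' \<in> A'" "b' \<in> A'" "a \<oplus>\<^bsub>P\<^esub> a' = b \<oplus>\<^bsub>P\<^esub> b'" for a b a' b'
    proof -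
      let ?c = "a \<oplus>\<^bsub>P\<^esub> a'"
      have c: "a \<in> carrier P" "b \<in> carrier P" "a' \<in> carrier P" "b' \<in> carrier P" "?c \<in> carrier P"
        using that(1-4) AP A'P by auto
      have "a = ?c \<oplus>\<^bsub>P\<^esub> \<ominus>\<^bsub>P\<^esub> a'" using c by (simp add: P.M.a_assoc P.M.r_neg)
      then have "a \<oplus>\<^bsub>P\<^esub> \<ominus>\<^bsub>P\<^esub> b = ?c \<oplus>\<^bsub>P\<^esub> \<ominus>\<^bsub>P\<^esub> a' \<oplus>\<^bsub>P\<^esub> \<ominus>\<^bsub>P\<^esub> b" by simp
      also have "\<dots> = (\<ominus>\<^bsub>P\<^esub> b \<oplus>\<^bsub>P\<^esub> ?c) \<oplus>\<^bsub>P\<^esub> \<ominus>\<^bsub>P\<^esub> a'"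
        using c(2-5) by (simp only: P.M.a_ac P.M.a_inv_closed P.M.a_closed)
      also have "\<ominus>\<^bsub>P\<^esub> b \<oplus>\<^bsub>P\<^esub> ?c = b'" unfolding that(5) using c by (simp add: P.M.r_neg1)
      finally have e: "a \<oplus>\<^bsub>P\<^esub> \<ominus>\<^bsub>P\<^esub> b = b' \<oplus>\<^bsub>P\<^esub> \<ominus>\<^bsub>P\<^esub> a'" .
      have "a \<oplus>\<^bsub>P\<^esub> \<ominus>\<^bsub>P\<^esub> b \<in> A" using that by (intro Aadd Ainv)
      moreover have "a \<oplus>\<^bsub>P\<^esub> \<ominus>\<^bsub>P\<^esub> b \<in> A'" unfolding e using that by (intro A'add A'inv)
      ultimately have "a \<oplus>\<^bsub>P\<^esub> \<ominus>\<^bsub>P\<^esub> b = \<zero>\<^bsub>P\<^esub>" using int by blast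
      then show ?thesis using that(1,2) AP by (metis P.M.a_inv_closed P.M.minus_equality P.M.minus_minus)
    qed
    define \<pi> where "\<pi> z = (SOME a. a \<in> A \<and> (\<exists>a'\<in>A'. z = a \<oplus>\<^bsub>P\<^esub> a'))" for z
    have \<pi>: "\<pi> (a \<oplus>\<^bsub>P\<^esub> a') = a" if "a \<in> A" "a' \<in> A'" for a a'
      unfolding \<pi>_def by (rule some_equality) (use that uniq in blast)+
    have dec: "\<exists>a\<in>A. \<exists>a'\<in>A'. z = a \<oplus>\<^bsub>P\<^esub> a'" if "z \<in> carrier P" for z
      using that unfolding sum[symmetric] by (auto simp: set_add_def set_mult_def)
    have \<pi>_hom: "\<pi> \<in> mod_hom R P (P\<lparr>carrier := A\<rparr>)"
    proof (rule mod_homI)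
      show "\<pi> z \<in> carrier (P\<lparr>carrier := A\<rparr>)" if "z \<in> carrier P" for z
        using dec[OF that] \<pi> by auto
    next
      fix y z assume y: "y \<in> carrier P" and z: "z \<in> carrier P"
      obtain a a' where a: "a \<in> A" "a' \<in> A'" "y = a \<oplus>\<^bsub>P\<^esub> a'" using dec[OF y] by auto
      obtain b b' where b: "b \<in> A" "b' \<in> A'" "z = b \<oplus>\<^bsub>P\<^esub> b'" using dec[OF z] by auto
      note d = a b
      have "y \<oplus>\<^bsub>P\<^esub> z = (a \<oplus>\<^bsub>P\<^esub> b) \<oplus>\<^bsub>P\<^esub> (a' \<oplus>\<^bsub>P\<^esub> b')" using d AP A'P by (simp add: P.M.a_ac)
      then show "\<pi> (y \<oplus>\<^bsub>P\<^esub> z) = \<pi> y \<oplus>\<^bsub>P\<lparr>carrier := A\<rparr>\<^esub> \<pi> z"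
        using d Aadd A'add by (simp add: \<pi>)
    next
      fix r z assume r: "r \<in> carrier R" and z: "z \<in> carrier P"
      obtain a a' where d: "a \<in> A" "a' \<in> A'" "z = a \<oplus>\<^bsub>P\<^esub> a'" using dec[OF z] by auto
      then show "\<pi> (r \<odot>\<^bsub>P\<^esub> z) = r \<odot>\<^bsub>P\<lparr>carrier := A\<rparr>\<^esub> \<pi> z"
        using r AP A'P by (simp add: \<pi> P.smult_r_distr A.smult_closed A'.smult_closed)
    qed
    have inv: "inv_into (carrier N) h \<in> mod_hom R (P\<lparr>carrier := A\<rparr>) N"
      using bij by (intro mod_hom_inv_into[OF h] N.M.a_closed N.smult_closed) auto
    have hA: "h x \<in> A" if "x \<in> carrier N" for x using bij that by (auto simp: bij_betw_def)
    have "h \<in> mod_hom R N P"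
      using mod_homD[OF h] hA AP by (intro mod_homI) auto
    moreover have "(\<lambda>z. inv_into (carrier N) h (\<pi> z)) \<in> mod_hom R P N"
      using \<pi>_hom inv by (rule mod_hom_compose)
    moreover have "inv_into (carrier N) h (\<pi> (h x)) = x" if "x \<in> carrier N" for x
    proof -
      have "\<zero>\<^bsub>P\<^esub> \<in> A'" using int by blast
      then have "\<pi> (h x) = h x" using \<pi>[OF hA[OF that], of "\<zero>\<^bsub>P\<^esub>"] AP[OF hA[OF that]] by simp
      then show ?thesis using bij that by (simp add: bij_betw_inv_into_left)
    qed
    ultimately show "\<exists>j\<in>mod_hom R N P. \<exists>p\<in>mod_hom R P N. \<forall>x\<in>carrier N. p (j x) = x"
      by (intro bexI[of _ h] bexI[of _ "\<lambda>z. inv_into (carrier N) h (\<pi> z)"] ballI)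
  next
    assume "\<exists>j\<in>mod_hom R N P. \<exists>p\<in>mod_hom R P N. \<forall>x\<in>carrier N. p (j x) = x"
    then obtain j p where j: "j \<in> mod_hom R N P" and p: "p \<in> mod_hom R P N"
      and pj: "\<And>x. x \<in> carrier N \<Longrightarrow> p (j x) = x" by auto
    have jz: "j \<zero>\<^bsub>N\<^esub> = \<zero>\<^bsub>P\<^esub>" "p \<zero>\<^bsub>P\<^esub> = \<zero>\<^bsub>N\<^esub>" using j p NP PN by (auto intro: mod_hom_zero)
    have jm: "\<ominus>\<^bsub>P\<^esub> j x = j (\<ominus>\<^bsub>N\<^esub> x)" if "x \<in> carrier N" for x
      using mod_hom_minus[OF j NP that] by simp
    have pm: "p (\<ominus>\<^bsub>P\<^esub> z) = \<ominus>\<^bsub>N\<^esub> p z" if "z \<in> carrier P" for z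
      using mod_hom_minus[OF p PN that] .
    note jc = mod_hom_closed[OF j] and pc = mod_hom_closed[OF p]
    let ?A = "j ` carrier N" and ?K = "{z \<in> carrier P. p z = \<zero>\<^bsub>N\<^esub>}"
    have "submodule ?A R P"
    proof
      show "?A \<subseteq> carrier (add_monoid P)" using jc by auto
      show "\<one>\<^bsub>add_monoid P\<^esub> \<in> ?A" using jz by (auto intro!: image_eqI[of _ j "\<zero>\<^bsub>N\<^esub>"])
      show "x \<otimes>\<^bsub>add_monoid P\<^esub> y \<in> ?A" if "x \<in> ?A" "y \<in> ?A" for x y
        using that by (auto simp flip: mod_hom_add[OF j])
      show "inv\<^bsub>add_monoid P\<^esub> x \<in> ?A" if "x \<in> ?A" for x
        using that by (auto simp: jm simp flip: a_inv_def)
      show "a \<odot>\<^bsub>P\<^esub> x \<in> ?A" if "a \<in> carrier R" "x \<in> ?A" for a x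
        using that by (auto simp: N.smult_closed simp flip: mod_hom_smult[OF j])
    qed
    moreover have "submodule ?K R P"
    proof
      show "a \<odot>\<^bsub>P\<^esub> x \<in> ?K" if "a \<in> carrier R" "x \<in> ?K" for a x
      proof -
        have "p (a \<odot>\<^bsub>P\<^esub> x) = a \<odot>\<^bsub>N\<^esub> \<zero>\<^bsub>N\<^esub>" using that by (simp add: mod_hom_smult[OF p])
        also have "\<dots> = \<zero>\<^bsub>N\<^esub>"
          using left_module.smult_zero_right[OF left_module_opposite_ring[OF N]] that by simp
        finally show ?thesis using that by (simp add: P.smult_closed)
      qed
    qed (auto simp: jz pm mod_hom_add[OF p] simp flip: a_inv_def)
    moreover have "?A <+>\<^bsub>P\<^esub> ?K = carrier P"
    proof
      show "?A <+>\<^bsub>P\<^esub> ?K \<subseteq> carrier P" using jc by (auto simp: set_add_def set_mult_def)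
      show "carrier P \<subseteq> ?A <+>\<^bsub>P\<^esub> ?K"
      proof
        fix z assume z: "z \<in> carrier P"
        have jp: "j (p z) \<in> carrier P" using z pc jc by simp
        have "p (z \<oplus>\<^bsub>P\<^esub> \<ominus>\<^bsub>P\<^esub> j (p z)) = \<zero>\<^bsub>N\<^esub>"
          using z jp pc by (simp add: mod_hom_add[OF p] pm pj N.M.r_neg)
        then have "z \<oplus>\<^bsub>P\<^esub> \<ominus>\<^bsub>P\<^esub> j (p z) \<in> ?K" using z jp by simp
        moreover have "z = j (p z) \<oplus>\<^bsub>P\<^esub> (z \<oplus>\<^bsub>P\<^esub> \<ominus>\<^bsub>P\<^esub> j (p z))"
          using z jp by (metis P.M.a_inv_closed P.M.a_lcomm P.M.r_neg P.M.r_zero)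
        ultimately show "z \<in> ?A <+>\<^bsub>P\<^esub> ?K" using pc[OF z] unfolding set_add_def set_mult_def by auto
      qed
    qed
    moreover have "?A \<inter> ?K = {\<zero>\<^bsub>P\<^esub>}"
      using jz jc pj by (auto intro!: image_eqI[of _ j "\<zero>\<^bsub>N\<^esub>"])
    moreover have "mod_iso R N (P\<lparr>carrier := ?A\<rparr>)"
      unfolding mod_iso_def
    proof (intro bexI)
      show "bij_betw j (carrier N) (carrier (P\<lparr>carrier := ?A\<rparr>))"
        using pj by (auto simp: bij_betw_def intro!: inj_on_inverseI[of _ p])
      show "j \<in> mod_hom R N (P\<lparr>carrier := ?A\<rparr>)"
        using mod_homD[OF j] by (intro mod_homI) auto
    qed
    ultimately show "is_direct_summand R N P"
      unfolding is_direct_summand_def by (intro exI[of _ ?A] exI[of _ ?K] conjI)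
  qed
qed

section \<open>Duality for finite systems of linear equations\<close>

lemma (in comm_monoid) finprod_swap:
  assumes "finite A" "finite B" "\<And>i j. \<lbrakk>i \<in> A; j \<in> B\<rbrakk> \<Longrightarrow> f i j \<in> carrier G"
  shows "(\<Otimes>i\<in>A. \<Otimes>j\<in>B. f i j) = (\<Otimes>j\<in>B. \<Otimes>i\<in>A. f i j)"
  using assms(1,3)
proof (induction A rule: finite_induct)
  case (insert i A)
  have c: "(\<lambda>j. f i j) \<in> B \<rightarrow> carrier G" "(\<lambda>j. \<Otimes>i\<in>A. f i j) \<in> B \<rightarrow> carrier G"
    "(\<lambda>i. \<Otimes>j\<in>B. f i j) \<in> A \<rightarrow> carrier G" "(\<Otimes>j\<in>B. f i j) \<in> carrier G"
    using insert.prems by (auto intro!: finprod_closed)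
  have "(\<Otimes>i\<in>insert i A. \<Otimes>j\<in>B. f i j) = (\<Otimes>j\<in>B. f i j) \<otimes> (\<Otimes>j\<in>B. \<Otimes>i\<in>A. f i j)"
    using insert c by simp
  also have "\<dots> = (\<Otimes>j\<in>B. f i j \<otimes> (\<Otimes>i\<in>A. f i j))"
    using c by (simp add: finprod_multf)
  also have "\<dots> = (\<Otimes>j\<in>B. \<Otimes>i\<in>insert i A. f i j)"
    using insert c by (intro finprod_cong') (auto simp: Pi_def)
  finally show ?case .
qed simp

lemma finprod_hom_QZ:
  assumes "finite J" "\<And>j. j \<in> J \<Longrightarrow> f j \<in> hom A QZ"
  shows "(\<lambda>y. \<Otimes>\<^bsub>QZ\<^esub>j\<in>J. f j y) \<in> hom A QZ"
proof (rule homI)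
  have c: "f j y \<in> carrier QZ" if "j \<in> J" "y \<in> carrier A" for j y
    using hom_in_carrier[OF assms(2)] that by blast
  show "(\<Otimes>\<^bsub>QZ\<^esub>j\<in>J. f j y) \<in> carrier QZ" if "y \<in> carrier A" for y
    using c that by (intro QZ.finprod_closed) auto
  fix x y assume xy: "x \<in> carrier A" "y \<in> carrier A"
  have "(\<Otimes>\<^bsub>QZ\<^esub>j\<in>J. f j (x \<otimes>\<^bsub>A\<^esub> y)) = (\<Otimes>\<^bsub>QZ\<^esub>j\<in>J. f j x \<otimes>\<^bsub>QZ\<^esub> f j y)"
    using xy c assms(2) by (intro QZ.finprod_cong') (auto simp: hom_def)
  also have "\<dots> = (\<Otimes>\<^bsub>QZ\<^esub>j\<in>J. f j x) \<otimes>\<^bsub>QZ\<^esub> (\<Otimes>\<^bsub>QZ\<^esub>j\<in>J. f j y)"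
    using xy c by (intro QZ.finprod_multf) auto
  finally show "(\<Otimes>\<^bsub>QZ\<^esub>j\<in>J. f j (x \<otimes>\<^bsub>A\<^esub> y)) = (\<Otimes>\<^bsub>QZ\<^esub>j\<in>J. f j x) \<otimes>\<^bsub>QZ\<^esub> (\<Otimes>\<^bsub>QZ\<^esub>j\<in>J. f j y)" .
qed

text \<open>
  Exactness of the dual: the annihilator of the intersection of finitely many kernels is the sum
  of the annihilators.  For the coordinate maps of a power \<open>M\<^sup>n\<close> it says that
  characters of \<open>M\<^sup>n\<close> are \<open>n\<close>-tuples of characters, and for the maps given by linear equations it describes
  the characters that vanish on all solutions.
\<close>

lemma char_through_finite_family:
  assumes A: "comm_group A" and M: "abelian_group M" and "finite S"
    and \<rho>: "\<And>s. s \<in> S \<Longrightarrow> \<rho> s \<in> hom A (add_monoid M)" and \<chi>: "\<chi> \<in> hom A QZ"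
    and ker: "\<And>y. \<lbrakk>y \<in> carrier A; \<And>s. s \<in> S \<Longrightarrow> \<rho> s y = \<zero>\<^bsub>M\<^esub>\<rbrakk> \<Longrightarrow> \<chi> y = \<one>\<^bsub>QZ\<^esub>"
  shows "\<exists>t. (\<forall>s\<in>S. t s \<in> carrier (character_module M)) \<and>
    (\<forall>y\<in>carrier A. \<chi> y = (\<Otimes>\<^bsub>QZ\<^esub>s\<in>S. t s (\<rho> s y)))"
  using assms(3) \<rho> \<chi> ker
proof (induction S arbitrary: \<chi> rule: finite_induct)
  case empty
  then show ?case by auto
next
  case (insert s S)
  interpret A: comm_group A by fact
  interpret M: abelian_group M by fact
  \<comment> \<open>on the common kernel \<open>Y\<close> of the other maps, \<open>\<chi>\<close> factors through \<open>\<rho> s\<close>; dividing by an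
    extension of that factor leaves a character that kills \<open>Y\<close>\<close>
  define Y where "Y = {y \<in> carrier A. \<forall>s'\<in>S. \<rho> s' y = \<zero>\<^bsub>M\<^esub>}"
  have gh: "group_hom A (add_monoid M) (\<rho> s')" if "s' \<in> insert s S" for s'
    using insert.prems(1)[OF that] by (simp add: group_hom_def group_hom_axioms_def A.is_group M.a_group)
  interpret \<chi>: group_hom A QZ \<chi>
    using insert.prems(2) by (simp add: group_hom_def group_hom_axioms_def A.is_group QZ.is_group)
  have Y: "subgroup Y A"
  proof
    show "\<one>\<^bsub>A\<^esub> \<in> Y" using group_hom.hom_one[OF gh] by (auto simp: Y_def)
    show "inv\<^bsub>A\<^esub> y \<in> Y" if "y \<in> Y" for y
    proof -
      have "\<rho> s' (inv\<^bsub>A\<^esub> y) = \<zero>\<^bsub>M\<^esub>" if "s' \<in> S" for s'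
        using group_hom.hom_inv[OF gh, of s' y] that \<open>y \<in> Y\<close>
        by (simp add: Y_def flip: a_inv_def)
      then show ?thesis using that by (simp add: Y_def)
    qed
  qed (use group_hom.hom_mult[OF gh] in \<open>auto simp: Y_def\<close>)
  let ?Y = "A\<lparr>carrier := Y\<rparr>"
  have YA: "y \<in> carrier A" if "y \<in> Y" for y using that by (simp add: Y_def)
  have "\<exists>\<psi>\<in>hom (add_monoid M) QZ. \<forall>y\<in>carrier ?Y. \<psi> (\<rho> s y) = \<chi> y"
  proof (rule char_extends_along)
    show "group ?Y" using A.subgroup_imp_group[OF Y] .
    show "comm_group (add_monoid M)" by (rule M.a_comm_group)
    show "\<rho> s \<in> hom ?Y (add_monoid M)" "\<chi> \<in> hom ?Y QZ"
      using insert.prems(1)[of s] insert.prems(2) YA by (auto simp: hom_def Pi_def)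
    show "\<chi> y = \<one>\<^bsub>QZ\<^esub>" if "y \<in> carrier ?Y" "\<rho> s y = \<one>\<^bsub>add_monoid M\<^esub>" for y
      using that by (intro insert.prems(3)) (auto simp: Y_def)
  qed
  then obtain \<psi> where \<psi>: "\<psi> \<in> hom (add_monoid M) QZ" "\<And>y. y \<in> Y \<Longrightarrow> \<psi> (\<rho> s y) = \<chi> y" by auto
  define ts where "ts = restrict \<psi> (carrier M)"
  have ts: "ts \<in> carrier (character_module M)"
    using \<psi>(1) by (auto simp: ts_def character_module_simps hom_def)
  have \<rho>c: "\<rho> s' y \<in> carrier M" if "y \<in> carrier A" "s' \<in> insert s S" for s' y
    using group_hom.hom_closed[OF gh[OF that(2)] that(1)] by simp
  have tsc: "ts (\<rho> s y) \<in> carrier QZ" if "y \<in> carrier A" for y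
    using character_closed[OF ts] \<rho>c that by blast
  define \<chi>' where "\<chi>' y = \<chi> y \<otimes>\<^bsub>QZ\<^esub> inv\<^bsub>QZ\<^esub> ts (\<rho> s y)" for y
  have "\<exists>t. (\<forall>s\<in>S. t s \<in> carrier (character_module M)) \<and>
    (\<forall>y\<in>carrier A. \<chi>' y = (\<Otimes>\<^bsub>QZ\<^esub>s\<in>S. t s (\<rho> s y)))"
  proof (rule insert.IH)
    show "\<chi>' \<in> hom A QZ"
    proof (rule homI)
      fix x y assume xy: "x \<in> carrier A" "y \<in> carrier A"
      have "ts (\<rho> s (x \<otimes>\<^bsub>A\<^esub> y)) = ts (\<rho> s x) \<otimes>\<^bsub>QZ\<^esub> ts (\<rho> s y)"
        using group_hom.hom_mult[OF gh xy, of s] character_add[OF ts] \<rho>c xy by simp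
      then show "\<chi>' (x \<otimes>\<^bsub>A\<^esub> y) = \<chi>' x \<otimes>\<^bsub>QZ\<^esub> \<chi>' y"
        using xy tsc by (simp add: \<chi>'_def QZ.inv_mult QZ.m_ac)
    qed (use tsc in \<open>simp add: \<chi>'_def\<close>)
    show "\<chi>' y = \<one>\<^bsub>QZ\<^esub>" if "y \<in> carrier A" "\<And>s'. s' \<in> S \<Longrightarrow> \<rho> s' y = \<zero>\<^bsub>M\<^esub>" for y
    proof -
      have "y \<in> Y" using that by (simp add: Y_def)
      then have "ts (\<rho> s y) = \<chi> y" using \<psi>(2) \<rho>c that(1) by (simp add: ts_def)
      then show ?thesis using that(1) by (simp add: \<chi>'_def)
    qed
  qed (use insert.prems(1) in blast)
  then obtain t where t: "\<And>s. s \<in> S \<Longrightarrow> t s \<in> carrier (character_module M)"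
    and \<chi>': "\<And>y. y \<in> carrier A \<Longrightarrow> \<chi>' y = (\<Otimes>\<^bsub>QZ\<^esub>s\<in>S. t s (\<rho> s y))" by blast
  have "\<chi> y = (\<Otimes>\<^bsub>QZ\<^esub>s'\<in>insert s S. (t(s := ts)) s' (\<rho> s' y))" if y: "y \<in> carrier A" for y
  proof -
    have tc: "t s' (\<rho> s' y) \<in> carrier QZ" if "s' \<in> S" for s'
      using character_closed[OF t[OF that] \<rho>c[OF y]] that by simp
    have "(\<Otimes>\<^bsub>QZ\<^esub>s'\<in>S. (t(s := ts)) s' (\<rho> s' y)) = \<chi>' y"
      unfolding \<chi>'[OF y] using insert.hyps(2) tc by (intro QZ.finprod_cong') auto
    moreover have "(\<lambda>s'. (t(s := ts)) s' (\<rho> s' y)) \<in> S \<rightarrow> carrier QZ"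
      using tc tsc[OF y] by auto
    ultimately show ?thesis
      using insert.hyps tsc[OF y] y \<chi>.hom_closed[OF y]
      by (simp add: \<chi>'_def QZ.m_ac)
  qed
  then show ?case using t ts insert.hyps(2) by (intro exI[of _ "t(s := ts)"]) auto
qed

definition lincomb :: "('r, 'a, 'z) module_scheme \<Rightarrow> 'j set \<Rightarrow> ('j \<Rightarrow> 'r) \<Rightarrow> ('j \<Rightarrow> 'a) \<Rightarrow> 'a"
  where "lincomb M J a y = (\<Oplus>\<^bsub>M\<^esub>j\<in>J. a j \<odot>\<^bsub>M\<^esub> y j)"

text \<open>
  Solutions of the homogeneous system whose rows are the elements of \<open>S\<close>.  They correspond to the
  homomorphisms to \<open>M\<close> from the module with generators \<open>J\<close> and relations \<open>S\<close>.
\<close>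

definition solutions :: "('r, 'a, 'z) module_scheme \<Rightarrow> 'j set \<Rightarrow> ('j \<Rightarrow> 'r) set \<Rightarrow> ('j \<Rightarrow> 'a) set"
  where "solutions M J S = {y \<in> J \<rightarrow> carrier M. \<forall>a\<in>S. lincomb M J a y = \<zero>\<^bsub>M\<^esub>}"

lemma (in left_module) lincomb_closed:
  assumes "a \<in> J \<rightarrow> carrier R" "y \<in> J \<rightarrow> carrier M"
  shows "lincomb M J a y \<in> carrier M"
  unfolding lincomb_def using assms by (intro M.finsum_closed) (auto intro: smult_closed)

lemma lincomb_cong:
  assumes "\<And>j. j \<in> J \<Longrightarrow> a j = b j" "\<And>j. j \<in> J \<Longrightarrow> y j = z j"
    and "left_module R M" "b \<in> J \<rightarrow> carrier R" "z \<in> J \<rightarrow> carrier M"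
  shows "lincomb M J a y = lincomb M J b z"
proof -
  interpret left_module R M by fact
  show ?thesis unfolding lincomb_def
    using assms by (intro M.finsum_cong') (auto intro!: smult_closed)
qed

lemma lincomb_add:
  assumes M: "left_module R M" and a: "a \<in> J \<rightarrow> carrier R"
    and y: "y \<in> J \<rightarrow> carrier M" and z: "z \<in> J \<rightarrow> carrier M"
  shows "lincomb M J a (\<lambda>j. y j \<oplus>\<^bsub>M\<^esub> z j) = lincomb M J a y \<oplus>\<^bsub>M\<^esub> lincomb M J a z"
proof -
  interpret M: left_module R M by fact
  note c = funcset_mem[OF a] funcset_mem[OF y] funcset_mem[OF z]
  have "lincomb M J a (\<lambda>j. y j \<oplus>\<^bsub>M\<^esub> z j) = (\<Oplus>\<^bsub>M\<^esub>j\<in>J. a j \<odot>\<^bsub>M\<^esub> y j \<oplus>\<^bsub>M\<^esub> a j \<odot>\<^bsub>M\<^esub> z j)"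
    unfolding lincomb_def using c
    by (intro M.M.finsum_cong') (auto simp: M.smult_r_distr M.smult_closed)
  also have "\<dots> = lincomb M J a y \<oplus>\<^bsub>M\<^esub> lincomb M J a z"
    unfolding lincomb_def using c by (intro M.M.finsum_addf) (auto simp: M.smult_closed)
  finally show ?thesis .
qed

lemma mod_hom_lincomb:
  assumes h: "h \<in> mod_hom R M N" and "abelian_group M" "abelian_group N"
    and smult: "\<And>a x. \<lbrakk>a \<in> carrier R; x \<in> carrier M\<rbrakk> \<Longrightarrow> a \<odot>\<^bsub>M\<^esub> x \<in> carrier M"
    and a: "a \<in> J \<rightarrow> carrier R" and y: "y \<in> J \<rightarrow> carrier M"
  shows "h (lincomb M J a y) = lincomb N J a (\<lambda>j. h (y j))"
proof -
  interpret N: abelian_group N by fact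
  have ay: "a j \<odot>\<^bsub>M\<^esub> y j \<in> carrier M" if "j \<in> J" for j using a y that smult by auto
  have "h (lincomb M J a y) = (\<Oplus>\<^bsub>N\<^esub>j\<in>J. h (a j \<odot>\<^bsub>M\<^esub> y j))"
    unfolding lincomb_def using ay by (intro mod_hom_finsum[OF assms(1-3)]) auto
  also have "\<dots> = lincomb N J a (\<lambda>j. h (y j))"
    unfolding lincomb_def
  proof (rule N.finsum_cong')
    have "h (a j \<odot>\<^bsub>M\<^esub> y j) = a j \<odot>\<^bsub>N\<^esub> h (y j)" if "j \<in> J" for j
      using a y that by (intro mod_hom_smult[OF h]) auto
    moreover have "h (a j \<odot>\<^bsub>M\<^esub> y j) \<in> carrier N" if "j \<in> J" for j
      using ay[OF that] by (rule mod_hom_closed[OF h])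
    ultimately show "(\<lambda>j. a j \<odot>\<^bsub>N\<^esub> h (y j)) \<in> J \<rightarrow> carrier N"
      "\<And>j. j \<in> J \<Longrightarrow> h (a j \<odot>\<^bsub>M\<^esub> y j) = a j \<odot>\<^bsub>N\<^esub> h (y j)"
      by auto
  qed auto
  finally show ?thesis .
qed

lemma left_mod_hom_lincomb:
  assumes "h \<in> mod_hom R M N" "left_module R M" "left_module R N"
    and "a \<in> J \<rightarrow> carrier R" "y \<in> J \<rightarrow> carrier M"
  shows "h (lincomb M J a y) = lincomb N J a (\<lambda>j. h (y j))"
proof -
  interpret M: left_module R M by fact
  interpret N: left_module R N by fact
  show ?thesis
    using assms(1,4,5) M.M.abelian_group_axioms N.M.abelian_group_axioms M.smult_closed
    by (intro mod_hom_lincomb)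
qed

lemma solutions_mod_hom:
  assumes "h \<in> mod_hom R M N" "left_module R M" "left_module R N"
    and "\<And>s. s \<in> S \<Longrightarrow> s \<in> J \<rightarrow> carrier R" "y \<in> solutions M J S"
  shows "(\<lambda>j. h (y j)) \<in> solutions N J S"
proof -
  have "h \<zero>\<^bsub>M\<^esub> = \<zero>\<^bsub>N\<^esub>"
    using assms(1-3) by (intro mod_hom_zero) (auto simp: left_module_def)
  then show ?thesis
    using assms(5) mod_hom_closed[OF assms(1)] left_mod_hom_lincomb[OF assms(1-3), of _ J y] assms(4)
    by (fastforce simp: solutions_def)
qed

lemma lincomb_character_module:
  assumes M: "left_module R M" and b: "b \<in> S \<rightarrow> carrier R"
    and t: "t \<in> S \<rightarrow> carrier (character_module M)" and x: "x \<in> carrier M"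
  shows "lincomb (character_module M) S b t x = (\<Otimes>\<^bsub>QZ\<^esub>s\<in>S. t s (b s \<odot>\<^bsub>M\<^esub> x))"
proof -
  interpret M: left_module R M by fact
  interpret C: right_module R "character_module M" using M by (rule right_module_character_module)
  have ev: "(\<lambda>c. c x) \<in> hom (add_monoid (character_module M)) QZ"
    using x by (auto simp: hom_def character_closed character_module_simps(3))
  have bt: "b s \<odot>\<^bsub>character_module M\<^esub> t s \<in> carrier (character_module M)" if "s \<in> S" for s
    using b t that by (auto intro!: C.smult_closed)
  have "lincomb (character_module M) S b t x = (\<Otimes>\<^bsub>QZ\<^esub>s\<in>S. (b s \<odot>\<^bsub>character_module M\<^esub> t s) x)"
    unfolding lincomb_def finsum_def
    using bt by (intro hom_finprod[OF C.M.a_comm_group comm_group_QZ ev]) auto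
  also have "\<dots> = (\<Otimes>\<^bsub>QZ\<^esub>s\<in>S. t s (b s \<odot>\<^bsub>M\<^esub> x))"
  proof (rule QZ.finprod_cong')
    show "(\<lambda>s. t s (b s \<odot>\<^bsub>M\<^esub> x)) \<in> S \<rightarrow> carrier QZ"
      using b t x by (auto intro!: character_closed[where M=M] M.smult_closed)
  qed (use x in \<open>auto simp: character_module_simps(4)\<close>)
  finally show ?thesis .
qed

text \<open>
  A matrix acts on tuples of elements and, transposed, on tuples of characters, and
  the two actions are adjoint with respect to evaluation.
\<close>

lemma pairing_transpose:
  assumes M: "left_module R M" and "finite J" "finite S"
    and a: "\<And>s j. \<lbrakk>s \<in> S; j \<in> J\<rbrakk> \<Longrightarrow> a s j \<in> carrier R"
    and t: "t \<in> S \<rightarrow> carrier (character_module M)" and y: "y \<in> J \<rightarrow> carrier M"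
  shows "(\<Otimes>\<^bsub>QZ\<^esub>j\<in>J. lincomb (character_module M) S (\<lambda>s. a s j) t (y j)) =
    (\<Otimes>\<^bsub>QZ\<^esub>s\<in>S. t s (lincomb M J (a s) y))"
proof -
  interpret M: left_module R M by fact
  have c: "t s (a s j \<odot>\<^bsub>M\<^esub> y j) \<in> carrier QZ" if "s \<in> S" "j \<in> J" for s j
    using that a t y by (auto intro!: character_closed[where M=M] M.smult_closed)
  have inner: "(\<lambda>j. t s (a s j \<odot>\<^bsub>M\<^esub> y j)) \<in> J \<rightarrow> carrier QZ" if "s \<in> S" for s using c that by auto
  have "(\<Otimes>\<^bsub>QZ\<^esub>j\<in>J. lincomb (character_module M) S (\<lambda>s. a s j) t (y j)) =
      (\<Otimes>\<^bsub>QZ\<^esub>j\<in>J. \<Otimes>\<^bsub>QZ\<^esub>s\<in>S. t s (a s j \<odot>\<^bsub>M\<^esub> y j))"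
    using a t y c by (intro QZ.finprod_cong' lincomb_character_module[OF M]) (auto intro!: QZ.finprod_closed)
  also have "\<dots> = (\<Otimes>\<^bsub>QZ\<^esub>s\<in>S. \<Otimes>\<^bsub>QZ\<^esub>j\<in>J. t s (a s j \<odot>\<^bsub>M\<^esub> y j))"
    using assms(2,3) c by (intro QZ.finprod_swap)
  also have "\<dots> = (\<Otimes>\<^bsub>QZ\<^esub>s\<in>S. t s (lincomb M J (a s) y))"
  proof (rule QZ.finprod_cong')
    show "(\<lambda>s. t s (lincomb M J (a s) y)) \<in> S \<rightarrow> carrier QZ"
      using t a y by (auto intro!: character_closed[where M=M] M.lincomb_closed)
    fix s assume s: "s \<in> S"
    have "t s \<in> hom (add_monoid M) QZ" using t s by (auto simp: character_module_simps(1))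
    then show "(\<Otimes>\<^bsub>QZ\<^esub>j\<in>J. t s (a s j \<odot>\<^bsub>M\<^esub> y j)) = t s (lincomb M J (a s) y)"
      unfolding lincomb_def finsum_def
      using s a y
      by (intro hom_finprod[symmetric, OF M.M.a_comm_group comm_group_QZ]) (auto intro!: M.smult_closed)
  qed simp
  finally show ?thesis .
qed

lemma left_module_finite_product:
  assumes "ring R" "finite I" "\<And>i. i \<in> I \<Longrightarrow> left_module R (M i)"
  shows "left_module R (product_module I M)"
proof -
  have "product_module I M = direct_sum_module I M"
    using assms(2) by (simp add: direct_sum_module_def)
  then show ?thesis using left_module_direct_sum[OF assms(1,3)] by simp
qed

text \<open>
  A tuple of characters that kills all solutions of a system is a combination of its rows
  with characters as coefficients.  This replaces the injectivity of \<open>M\<^sup>+ \<otimes> Q \<rightarrow> Hom(Q, M)\<^sup>+\<close> for finitely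
  presented \<open>Q\<close>.
\<close>

lemma solutions_annihilator:
  assumes M: "left_module R M" and fin: "finite J" "finite S"
    and S: "\<And>s. s \<in> S \<Longrightarrow> s \<in> J \<rightarrow> carrier R"
    and d: "d \<in> J \<rightarrow> carrier (character_module M)"
    and ann: "\<And>y. y \<in> solutions M J S \<Longrightarrow> (\<Otimes>\<^bsub>QZ\<^esub>j\<in>J. d j (y j)) = \<one>\<^bsub>QZ\<^esub>"
  shows "\<exists>t. t \<in> S \<rightarrow> carrier (character_module M) \<and>
    (\<forall>j\<in>J. d j = lincomb (character_module M) S (\<lambda>s. s j) t)"
proof -
  interpret M: left_module R M by fact
  interpret P: left_module R "product_module J (\<lambda>_. M)"
    using M.R.ring_axioms fin(1) M by (rule left_module_finite_product)
  interpret C: right_module R "character_module M" using M by (rule right_module_character_module)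
  let ?A = "add_monoid (product_module J (\<lambda>_. M))"
  have car: "y \<in> carrier (product_module J (\<lambda>_. M)) \<longleftrightarrow> y \<in> J \<rightarrow>\<^sub>E carrier M" for y by (simp add: product_module_simps)
  have proj: "(\<lambda>y. y j) \<in> mod_hom R (product_module J (\<lambda>_. M)) M" if "j \<in> J" for j
    using that by (intro mod_homI) (auto simp: product_module_simps)
  define \<chi> where "\<chi> y = (\<Otimes>\<^bsub>QZ\<^esub>j\<in>J. d j (y j))" for y
  have \<chi>_hom: "\<chi> \<in> hom ?A QZ"
    unfolding \<chi>_def
  proof (rule finprod_hom_QZ[OF fin(1)])
    fix j assume j: "j \<in> J"
    then have "d j \<in> hom (add_monoid M) QZ" using d by (auto simp: character_module_simps(1))
    from hom_compose[OF mod_hom_imp_hom[OF proj[OF j]] this]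
    show "(\<lambda>y. d j (y j)) \<in> hom ?A QZ" by (simp add: o_def)
  qed
  have row_hom: "lincomb M J s \<in> hom ?A (add_monoid M)" if s: "s \<in> S" for s
  proof (rule homI)
    show "lincomb M J s y \<in> carrier (add_monoid M)" if "y \<in> carrier ?A" for y
      using that S[OF s] by (auto simp: car intro!: M.lincomb_closed)
    fix y z assume y: "y \<in> carrier ?A" and z: "z \<in> carrier ?A"
    have yz: "y \<in> J \<rightarrow> carrier M" "z \<in> J \<rightarrow> carrier M" using y z by (auto simp: car)
    have "lincomb M J s (y \<otimes>\<^bsub>?A\<^esub> z) = lincomb M J s (\<lambda>j. y j \<oplus>\<^bsub>M\<^esub> z j)"
      using S[OF s] funcset_mem[OF yz(1)] funcset_mem[OF yz(2)]
      by (intro lincomb_cong[OF _ _ M]) (auto simp: product_module_simps)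
    also have "\<dots> = lincomb M J s y \<oplus>\<^bsub>M\<^esub> lincomb M J s z"
      by (rule lincomb_add[OF M S[OF s] yz])
    finally show "lincomb M J s (y \<otimes>\<^bsub>?A\<^esub> z) = lincomb M J s y \<otimes>\<^bsub>add_monoid M\<^esub> lincomb M J s z" by simp
  qed
  have ker: "\<chi> y = \<one>\<^bsub>QZ\<^esub>" if "y \<in> carrier ?A" "\<And>s. s \<in> S \<Longrightarrow> lincomb M J s y = \<zero>\<^bsub>M\<^esub>" for y
    unfolding \<chi>_def using that by (intro ann) (auto simp: solutions_def car)
  have "\<exists>t. (\<forall>s\<in>S. t s \<in> carrier (character_module M)) \<and>
      (\<forall>y\<in>carrier ?A. \<chi> y = (\<Otimes>\<^bsub>QZ\<^esub>s\<in>S. t s (lincomb M J s y)))"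
    by (rule char_through_finite_family[OF P.M.a_comm_group M.M.abelian_group_axioms fin(2)])
      (fact row_hom \<chi>_hom ker)+
  then obtain t where t0: "\<forall>s\<in>S. t s \<in> carrier (character_module M)"
    and \<chi>0: "\<forall>y\<in>carrier ?A. \<chi> y = (\<Otimes>\<^bsub>QZ\<^esub>s\<in>S. t s (lincomb M J s y))"
    by (elim exE conjE) (rule that)
  have t: "t \<in> S \<rightarrow> carrier (character_module M)" using t0 by simp
  note \<chi> = bspec[OF \<chi>0]
  have "d j = lincomb (character_module M) S (\<lambda>s. s j) t" if j: "j \<in> J" for j
  proof (rule extensionalityI)
    show "d j \<in> extensional (carrier M)" using d j by (auto simp: character_module_simps(1))
    have Sj: "(\<lambda>s. s j) \<in> S \<rightarrow> carrier R" using S j by auto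
    have "lincomb (character_module M) S (\<lambda>s. s j) t \<in> carrier (character_module M)"
      unfolding lincomb_def using Sj t by (intro C.M.finsum_closed) (auto intro!: C.smult_closed)
    then show "lincomb (character_module M) S (\<lambda>s. s j) t \<in> extensional (carrier M)"
      by (simp add: character_module_simps(1))
    fix x assume x: "x \<in> carrier M"
    \<comment> \<open>test on the vector with the single entry \<open>x\<close> at \<open>j\<close>\<close>
    let ?y = "coproj J (\<lambda>_. M) j x"
    have y: "?y \<in> carrier ?A" using x by (auto simp: car coproj_def)
    have dx: "d k x \<in> carrier QZ" "d k \<zero>\<^bsub>M\<^esub> = \<one>\<^bsub>QZ\<^esub>" if "k \<in> J" for k
      using d that x character_closed[of "d k" M x] character_zero[of "d k" M] M.M.abelian_group_axioms by auto
    have "\<chi> ?y = (\<Otimes>\<^bsub>QZ\<^esub>k\<in>J. if j = k then d k x else \<one>\<^bsub>QZ\<^esub>)"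
      unfolding \<chi>_def by (intro QZ.finprod_cong') (auto simp: coproj_def dx)
    also have "\<dots> = d j x"
      using j fin(1) dx by (intro QZ.finprod_singleton) auto
    finally have 1: "\<chi> ?y = d j x" .
    have "lincomb M J s ?y = s j \<odot>\<^bsub>M\<^esub> x" if s: "s \<in> S" for s
    proof -
      have c: "s k \<in> carrier R" if "k \<in> J" for k using S[OF s] that by auto
      have "lincomb M J s ?y = (\<Oplus>\<^bsub>M\<^esub>k\<in>J. if j = k then s k \<odot>\<^bsub>M\<^esub> x else \<zero>\<^bsub>M\<^esub>)"
        unfolding lincomb_def using c x
        by (intro M.M.finsum_cong') (auto simp: coproj_def M.smult_zero_right intro!: M.smult_closed)
      also have "\<dots> = s j \<odot>\<^bsub>M\<^esub> x"
        using c x j fin(1) by (intro M.M.add.finprod_singleton) (auto intro!: M.smult_closed)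
      finally show ?thesis .
    qed
    then have "\<chi> ?y = (\<Otimes>\<^bsub>QZ\<^esub>s\<in>S. t s (s j \<odot>\<^bsub>M\<^esub> x))"
      unfolding \<chi>[OF y] using Sj t x
      by (intro QZ.finprod_cong') (auto intro!: character_closed[where M=M] M.smult_closed)
    then show "d j x = lincomb (character_module M) S (\<lambda>s. s j) t x"
      using 1 lincomb_character_module[OF M Sj t x] by simp
  qed
  then show ?thesis using t by auto
qed

text \<open>
  Being a combination of the rows is preserved by every homomorphism \<open>M\<^sup>+ \<rightarrow> N\<^sup>+\<close>, whether or not
  it is induced by a homomorphism \<open>N \<rightarrow> M\<close>.
\<close>

lemma annihilator_natural:
  assumes M: "left_module R M" and N: "left_module R N" and fin: "finite J" "finite S"
    and S: "\<And>s. s \<in> S \<Longrightarrow> s \<in> J \<rightarrow> carrier R"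
    and d: "d \<in> J \<rightarrow> carrier (character_module M)"
    and ann: "\<And>y. y \<in> solutions M J S \<Longrightarrow> (\<Otimes>\<^bsub>QZ\<^esub>j\<in>J. d j (y j)) = \<one>\<^bsub>QZ\<^esub>"
    and h: "h \<in> mod_hom R (character_module M) (character_module N)"
    and z: "z \<in> solutions N J S"
  shows "(\<Otimes>\<^bsub>QZ\<^esub>j\<in>J. h (d j) (z j)) = \<one>\<^bsub>QZ\<^esub>"
proof -
  interpret N: left_module R N by fact
  interpret CM: right_module R "character_module M" using M by (rule right_module_character_module)
  interpret CN: right_module R "character_module N" using N by (rule right_module_character_module)
  obtain t where t: "t \<in> S \<rightarrow> carrier (character_module M)"
    and dt: "\<And>j. j \<in> J \<Longrightarrow> d j = lincomb (character_module M) S (\<lambda>s. s j) t"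
    using solutions_annihilator[OF M fin S d ann] by auto
  have ht: "(\<lambda>s. h (t s)) \<in> S \<rightarrow> carrier (character_module N)"
    using t mod_hom_closed[OF h] by auto
  have zc: "z \<in> J \<rightarrow> carrier N" and z0: "\<And>s. s \<in> S \<Longrightarrow> lincomb N J s z = \<zero>\<^bsub>N\<^esub>"
    using z by (auto simp: solutions_def)
  have hdc: "h (d j) \<in> carrier (character_module N)" if "j \<in> J" for j
    using d that by (auto intro: mod_hom_closed[OF h])
  have hd: "h (d j) = lincomb (character_module N) S (\<lambda>s. s j) (\<lambda>s. h (t s))" if "j \<in> J" for j
    unfolding dt[OF that] using S that t
    by (intro mod_hom_lincomb[OF h CM.M.abelian_group_axioms CN.M.abelian_group_axioms CM.smult_closed]) auto
  have "(\<Otimes>\<^bsub>QZ\<^esub>j\<in>J. h (d j) (z j)) =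
      (\<Otimes>\<^bsub>QZ\<^esub>j\<in>J. lincomb (character_module N) S (\<lambda>s. s j) (\<lambda>s. h (t s)) (z j))"
    using zc by (intro QZ.finprod_cong') (auto simp flip: hd intro!: character_closed[OF hdc])
  also have "\<dots> = (\<Otimes>\<^bsub>QZ\<^esub>s\<in>S. h (t s) (lincomb N J s z))"
    using S by (intro pairing_transpose[OF N fin _ ht zc]) auto
  also have "\<dots> = (\<Otimes>\<^bsub>QZ\<^esub>s\<in>S. \<one>\<^bsub>QZ\<^esub>)"
  proof (rule QZ.finprod_cong')
    fix s assume s: "s \<in> S"
    then have "h (t s) \<in> carrier (character_module N)" using ht by auto
    then show "h (t s) (lincomb N J s z) = \<one>\<^bsub>QZ\<^esub>"
      using character_zero[OF _ N.M.abelian_group_axioms] by (simp add: z0[OF s])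
  qed auto
  finally show ?thesis by simp
qed

section \<open>Finite presentations\<close>

text \<open>
  A presentation with named generators: homomorphisms out of \<open>M\<close> can be prescribed on the \<open>e j\<close>,
  subject to the relations in \<open>S\<close>.
\<close>

definition presented ::
  "('r, 'q) ring_scheme \<Rightarrow> ('r, 'a, 'z) module_scheme \<Rightarrow> 'j set \<Rightarrow> ('j \<Rightarrow> 'r) set \<Rightarrow> ('j \<Rightarrow> 'a) \<Rightarrow> bool"
  where "presented R M J S e \<longleftrightarrow>
    finite J \<and> finite S \<and> S \<subseteq> J \<rightarrow>\<^sub>E carrier R \<and> e \<in> J \<rightarrow> carrier M \<and>
    (\<forall>x\<in>carrier M. \<exists>a\<in>J \<rightarrow>\<^sub>E carrier R. x = lincomb M J a e) \<and>
    (\<forall>a\<in>J \<rightarrow>\<^sub>E carrier R. lincomb M J a e = \<zero>\<^bsub>M\<^esub> \<longleftrightarrow>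
      a \<in> submodule_span R (product_module J (\<lambda>_. regular_module R)) S)"

lemma regular_module_simps:
  "carrier (regular_module R) = carrier R" "\<zero>\<^bsub>regular_module R\<^esub> = \<zero>\<^bsub>R\<^esub>"
  "a \<oplus>\<^bsub>regular_module R\<^esub> b = a \<oplus>\<^bsub>R\<^esub> b" "a \<odot>\<^bsub>regular_module R\<^esub> b = a \<otimes>\<^bsub>R\<^esub> b"
  by (simp_all add: regular_module_def)

lemma left_module_regular_module:
  assumes "ring R" shows "left_module R (regular_module R)"
proof -
  interpret ring R by fact
  have "abelian_group (regular_module R)"
    by (rule abelian_groupI)
      (auto simp: regular_module_simps a_ac intro: bexI[OF _ a_inv_closed] l_neg)
  then show ?thesis
    by (simp add: left_module_def left_module_axioms_def regular_module_simps ring_axioms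
        l_distr r_distr m_assoc)
qed

lemma lincomb_mod_hom:
  assumes M: "left_module R M" and "finite J" and y: "y \<in> J \<rightarrow> carrier M"
  shows "(\<lambda>a. lincomb M J a y) \<in> mod_hom R (product_module J (\<lambda>_. regular_module R)) M"
proof -
  interpret M: left_module R M by fact
  have c: "a j \<odot>\<^bsub>M\<^esub> y j \<in> carrier M" if "a j \<in> carrier R" "j \<in> J" for a j
    using that y by (auto intro: M.smult_closed)
  have yj: "y j \<in> carrier M" if "j \<in> J" for j using y that by auto
  show ?thesis
  proof (rule mod_homI)
    fix a assume "a \<in> carrier (product_module J (\<lambda>_. regular_module R))"
    then have a: "a j \<in> carrier R" if "j \<in> J" for j
      using that by (auto simp: product_module_simps regular_module_simps)
    show "lincomb M J a y \<in> carrier M" using a y by (intro M.lincomb_closed) auto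
    show "lincomb M J (r \<odot>\<^bsub>product_module J (\<lambda>_. regular_module R)\<^esub> a) y = r \<odot>\<^bsub>M\<^esub> lincomb M J a y"
      if r: "r \<in> carrier R" for r
    proof -
      have "lincomb M J (r \<odot>\<^bsub>product_module J (\<lambda>_. regular_module R)\<^esub> a) y =
          (\<Oplus>\<^bsub>M\<^esub>j\<in>J. r \<odot>\<^bsub>M\<^esub> (a j \<odot>\<^bsub>M\<^esub> y j))"
        unfolding lincomb_def using a r c yj
        by (intro M.M.finsum_cong')
          (auto simp: product_module_simps regular_module_simps M.smult_assoc intro!: M.smult_closed)
      also have "\<dots> = r \<odot>\<^bsub>M\<^esub> lincomb M J a y"
        unfolding lincomb_def using a r c assms(2) by (intro M.finsum_smult[symmetric]) auto
      finally show ?thesis .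
    qed
    fix b assume "b \<in> carrier (product_module J (\<lambda>_. regular_module R))"
    then have b: "b j \<in> carrier R" if "j \<in> J" for j
      using that by (auto simp: product_module_simps regular_module_simps)
    have "lincomb M J (a \<oplus>\<^bsub>product_module J (\<lambda>_. regular_module R)\<^esub> b) y =
        (\<Oplus>\<^bsub>M\<^esub>j\<in>J. a j \<odot>\<^bsub>M\<^esub> y j \<oplus>\<^bsub>M\<^esub> b j \<odot>\<^bsub>M\<^esub> y j)"
      unfolding lincomb_def using a b c yj
      by (intro M.M.finsum_cong')
        (auto simp: product_module_simps regular_module_simps M.smult_l_distr)
    also have "\<dots> = lincomb M J a y \<oplus>\<^bsub>M\<^esub> lincomb M J b y"
      unfolding lincomb_def using a b c by (intro M.M.finsum_addf) auto
    finally show "lincomb M J (a \<oplus>\<^bsub>product_module J (\<lambda>_. regular_module R)\<^esub> b) y =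
        lincomb M J a y \<oplus>\<^bsub>M\<^esub> lincomb M J b y" .
  qed
qed

lemma lincomb_unit:
  assumes M: "left_module R M" and fin: "finite J" and j: "j \<in> J" and y: "y \<in> J \<rightarrow> carrier M"
  shows "lincomb M J (coproj J (\<lambda>_. regular_module R) j \<one>\<^bsub>R\<^esub>) y = y j"
proof -
  interpret M: left_module R M by fact
  have zero: "\<zero>\<^bsub>R\<^esub> \<odot>\<^bsub>M\<^esub> x = \<zero>\<^bsub>M\<^esub>" if x: "x \<in> carrier M" for x
  proof -
    have "\<zero>\<^bsub>R\<^esub> \<odot>\<^bsub>M\<^esub> x \<oplus>\<^bsub>M\<^esub> \<zero>\<^bsub>R\<^esub> \<odot>\<^bsub>M\<^esub> x = \<zero>\<^bsub>R\<^esub> \<odot>\<^bsub>M\<^esub> x"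
      using M.smult_l_distr[of "\<zero>\<^bsub>R\<^esub>" "\<zero>\<^bsub>R\<^esub>" x] x by simp
    then show ?thesis using M.smult_closed[of "\<zero>\<^bsub>R\<^esub>" x] x
      by (metis M.M.add.l_cancel_one M.R.zero_closed)
  qed
  have "y k \<in> carrier M" if "k \<in> J" for k using y that by auto
  then have "lincomb M J (coproj J (\<lambda>_. regular_module R) j \<one>\<^bsub>R\<^esub>) y =
      (\<Oplus>\<^bsub>M\<^esub>k\<in>J. if j = k then y k else \<zero>\<^bsub>M\<^esub>)"
    unfolding lincomb_def
    by (intro M.M.finsum_cong') (auto simp: coproj_def regular_module_simps zero M.smult_one)
  also have "\<dots> = y j" using y j fin by (intro M.M.add.finprod_singleton) auto
  finally show ?thesis .
qed

lemma kernel_submodule: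
  assumes h: "h \<in> mod_hom R M N" and M: "left_module R M" and N: "left_module R N"
  shows "submodule {x \<in> carrier M. h x = \<zero>\<^bsub>N\<^esub>} R M"
proof -
  interpret M: left_module R M by fact
  interpret N: left_module R N by fact
  note ag = M.M.abelian_group_axioms N.M.abelian_group_axioms
  show ?thesis
  proof
    show "inv\<^bsub>add_monoid M\<^esub> x \<in> {x \<in> carrier M. h x = \<zero>\<^bsub>N\<^esub>}" if "x \<in> {x \<in> carrier M. h x = \<zero>\<^bsub>N\<^esub>}" for x
      using that mod_hom_minus[OF h ag, of x] by (simp flip: a_inv_def)
  qed (auto simp: mod_hom_add[OF h] mod_hom_smult[OF h] mod_hom_zero[OF h ag]
      M.smult_closed N.smult_zero_right)
qed

lemma presented_solution:
  assumes pr: "presented R M J S e"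
  shows "e \<in> solutions M J S"
proof -
  have "s \<in> submodule_span R (product_module J (\<lambda>_. regular_module R)) S" if "s \<in> S" for s
    using that by (auto simp: submodule_span_def)
  then have "lincomb M J s e = \<zero>\<^bsub>M\<^esub>" if "s \<in> S" for s
    using pr that by (auto simp: presented_def)
  then show ?thesis using pr by (simp add: solutions_def presented_def)
qed

lemma presented_universal:
  assumes M: "left_module R M" and N: "left_module R N" and pr: "presented R M J S e"
    and y: "y \<in> solutions N J S"
  shows "\<exists>g\<in>mod_hom R M N. \<forall>j\<in>J. g (e j) = y j"
proof -
  interpret M: left_module R M by fact
  interpret N: left_module R N by fact
  let ?P = "product_module J (\<lambda>_. regular_module R)"
  have fin: "finite J" and e: "e \<in> J \<rightarrow> carrier M" and S: "S \<subseteq> J \<rightarrow>\<^sub>E carrier R"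
    and gen: "\<And>x. x \<in> carrier M \<Longrightarrow> \<exists>a\<in>J \<rightarrow>\<^sub>E carrier R. x = lincomb M J a e"
    and rel: "\<And>a. a \<in> J \<rightarrow>\<^sub>E carrier R \<Longrightarrow> lincomb M J a e = \<zero>\<^bsub>M\<^esub> \<Longrightarrow> a \<in> submodule_span R ?P S"
    using pr by (auto simp: presented_def)
  have yN: "y \<in> J \<rightarrow> carrier N" using y by (simp add: solutions_def)
  interpret P: left_module R ?P
    using M.R.ring_axioms fin left_module_regular_module[OF M.R.ring_axioms]
    by (rule left_module_finite_product)
  have car: "carrier ?P = J \<rightarrow>\<^sub>E carrier R"
    by (auto simp: product_module_simps regular_module_simps)
  note he = lincomb_mod_hom[OF M fin e] and hy = lincomb_mod_hom[OF N fin yN]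
  have "submodule_span R ?P S \<subseteq> {a \<in> carrier ?P. lincomb N J a y = \<zero>\<^bsub>N\<^esub>}"
    using y S by (intro submodule_span_least kernel_submodule[OF hy P.left_module_axioms N])
      (auto simp: car solutions_def)
  then have ker: "lincomb N J a y = \<zero>\<^bsub>N\<^esub>" if "a \<in> carrier ?P" "lincomb M J a e = \<zero>\<^bsub>M\<^esub>" for a
    using rel[of a] that by (auto simp: car)
  have wd: "lincomb N J a y = lincomb N J b y"
    if ab: "a \<in> carrier ?P" "b \<in> carrier ?P" and eq: "lincomb M J a e = lincomb M J b e" for a b
  proof -
    have ca: "lincomb M J b e \<in> carrier M" "lincomb N J a y \<in> carrier N" "lincomb N J b y \<in> carrier N"
      using mod_hom_closed[OF he] mod_hom_closed[OF hy] ab by auto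
    let ?d = "a \<oplus>\<^bsub>?P\<^esub> \<ominus>\<^bsub>?P\<^esub> b"
    have d: "?d \<in> carrier ?P" using ab by simp
    have "lincomb M J ?d e = lincomb M J a e \<oplus>\<^bsub>M\<^esub> \<ominus>\<^bsub>M\<^esub> lincomb M J b e"
      using ab mod_hom_add[OF he] mod_hom_minus[OF he P.M.abelian_group_axioms M.M.abelian_group_axioms]
      by simp
    then have "lincomb M J ?d e = \<zero>\<^bsub>M\<^esub>" using ca by (simp add: eq M.M.r_neg)
    from ker[OF d this] have "lincomb N J a y \<oplus>\<^bsub>N\<^esub> \<ominus>\<^bsub>N\<^esub> lincomb N J b y = \<zero>\<^bsub>N\<^esub>"
      using ab mod_hom_add[OF hy] mod_hom_minus[OF hy P.M.abelian_group_axioms N.M.abelian_group_axioms]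
      by simp
    then show ?thesis using ca by (metis N.M.a_inv_closed N.M.minus_equality N.M.minus_minus)
  qed
  define g where "g x = lincomb N J (SOME a. a \<in> carrier ?P \<and> x = lincomb M J a e) y" for x
  have g: "g (lincomb M J a e) = lincomb N J a y" if a: "a \<in> carrier ?P" for a
  proof -
    let ?b = "SOME b. b \<in> carrier ?P \<and> lincomb M J a e = lincomb M J b e"
    have "?b \<in> carrier ?P \<and> lincomb M J a e = lincomb M J ?b e"
      by (rule someI[of _ a]) (use a in simp)
    then show ?thesis unfolding g_def using wd[of ?b a] a by simp
  qed
  have "g \<in> mod_hom R M N"
  proof (rule mod_homI)
    fix x assume "x \<in> carrier M"
    then obtain a where a: "a \<in> carrier ?P" "x = lincomb M J a e" using gen car by auto
    show "g x \<in> carrier N" using a mod_hom_closed[OF hy] by (simp add: g)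
    show "g (r \<odot>\<^bsub>M\<^esub> x) = r \<odot>\<^bsub>N\<^esub> g x" if "r \<in> carrier R" for r
      using a that mod_hom_smult[OF he that a(1)] mod_hom_smult[OF hy that a(1)] g[of "r \<odot>\<^bsub>?P\<^esub> a"]
      by (simp add: g P.smult_closed)
    fix z assume "z \<in> carrier M"
    then obtain b where b: "b \<in> carrier ?P" "z = lincomb M J b e" using gen car by auto
    show "g (x \<oplus>\<^bsub>M\<^esub> z) = g x \<oplus>\<^bsub>N\<^esub> g z"
      using a b mod_hom_add[OF he a(1) b(1)] mod_hom_add[OF hy a(1) b(1)] g[of "a \<oplus>\<^bsub>?P\<^esub> b"]
      by (simp add: g)
  qed
  moreover have "g (e j) = y j" if j: "j \<in> J" for j
  proof -
    let ?u = "coproj J (\<lambda>_. regular_module R) j \<one>\<^bsub>R\<^esub>"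
    have u: "?u \<in> carrier ?P" by (auto simp: car coproj_def regular_module_simps)
    have "e j = lincomb M J ?u e" using lincomb_unit[OF M fin j e] by simp
    then show ?thesis using g[OF u] lincomb_unit[OF N fin j yN] by simp
  qed
  ultimately show ?thesis by auto
qed

text \<open>
  The generators are the images of the unit vectors.  The unit vectors span the free module,
  and the kernel of the induced map is the submodule that is factored out.
\<close>

lemma finitely_presentedD:
  fixes M :: "('r, 'a, 'z) module_scheme"
  assumes "finitely_presented R M"
  obtains n S e where "presented R M {..<n::nat} S e"
proof -
  from assms have M: "left_module R M" and "\<exists>n S. finite S \<and> S \<subseteq> carrier (free_module R n) \<and>
      mod_iso R (quotient_module (free_module R n) (submodule_span R (free_module R n) S)) M"
    unfolding finitely_presented_def by simp_all
  then obtain n S where S: "finite S" "S \<subseteq> carrier (free_module R n)"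
    and iso: "mod_iso R (quotient_module (free_module R n) (submodule_span R (free_module R n) S)) M"
    by (elim exE conjE) (rule that)
  from iso obtain \<theta>
    where \<theta>: "\<theta> \<in> mod_hom R (quotient_module (free_module R n) (submodule_span R (free_module R n) S)) M"
    and bij: "bij_betw \<theta> (carrier (quotient_module (free_module R n) (submodule_span R (free_module R n) S))) (carrier M)"
    unfolding mod_iso_def by blast
  interpret M: left_module R M by fact
  let ?P = "free_module R n" and ?J = "{..<n}"
  let ?K = "submodule_span R ?P S"
  let ?Q = "quotient_module ?P ?K"
  interpret P: left_module R ?P
    unfolding free_module_def
    using M.R.ring_axioms finite_lessThan left_module_regular_module[OF M.R.ring_axioms]
    by (rule left_module_finite_product)
  have car: "carrier ?P = ?J \<rightarrow>\<^sub>E carrier R"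
    by (simp add: free_module_def product_module_def regular_module_def)
  have K: "submodule ?K R ?P" by (rule P.submodule_submodule_span[OF S(2)])
  note q = P.quotient_module_facts[OF K]
  have quot: "(\<lambda>x. ?K +>\<^bsub>?P\<^esub> x) \<in> mod_hom R ?P ?Q"
    by (rule mod_homI) (simp_all add: q(1-3))
  define \<pi> where "\<pi> x = \<theta> (?K +>\<^bsub>?P\<^esub> x)" for x
  have \<pi>: "\<pi> \<in> mod_hom R ?P M"
    unfolding \<pi>_def using quot \<theta> by (rule mod_hom_compose)
  define u where "u j = coproj ?J (\<lambda>_. regular_module R) j \<one>\<^bsub>R\<^esub>" for j
  have u: "u \<in> ?J \<rightarrow> carrier ?P"
    by (auto simp: car u_def coproj_def regular_module_simps)
  have unit: "lincomb ?P ?J a u = a" if a: "a \<in> carrier ?P" for a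
  proof (rule extensionalityI)
    show "a \<in> extensional ?J" using a by (simp add: car PiE_iff)
    have aJ: "a \<in> ?J \<rightarrow> carrier R" using a by (auto simp: car)
    show "lincomb ?P ?J a u \<in> extensional ?J"
      using P.lincomb_closed[OF aJ u] by (simp add: car PiE_iff)
    fix k assume k: "k \<in> ?J"
    interpret V: left_module R "regular_module R"
      by (rule left_module_regular_module[OF M.R.ring_axioms])
    have ev: "(\<lambda>x. x k) \<in> mod_hom R ?P (regular_module R)"
      using k by (intro mod_homI) (auto simp: free_module_def product_module_simps regular_module_simps)
    have "lincomb ?P ?J a u k = lincomb (regular_module R) ?J a (\<lambda>j. u j k)"
      using left_mod_hom_lincomb[OF ev P.left_module_axioms V.left_module_axioms aJ u] .
    also have "\<dots> = (\<Oplus>\<^bsub>regular_module R\<^esub>j\<in>?J. if k = j then a j else \<zero>\<^bsub>regular_module R\<^esub>)"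
      unfolding lincomb_def using k funcset_mem[OF aJ]
      by (intro V.M.finsum_cong') (auto simp: u_def coproj_def regular_module_simps)
    also have "\<dots> = a k"
      using aJ k by (intro V.M.add.finprod_singleton) (auto simp: regular_module_simps)
    finally show "lincomb ?P ?J a u k = a k" .
  qed
  define e where "e j = \<pi> (u j)" for j
  have \<pi>_eq: "\<pi> a = lincomb M ?J a e" if a: "a \<in> carrier ?P" for a
  proof -
    have "\<pi> (lincomb ?P ?J a u) = lincomb M ?J a e"
      unfolding e_def using a by (intro left_mod_hom_lincomb[OF \<pi> P.left_module_axioms M _ u]) (simp add: car PiE_def)
    then show ?thesis using unit[OF a] by simp
  qed
  have "presented R M ?J S e"
    unfolding presented_def
  proof (intro conjI ballI)
    show "finite S" "S \<subseteq> ?J \<rightarrow>\<^sub>E carrier R" "finite ?J" using S car by auto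
    show "e \<in> ?J \<rightarrow> carrier M" by (rule Pi_I) (simp add: e_def mod_hom_closed[OF \<pi> funcset_mem[OF u]])
  next
    fix x assume "x \<in> carrier M"
    moreover have "\<theta> ` carrier ?Q = carrier M" using bij by (simp add: bij_betw_def)
    moreover have "\<theta> ` carrier ?Q = \<pi> ` carrier ?P" unfolding q(1) image_image \<pi>_def ..
    ultimately have "x \<in> \<pi> ` carrier ?P" by metis
    then obtain a where a: "a \<in> carrier ?P" "x = \<pi> a" by (elim imageE) (rule that)
    show "\<exists>a\<in>?J \<rightarrow>\<^sub>E carrier R. x = lincomb M ?J a e"
      by (rule bexI[of _ a]) (use a car \<pi>_eq[OF a(1)] in metis)+
  next
    fix a assume "a \<in> ?J \<rightarrow>\<^sub>E carrier R"
    then have a: "a \<in> carrier ?P" by (simp add: car)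
    interpret Q: left_module R ?Q by (rule q(5))
    have z: "?K +>\<^bsub>?P\<^esub> \<zero>\<^bsub>?P\<^esub> = \<zero>\<^bsub>?Q\<^esub>"
      using mod_hom_zero[OF quot P.M.abelian_group_axioms Q.M.abelian_group_axioms] .
    have "lincomb M ?J a e = \<zero>\<^bsub>M\<^esub> \<longleftrightarrow> \<theta> (?K +>\<^bsub>?P\<^esub> a) = \<theta> \<zero>\<^bsub>?Q\<^esub>"
      using mod_hom_zero[OF \<theta> Q.M.abelian_group_axioms M.M.abelian_group_axioms] \<pi>_eq[OF a]
      by (simp add: \<pi>_def)
    also have "\<dots> \<longleftrightarrow> ?K +>\<^bsub>?P\<^esub> a = \<zero>\<^bsub>?Q\<^esub>"
      by (rule inj_on_eq_iff[OF bij_betw_imp_inj_on[OF bij] mod_hom_closed[OF quot a] Q.M.zero_closed])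
    also have "\<dots> \<longleftrightarrow> a \<ominus>\<^bsub>?P\<^esub> \<zero>\<^bsub>?P\<^esub> \<in> ?K"
      unfolding z[symmetric] using q(4)[OF a P.M.zero_closed] .
    also have "a \<ominus>\<^bsub>?P\<^esub> \<zero>\<^bsub>?P\<^esub> = a" using a by (simp add: a_minus_def)
    finally show "lincomb M ?J a e = \<zero>\<^bsub>M\<^esub> \<longleftrightarrow>
        a \<in> submodule_span R (product_module ?J (\<lambda>_. regular_module R)) S"
      by (simp add: free_module_def)
  qed
  then show thesis by (rule that)
qed

lemma presented_generates:
  assumes "presented R M J S e" "x \<in> carrier M"
  shows "\<exists>a\<in>J \<rightarrow> carrier R. x = lincomb M J a e"
proof -
  have "\<exists>a\<in>J \<rightarrow>\<^sub>E carrier R. x = lincomb M J a e" using assms by (simp add: presented_def)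
  then show ?thesis by (auto simp: PiE_def)
qed

lemma presented_hom_eqI:
  assumes "presented R M J S e" and M: "left_module R M" and N: "left_module R N"
    and g: "g \<in> mod_hom R M N" and h: "h \<in> mod_hom R M N"
    and eq: "\<And>j. j \<in> J \<Longrightarrow> g (e j) = h (e j)" and x: "x \<in> carrier M"
  shows "g x = h x"
proof -
  interpret N: left_module R N by fact
  have e: "e \<in> J \<rightarrow> carrier M" using assms(1) by (simp add: presented_def)
  obtain a where a: "a \<in> J \<rightarrow> carrier R" "x = lincomb M J a e"
    using presented_generates[OF assms(1) x] by auto
  have "g x = lincomb N J a (\<lambda>j. g (e j))"
    unfolding a(2) by (rule left_mod_hom_lincomb[OF g M N a(1) e])
  also have "\<dots> = lincomb N J a (\<lambda>j. h (e j))"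
    using eq a(1) e mod_hom_closed[OF h] N by (intro lincomb_cong) auto
  also have "\<dots> = h x"
    unfolding a(2) by (rule left_mod_hom_lincomb[OF h M N a(1) e, symmetric])
  finally show ?thesis .
qed

text \<open>
  For the homomorphisms \<open>F\<^sup>+ \<rightarrow> B\<^sup>+\<close> induced by some \<open>g : B \<rightarrow> F\<close> the conclusion is the hypothesis.  It
  carries over to all others: expressing the \<open>b k\<close> by the generators of \<open>B\<close> turns the
  hypothesis into a statement about the solutions in \<open>F\<close> of the relations of \<open>B\<close>, and
  then naturality of the annihilators applies.
\<close>

lemma character_hom_annihilates:
  assumes F: "left_module R F" and B: "left_module R B" and pr: "presented R B J S e"
    and h: "h \<in> mod_hom R (character_module F) (character_module B)" and K: "finite K"
    and c: "c \<in> K \<rightarrow> carrier (character_module F)" and b: "b \<in> K \<rightarrow> carrier B"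
    and ann: "\<And>g. g \<in> mod_hom R B F \<Longrightarrow> (\<Otimes>\<^bsub>QZ\<^esub>k\<in>K. c k (g (b k))) = \<one>\<^bsub>QZ\<^esub>"
  shows "(\<Otimes>\<^bsub>QZ\<^esub>k\<in>K. h (c k) (b k)) = \<one>\<^bsub>QZ\<^esub>"
proof -
  interpret F: left_module R F by fact
  interpret B: left_module R B by fact
  interpret CF: right_module R "character_module F" using F by (rule right_module_character_module)
  interpret CB: right_module R "character_module B" using B by (rule right_module_character_module)
  have S: "s \<in> J \<rightarrow> carrier R" if "s \<in> S" for s
    using pr that by (auto simp: presented_def)
  have fin: "finite J" "finite S" and e: "e \<in> J \<rightarrow> carrier B"
    using pr by (auto simp: presented_def)
  have "\<exists>a. a \<in> J \<rightarrow> carrier R \<and> b k = lincomb B J a e" if k: "k \<in> K" for k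
  proof -
    have "b k \<in> carrier B" using b k by auto
    from presented_generates[OF pr this] show ?thesis by auto
  qed
  then obtain a where a: "\<And>k. k \<in> K \<Longrightarrow> a k \<in> J \<rightarrow> carrier R"
    and ba: "\<And>k. k \<in> K \<Longrightarrow> b k = lincomb B J (a k) e" by metis
  have akj: "a k j \<in> carrier R" if "k \<in> K" "j \<in> J" for k j using a[OF that(1)] that(2) by auto
  \<comment> \<open>rewrite \<open>c\<close> and \<open>b\<close> in terms of the generators \<open>e\<close>\<close>
  define d where "d j = lincomb (character_module F) K (\<lambda>k. a k j) c" for j
  have d: "d \<in> J \<rightarrow> carrier (character_module F)"
    unfolding d_def lincomb_def using c akj
    by (auto intro!: CF.M.finsum_closed CF.smult_closed)
  have dann: "(\<Otimes>\<^bsub>QZ\<^esub>j\<in>J. d j (z j)) = \<one>\<^bsub>QZ\<^esub>" if z: "z \<in> solutions F J S" for z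
  proof -
    obtain g where g: "g \<in> mod_hom R B F" "\<And>j. j \<in> J \<Longrightarrow> g (e j) = z j"
      using presented_universal[OF B F pr z] by auto
    have zc: "z \<in> J \<rightarrow> carrier F" using z by (simp add: solutions_def)
    have gb: "lincomb F J (a k) z = g (b k)" if k: "k \<in> K" for k
    proof -
      have "g (b k) = lincomb F J (a k) (\<lambda>j. g (e j))"
        unfolding ba[OF k] by (rule left_mod_hom_lincomb[OF g(1) B F a[OF k] e])
      also have "\<dots> = lincomb F J (a k) z"
        using g(2) a[OF k] zc F by (intro lincomb_cong) auto
      finally show ?thesis by simp
    qed
    have "(\<Otimes>\<^bsub>QZ\<^esub>j\<in>J. d j (z j)) = (\<Otimes>\<^bsub>QZ\<^esub>k\<in>K. c k (lincomb F J (a k) z))"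
      unfolding d_def using akj by (intro pairing_transpose[OF F fin(1) K _ c zc])
    also have "\<dots> = (\<Otimes>\<^bsub>QZ\<^esub>k\<in>K. c k (g (b k)))"
      using c b mod_hom_closed[OF g(1)]
      by (intro QZ.finprod_cong') (auto simp: gb intro!: character_closed[where M=F])
    also have "\<dots> = \<one>\<^bsub>QZ\<^esub>" using g(1) by (rule ann)
    finally show ?thesis .
  qed
  have hc: "(\<lambda>k. h (c k)) \<in> K \<rightarrow> carrier (character_module B)"
    using c mod_hom_closed[OF h] by auto
  have hd: "h (d j) = lincomb (character_module B) K (\<lambda>k. a k j) (\<lambda>k. h (c k))" if "j \<in> J" for j
    unfolding d_def using akj that c
    by (intro mod_hom_lincomb[OF h CF.M.abelian_group_axioms CB.M.abelian_group_axioms CF.smult_closed]) auto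
  have hdc: "h (d j) \<in> carrier (character_module B)" if "j \<in> J" for j
    using d that by (auto intro: mod_hom_closed[OF h])
  have "(\<Otimes>\<^bsub>QZ\<^esub>k\<in>K. h (c k) (b k)) = (\<Otimes>\<^bsub>QZ\<^esub>k\<in>K. h (c k) (lincomb B J (a k) e))"
  proof (rule QZ.finprod_cong')
    fix k assume k: "k \<in> K"
    show "h (c k) (b k) = h (c k) (lincomb B J (a k) e)" by (rule arg_cong[OF ba[OF k]])
  next
    show "(\<lambda>k. h (c k) (lincomb B J (a k) e)) \<in> K \<rightarrow> carrier QZ"
      using funcset_mem[OF hc] a e by (intro Pi_I character_closed[where M=B] B.lincomb_closed) auto
  qed simp
  also have "\<dots> = (\<Otimes>\<^bsub>QZ\<^esub>j\<in>J. lincomb (character_module B) K (\<lambda>k. a k j) (\<lambda>k. h (c k)) (e j))"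
    using akj by (intro pairing_transpose[OF B fin(1) K _ hc e, symmetric])
  also have "\<dots> = (\<Otimes>\<^bsub>QZ\<^esub>j\<in>J. h (d j) (e j))"
    using e by (intro QZ.finprod_cong') (auto simp flip: hd intro!: character_closed[OF hdc])
  also have "\<dots> = \<one>\<^bsub>QZ\<^esub>"
    by (rule annihilator_natural[OF F B fin S d dann h presented_solution[OF pr]])
  finally show ?thesis .
qed

section \<open>Factoring finitely presented modules through an additive class\<close>

text \<open>
  The coproduct property of the direct sum, for two given homomorphisms to \<open>F\<close>.
\<close>

lemma additive_biproduct:
  assumes add: "additive_subcategory R \<B>" and mods: "\<forall>B\<in>\<B>. left_module R B"
    and MN: "M \<in> \<B>" "N \<in> \<B>" and F: "left_module R F"
    and g: "g \<in> mod_hom R M F" and h: "h \<in> mod_hom R N F"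
  obtains P i j k where "P \<in> \<B>" "i \<in> mod_hom R M P" "j \<in> mod_hom R N P" "k \<in> mod_hom R P F"
    "\<And>x. x \<in> carrier M \<Longrightarrow> k (i x) = g x" "\<And>x. x \<in> carrier N \<Longrightarrow> k (j x) = h x"
proof -
  from add MN have "\<exists>P\<in>\<B>. mod_iso R (pair_module M N) P"
    unfolding additive_subcategory_def by blast
  then obtain P \<psi> where P: "P \<in> \<B>" and \<psi>: "\<psi> \<in> mod_hom R (pair_module M N) P"
    and bij: "bij_betw \<psi> (carrier (pair_module M N)) (carrier P)"
    unfolding mod_iso_def by blast
  interpret M: left_module R M using mods MN(1) by (rule bspec)
  interpret N: left_module R N using mods MN(2) by (rule bspec)
  interpret F: left_module R F by fact
  let ?Q = "pair_module M N"
  have ps: "carrier ?Q = carrier M \<times> carrier N"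
    "(x, y) \<oplus>\<^bsub>?Q\<^esub> (x', y') = (x \<oplus>\<^bsub>M\<^esub> x', y \<oplus>\<^bsub>N\<^esub> y')"
    "a \<odot>\<^bsub>?Q\<^esub> (x, y) = (a \<odot>\<^bsub>M\<^esub> x, a \<odot>\<^bsub>N\<^esub> y)" for x y x' y' a
    by (simp_all add: pair_module_def)
  let ?\<phi> = "inv_into (carrier ?Q) \<psi>"
  have \<phi>: "?\<phi> \<in> mod_hom R P ?Q"
    by (rule mod_hom_inv_into[OF \<psi> bij]) (auto simp: ps M.smult_closed N.smult_closed)
  have gh: "(\<lambda>(x, y). g x \<oplus>\<^bsub>F\<^esub> h y) \<in> mod_hom R ?Q F"
    using mod_hom_closed[OF g] mod_hom_closed[OF h]
    by (intro mod_homI)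
      (auto simp: ps mod_hom_add[OF g] mod_hom_add[OF h] mod_hom_smult[OF g] mod_hom_smult[OF h]
        F.M.a_ac F.smult_r_distr)
  have iM: "(\<lambda>x. (x, \<zero>\<^bsub>N\<^esub>)) \<in> mod_hom R M ?Q" and iN: "(\<lambda>y. (\<zero>\<^bsub>M\<^esub>, y)) \<in> mod_hom R N ?Q"
    by (rule mod_homI; auto simp: ps N.smult_zero_right M.smult_zero_right)+
  have inv: "?\<phi> (\<psi> z) = z" if "z \<in> carrier ?Q" for z
    using bij that by (rule bij_betw_inv_into_left)
  have z: "g \<zero>\<^bsub>M\<^esub> = \<zero>\<^bsub>F\<^esub>" "h \<zero>\<^bsub>N\<^esub> = \<zero>\<^bsub>F\<^esub>"
    using mod_hom_zero[OF g M.M.abelian_group_axioms F.M.abelian_group_axioms]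
      mod_hom_zero[OF h N.M.abelian_group_axioms F.M.abelian_group_axioms] by auto
  show thesis
  proof (rule that[OF P mod_hom_compose[OF iM \<psi>] mod_hom_compose[OF iN \<psi>] mod_hom_compose[OF \<phi> gh]])
    show "(case ?\<phi> (\<psi> (x, \<zero>\<^bsub>N\<^esub>)) of (x, y) \<Rightarrow> g x \<oplus>\<^bsub>F\<^esub> h y) = g x" if "x \<in> carrier M" for x
      using that mod_hom_closed[OF g that] by (subst inv) (simp_all add: ps z)
    show "(case ?\<phi> (\<psi> (\<zero>\<^bsub>M\<^esub>, y)) of (x, y) \<Rightarrow> g x \<oplus>\<^bsub>F\<^esub> h y) = h y" if "y \<in> carrier N" for y
      using that mod_hom_closed[OF h that] by (subst inv) (simp_all add: ps z)
  qed
qed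

text \<open>
  Lenzing's criterion: every homomorphism from a finitely presented module to \<open>F\<close> factors through a
  module in \<open>\<B>\<close>.  The finitely presented module is represented by its generators and relations.
\<close>

definition solutions_factor ::
  "('r, 'q) ring_scheme \<Rightarrow> ('r, 'b) module set \<Rightarrow> ('r, 'f, 'z) module_scheme \<Rightarrow> bool"
  where "solutions_factor R \<B> F \<longleftrightarrow>
    (\<forall>n S. finite S \<longrightarrow> S \<subseteq> {..<n::nat} \<rightarrow> carrier R \<longrightarrow>
      (\<forall>y\<in>solutions F {..<n} S. \<exists>B\<in>\<B>. \<exists>b\<in>solutions B {..<n} S. \<exists>g\<in>mod_hom R B F.
        \<forall>k\<in>{..<n}. y k = g (b k)))"

lemma solutions_factorD:
  assumes "solutions_factor R \<B> F" "finite S" "S \<subseteq> {..<n::nat} \<rightarrow> carrier R" "y \<in> solutions F {..<n} S"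
  shows "\<exists>B\<in>\<B>. \<exists>b\<in>solutions B {..<n} S. \<exists>g\<in>mod_hom R B F. \<forall>k\<in>{..<n}. y k = g (b k)"
  using assms unfolding solutions_factor_def by simp

text \<open>
  The sum of a solution that factors through \<open>B\<close> and one that factors through \<open>C\<close> factors through
  the direct sum of \<open>B\<close> and \<open>C\<close>, and the zero module of \<open>\<B>\<close> provides the solution \<open>0\<close>.
\<close>

lemma factoring_solutions_subgroup:
  fixes F :: "('r, 'f, 'z) module_scheme" and J :: "'j set" and \<B> :: "('r, 'b) module set"
  assumes add: "additive_subcategory R \<B>" and mods0: "\<forall>B\<in>\<B>. left_module R B"
    and F: "left_module R F" and S: "S \<subseteq> J \<rightarrow> carrier R"
  shows "subgroup {\<lambda>k\<in>J. g (b k) | B b g. B \<in> \<B> \<and> b \<in> solutions B J S \<and> g \<in> mod_hom R B F}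
    (add_monoid (product_module J (\<lambda>_. F)))" (is "subgroup ?Y ?G")
proof -
  interpret F: left_module R F by fact
  interpret P: abelian_group "product_module J (\<lambda>_. F)"
    by (rule abelian_group_product_module) (rule F.M.abelian_group_axioms)
  note mods = bspec[OF mods0]
  have mem: "(\<lambda>k\<in>J. g (b k)) \<in> ?Y" if "B \<in> \<B>" "b \<in> solutions B J S" "g \<in> mod_hom R B F" for B b g
    using that by auto
  have val: "(\<lambda>k\<in>J. g (b k)) \<in> carrier (product_module J (\<lambda>_. F))"
    if "b \<in> solutions B J S" "g \<in> mod_hom R B F" for B :: "('r, 'b) module" and b g
    using that mod_hom_closed[OF that(2)] by (auto simp: product_module_simps solutions_def)
  show ?thesis
  proof
    show "?Y \<subseteq> carrier ?G" by (auto intro!: val)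
    obtain Z where Z: "Z \<in> \<B>" "carrier Z = {\<zero>\<^bsub>Z\<^esub>}"
      using add unfolding additive_subcategory_def by blast
    interpret Z: left_module R Z using mods Z by simp
    have "lincomb Z J s (\<lambda>_. \<zero>\<^bsub>Z\<^esub>) = \<zero>\<^bsub>Z\<^esub>" if "s \<in> S" for s
    proof -
      have "lincomb Z J s (\<lambda>_. \<zero>\<^bsub>Z\<^esub>) \<in> carrier Z" using S that by (intro Z.lincomb_closed) auto
      then show ?thesis unfolding Z(2) by simp
    qed
    then have "(\<lambda>_. \<zero>\<^bsub>Z\<^esub>) \<in> solutions Z J S" by (simp add: solutions_def)
    moreover have "(\<lambda>_. \<zero>\<^bsub>F\<^esub>) \<in> mod_hom R Z F"
      by (intro mod_homI) (simp_all add: F.smult_zero_right)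
    ultimately have "(\<lambda>k\<in>J. \<zero>\<^bsub>F\<^esub>) \<in> ?Y" by (rule mem[OF Z(1)])
    then show "\<one>\<^bsub>?G\<^esub> \<in> ?Y" by (simp add: product_module_simps(2))
  next
    fix y assume "y \<in> ?Y"
    then obtain B b g where y: "y = (\<lambda>k\<in>J. g (b k))" and B: "B \<in> \<B>" "b \<in> solutions B J S" "g \<in> mod_hom R B F"
      by auto
    have "inv\<^bsub>?G\<^esub> y = (\<lambda>k\<in>J. \<ominus>\<^bsub>F\<^esub> y k)"
      using product_module_a_inv[OF _ val[OF B(2,3)]] F.M.abelian_group_axioms
      unfolding y a_inv_def by simp
    also have "\<dots> = (\<lambda>k\<in>J. \<ominus>\<^bsub>F\<^esub> g (b k))" by (auto simp: y intro!: restrict_ext)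
    also have "\<dots> \<in> ?Y" by (rule mem[OF B(1,2) mod_hom_uminus[OF B(3) F]])
    finally show "inv\<^bsub>?G\<^esub> y \<in> ?Y" .
  next
    fix y z assume "y \<in> ?Y" "z \<in> ?Y"
    then obtain B b g C c h where y: "y = (\<lambda>k\<in>J. g (b k))" and z: "z = (\<lambda>k\<in>J. h (c k))"
      and B: "B \<in> \<B>" "b \<in> solutions B J S" "g \<in> mod_hom R B F"
      and C: "C \<in> \<B>" "c \<in> solutions C J S" "h \<in> mod_hom R C F"
      by auto
    have bc: "b k \<in> carrier B" "c k \<in> carrier C" if "k \<in> J" for k
      using B(2) C(2) that by (auto simp: solutions_def)
    obtain P i j l where P: "P \<in> \<B>" and i: "i \<in> mod_hom R B P" and j: "j \<in> mod_hom R C P"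
      and l: "l \<in> mod_hom R P F"
      and li: "\<And>x. x \<in> carrier B \<Longrightarrow> l (i x) = g x" and lj: "\<And>x. x \<in> carrier C \<Longrightarrow> l (j x) = h x"
      using additive_biproduct[OF add mods0 B(1) C(1) F B(3) C(3)] by blast
    interpret P: left_module R P using mods P by simp
    have SJ: "s \<in> J \<rightarrow> carrier R" if "s \<in> S" for s using S that by auto
    have ib: "(\<lambda>k. i (b k)) \<in> solutions P J S" and jc: "(\<lambda>k. j (c k)) \<in> solutions P J S"
      using solutions_mod_hom[OF i mods[OF B(1)] mods[OF P] SJ B(2)]
        solutions_mod_hom[OF j mods[OF C(1)] mods[OF P] SJ C(2)] by auto
    have "lincomb P J s (\<lambda>k. i (b k) \<oplus>\<^bsub>P\<^esub> j (c k)) = \<zero>\<^bsub>P\<^esub>" if s: "s \<in> S" for s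
      using ib jc s lincomb_add[OF mods[OF P] SJ[OF s], of "\<lambda>k. i (b k)" "\<lambda>k. j (c k)"]
      by (simp add: solutions_def)
    then have "(\<lambda>k. i (b k) \<oplus>\<^bsub>P\<^esub> j (c k)) \<in> solutions P J S"
      using ib jc by (auto simp: solutions_def Pi_def)
    from mem[OF P this l] have "(\<lambda>k\<in>J. l (i (b k) \<oplus>\<^bsub>P\<^esub> j (c k))) \<in> ?Y" .
    also have "(\<lambda>k\<in>J. l (i (b k) \<oplus>\<^bsub>P\<^esub> j (c k))) = y \<otimes>\<^bsub>?G\<^esub> z"
      using bc mod_hom_closed[OF i] mod_hom_closed[OF j]
      by (auto simp: y z product_module_simps(3) mod_hom_add[OF l] li lj intro!: restrict_ext)
    finally show "y \<otimes>\<^bsub>?G\<^esub> z \<in> ?Y" .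
  qed
qed

text \<open>
  If some solution \<open>y\<close> does not factor, a character separates it from the subgroup of those that do.  The
  retraction shows that this character is a combination of the equations, so that it kills \<open>y\<close>.
\<close>

proposition summand_solutions_factor:
  fixes F :: "('r, 'f, 'z) module_scheme" and J :: "'j set"
  assumes fp: "\<And>B. B \<in> \<B> \<Longrightarrow> finitely_presented R B" and add: "additive_subcategory R \<B>"
    and F: "left_module R F" and D: "\<And>i. i \<in> I \<Longrightarrow> D i \<in> \<B>"
    and j: "j \<in> mod_hom R (character_module F) (product_module I (\<lambda>i. character_module (D i)))"
    and p: "p \<in> mod_hom R (product_module I (\<lambda>i. character_module (D i))) (character_module F)"
    and pj: "\<And>c. c \<in> carrier (character_module F) \<Longrightarrow> p (j c) = c"
    and fin: "finite J" "finite S" and S: "S \<subseteq> J \<rightarrow> carrier R" and y: "y \<in> solutions F J S"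
  shows "\<exists>B\<in>\<B>. \<exists>b\<in>solutions B J S. \<exists>g\<in>mod_hom R B F. \<forall>k\<in>J. y k = g (b k)"
proof (rule ccontr)
  assume neg: "\<not> ?thesis"
  have mods: "left_module R B" if "B \<in> \<B>" for B using fp[OF that] by (simp add: finitely_presented_def)
  interpret F: left_module R F by fact
  let ?PF = "product_module J (\<lambda>_. F)"
  interpret PF: abelian_group ?PF
    by (rule abelian_group_product_module) (rule F.M.abelian_group_axioms)
  interpret CF: right_module R "character_module F" using F by (rule right_module_character_module)
  have CD: "right_module R (character_module (D i))" if "i \<in> I" for i
    using right_module_character_module[OF mods[OF D[OF that]]] .
  let ?P = "product_module I (\<lambda>i. character_module (D i))"
  interpret P: right_module R ?P using F.R.ring_axioms CD by (rule right_module_product_module)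
  have SJ: "s \<in> J \<rightarrow> carrier R" if "s \<in> S" for s using S that by auto
  have yc: "y \<in> J \<rightarrow> carrier F" and y0: "\<And>s. s \<in> S \<Longrightarrow> lincomb F J s y = \<zero>\<^bsub>F\<^esub>"
    using y by (auto simp: solutions_def)
  let ?Y = "{\<lambda>k\<in>J. g (b k) | B b g. B \<in> \<B> \<and> b \<in> solutions B J S \<and> g \<in> mod_hom R B F}"
  let ?y = "restrict y J"
  have y_car: "?y \<in> carrier (add_monoid ?PF)" using yc by (auto simp: product_module_simps)
  have "?y \<notin> ?Y"
  proof
    assume "?y \<in> ?Y"
    then obtain B b g where B: "B \<in> \<B>" "b \<in> solutions B J S" "g \<in> mod_hom R B F"
      and e: "?y = (\<lambda>k\<in>J. g (b k))" by auto
    have "y k = g (b k)" if "k \<in> J" for k using fun_cong[OF e, of k] that by simp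
    with B neg show False by blast
  qed
  moreover have "\<forall>B\<in>\<B>. left_module R B" using mods by blast
  note factoring_solutions_subgroup[OF add this F S]
  ultimately have "\<exists>\<psi>\<in>hom (add_monoid ?PF) QZ. (\<forall>z\<in>?Y. \<psi> z = \<one>\<^bsub>QZ\<^esub>) \<and> \<psi> ?y \<noteq> \<one>\<^bsub>QZ\<^esub>"
    using y_car by (intro char_separates[OF PF.a_comm_group])
  then
  obtain \<psi> where \<psi>: "\<psi> \<in> hom (add_monoid ?PF) QZ" and \<psi>Y: "\<forall>z\<in>?Y. \<psi> z = \<one>\<^bsub>QZ\<^esub>"
    and \<psi>y: "\<psi> ?y \<noteq> \<one>\<^bsub>QZ\<^esub>" by (elim bexE conjE) (rule that)
  have "\<exists>c. (\<forall>k\<in>J. c k \<in> carrier (character_module F)) \<and>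
      (\<forall>z\<in>carrier (add_monoid ?PF). \<psi> z = (\<Otimes>\<^bsub>QZ\<^esub>k\<in>J. c k (z k)))"
  proof (rule char_through_finite_family[OF PF.a_comm_group F.M.abelian_group_axioms fin(1) _ \<psi>])
    show "(\<lambda>z. z k) \<in> hom (add_monoid ?PF) (add_monoid F)" if "k \<in> J" for k
      using that by (auto simp: hom_def product_module_simps)
    fix z assume z: "z \<in> carrier (add_monoid ?PF)" and z0: "\<And>k. k \<in> J \<Longrightarrow> z k = \<zero>\<^bsub>F\<^esub>"
    have "z = \<one>\<^bsub>add_monoid ?PF\<^esub>"
      using z z0 by (intro extensionalityI[where A=J]) (auto simp: product_module_simps PiE_iff)
    then show "\<psi> z = \<one>\<^bsub>QZ\<^esub>" using hom_one[OF \<psi> PF.a_group QZ.is_group] by simp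
  qed
  then obtain c where c0: "\<forall>k\<in>J. c k \<in> carrier (character_module F)"
    and \<psi>c: "\<forall>z\<in>carrier (add_monoid ?PF). \<psi> z = (\<Otimes>\<^bsub>QZ\<^esub>k\<in>J. c k (z k))"
    by (elim exE conjE) (rule that)
  have c: "c \<in> J \<rightarrow> carrier (character_module F)" using c0 by simp
  have \<psi>_restrict: "\<psi> (restrict z J) = (\<Otimes>\<^bsub>QZ\<^esub>k\<in>J. c k (z k))" if z: "z \<in> J \<rightarrow> carrier F" for z
  proof -
    have "restrict z J \<in> carrier (add_monoid ?PF)" using z by (auto simp: product_module_simps)
    then have "\<psi> (restrict z J) = (\<Otimes>\<^bsub>QZ\<^esub>k\<in>J. c k (restrict z J k))" using \<psi>c by (rule bspec[rotated])
    also have "\<dots> = (\<Otimes>\<^bsub>QZ\<^esub>k\<in>J. c k (z k))"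
      using funcset_mem[OF c] funcset_mem[OF z]
      by (intro QZ.finprod_cong') (auto intro!: character_closed[where M=F])
    finally show ?thesis .
  qed
  \<comment> \<open>at each \<open>i\<close> the images of the \<open>c k\<close> annihilate the solutions in \<open>D i\<close>, because \<open>c\<close>
    annihilates their images under all homomorphisms \<open>D i \<rightarrow> F\<close>\<close>
  have comp: "(\<lambda>f. j f i) \<in> mod_hom R (character_module F) (character_module (D i))" if "i \<in> I" for i
  proof -
    have "(\<lambda>f. f i) \<in> mod_hom R ?P (character_module (D i))"
      using that by (intro mod_homI) (auto simp: product_module_simps)
    from mod_hom_compose[OF j this] show ?thesis .
  qed
  have "\<exists>t. t \<in> S \<rightarrow> carrier (character_module (D i)) \<and>
      (\<forall>k\<in>J. j (c k) i = lincomb (character_module (D i)) S (\<lambda>s. s k) t)" if i: "i \<in> I" for i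
  proof (rule solutions_annihilator[OF mods[OF D[OF i]] fin SJ])
    show "(\<lambda>k. j (c k) i) \<in> J \<rightarrow> carrier (character_module (D i))"
      using mod_hom_closed[OF comp[OF i] funcset_mem[OF c]] by simp
    fix v assume v: "v \<in> solutions (D i) J S"
    have vc: "v \<in> J \<rightarrow> carrier (D i)" using v by (simp add: solutions_def)
    obtain n S' e where pr: "presented R (D i) {..<n::nat} S' e"
      using finitely_presentedD[OF fp[OF D[OF i]]] .
    show "(\<Otimes>\<^bsub>QZ\<^esub>k\<in>J. j (c k) i (v k)) = \<one>\<^bsub>QZ\<^esub>"
    proof (rule character_hom_annihilates[OF F mods[OF D[OF i]] pr comp[OF i] fin(1) c vc])
      fix g assume g: "g \<in> mod_hom R (D i) F"
      have "(\<lambda>k\<in>J. g (v k)) \<in> ?Y" using D[OF i] v g by auto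
      then have "\<psi> (\<lambda>k\<in>J. g (v k)) = \<one>\<^bsub>QZ\<^esub>" using \<psi>Y by (rule bspec[rotated])
      then show "(\<Otimes>\<^bsub>QZ\<^esub>k\<in>J. c k (g (v k))) = \<one>\<^bsub>QZ\<^esub>"
        using \<psi>_restrict[of "\<lambda>k. g (v k)"] mod_hom_closed[OF g funcset_mem[OF vc]] by simp
    qed
  qed auto
  then obtain t where t: "\<And>i. i \<in> I \<Longrightarrow> t i \<in> S \<rightarrow> carrier (character_module (D i))"
    and jt: "\<And>i k. \<lbrakk>i \<in> I; k \<in> J\<rbrakk> \<Longrightarrow> j (c k) i = lincomb (character_module (D i)) S (\<lambda>s. s k) (t i)"
    by metis
  \<comment> \<open>the coefficients found for the various \<open>i\<close> form elements of the product, so that \<open>p\<close> applies\<close>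
  define t' where "t' s = (\<lambda>i\<in>I. t i s)" for s
  have t': "t' \<in> S \<rightarrow> carrier ?P"
    using funcset_mem[OF t] by (auto simp: t'_def product_module_simps)
  have row: "(\<lambda>s. s k) \<in> S \<rightarrow> carrier R" if "k \<in> J" for k using SJ that by auto
  have jc: "j (c k) = lincomb ?P S (\<lambda>s. s k) t'" if k: "k \<in> J" for k
  proof (rule extensionalityI)
    have "j (c k) \<in> carrier ?P" using mod_hom_closed[OF j funcset_mem[OF c k]] .
    then show "j (c k) \<in> extensional I" by (simp add: product_module_simps PiE_iff)
    have "lincomb ?P S (\<lambda>s. s k) t' \<in> carrier ?P"
      unfolding lincomb_def using funcset_mem[OF row[OF k]] funcset_mem[OF t']
      by (intro P.M.finsum_closed) (auto intro!: P.smult_closed)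
    then show "lincomb ?P S (\<lambda>s. s k) t' \<in> extensional I" by (simp add: product_module_simps PiE_iff)
    fix i assume i: "i \<in> I"
    interpret CDi: right_module R "character_module (D i)" by (rule CD[OF i])
    have pr: "(\<lambda>f. f i) \<in> mod_hom R ?P (character_module (D i))"
      using i by (intro mod_homI) (auto simp: product_module_simps)
    have "lincomb ?P S (\<lambda>s. s k) t' i = lincomb (character_module (D i)) S (\<lambda>s. s k) (\<lambda>s. t' s i)"
      by (rule mod_hom_lincomb[OF pr P.M.abelian_group_axioms CDi.M.abelian_group_axioms P.smult_closed row[OF k] t'])
    also have "(\<lambda>s. t' s i) = t i" using i by (simp add: t'_def fun_eq_iff)
    finally show "j (c k) i = lincomb ?P S (\<lambda>s. s k) t' i" using jt[OF i k] by simp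
  qed
  have pt': "(\<lambda>s. p (t' s)) \<in> S \<rightarrow> carrier (character_module F)"
    using mod_hom_closed[OF p funcset_mem[OF t']] by simp
  have ck: "c k = lincomb (character_module F) S (\<lambda>s. s k) (\<lambda>s. p (t' s))" if k: "k \<in> J" for k
  proof -
    have "c k = p (lincomb ?P S (\<lambda>s. s k) t')" using pj[OF funcset_mem[OF c k]] jc[OF k] by simp
    also have "\<dots> = lincomb (character_module F) S (\<lambda>s. s k) (\<lambda>s. p (t' s))"
      by (rule mod_hom_lincomb[OF p P.M.abelian_group_axioms CF.M.abelian_group_axioms P.smult_closed row[OF k] t'])
    finally show ?thesis .
  qed
  have "\<psi> ?y = (\<Otimes>\<^bsub>QZ\<^esub>k\<in>J. c k (y k))" by (rule \<psi>_restrict[OF yc])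
  also have "\<dots> = (\<Otimes>\<^bsub>QZ\<^esub>k\<in>J. lincomb (character_module F) S (\<lambda>s. s k) (\<lambda>s. p (t' s)) (y k))"
  proof (rule QZ.finprod_cong')
    show "(\<lambda>k. lincomb (character_module F) S (\<lambda>s. s k) (\<lambda>s. p (t' s)) (y k)) \<in> J \<rightarrow> carrier QZ"
      using character_closed[OF funcset_mem[OF c] funcset_mem[OF yc]] by (simp flip: ck)
    show "c k (y k) = lincomb (character_module F) S (\<lambda>s. s k) (\<lambda>s. p (t' s)) (y k)" if "k \<in> J" for k
      by (rule fun_cong[OF ck[OF that]])
  qed simp
  also have "\<dots> = (\<Otimes>\<^bsub>QZ\<^esub>s\<in>S. p (t' s) (lincomb F J s y))"
    using funcset_mem[OF row] by (intro pairing_transpose[OF F fin _ pt' yc])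
  also have "\<dots> = (\<Otimes>\<^bsub>QZ\<^esub>s\<in>S. \<one>\<^bsub>QZ\<^esub>)"
    using character_zero[OF funcset_mem[OF pt'] F.M.abelian_group_axioms]
    by (intro QZ.finprod_cong') (simp_all add: y0)
  finally show False using \<psi>y by simp
qed

text \<open>
  The homomorphism \<open>g\<close> induces one on the quotient of \<open>B\<close> by \<open>K\<close>, and it factors through \<open>\<B>\<close> because the
  quotient is finitely presented.  This provides the arrows that make the category of
  modules over \<open>F\<close> filtered.
\<close>

lemma solutions_factor_kill:
  assumes fac: "solutions_factor R \<B> F" and fp: "\<And>B. B \<in> \<B> \<Longrightarrow> finitely_presented R B"
    and F: "left_module R F" and B: "B \<in> \<B>" and g: "g \<in> mod_hom R B F"
    and K: "finite K" "K \<subseteq> carrier B" "\<And>x. x \<in> K \<Longrightarrow> g x = \<zero>\<^bsub>F\<^esub>"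
  shows "\<exists>C\<in>\<B>. \<exists>w\<in>mod_hom R B C. \<exists>h\<in>mod_hom R C F.
    (\<forall>x\<in>carrier B. h (w x) = g x) \<and> (\<forall>x\<in>K. w x = \<zero>\<^bsub>C\<^esub>)"
proof -
  have mods: "left_module R B" if "B \<in> \<B>" for B using fp[OF that] by (simp add: finitely_presented_def)
  obtain n S e where pr: "presented R B {..<n::nat} S e"
    using finitely_presentedD[OF fp[OF B]] .
  let ?J = "{..<n}"
  have e: "e \<in> ?J \<rightarrow> carrier B" and S: "finite S" "S \<subseteq> ?J \<rightarrow> carrier R"
    using pr by (auto simp: presented_def PiE_def)
  have "\<exists>a. a \<in> ?J \<rightarrow> carrier R \<and> x = lincomb B ?J a e" if "x \<in> K" for x
    using presented_generates[OF pr subsetD[OF K(2) that]] by auto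
  then obtain a where a: "\<And>x. x \<in> K \<Longrightarrow> a x \<in> ?J \<rightarrow> carrier R"
    and xa: "\<And>x. x \<in> K \<Longrightarrow> x = lincomb B ?J (a x) e" by metis
  \<comment> \<open>the quotient of \<open>B\<close> by \<open>K\<close> is presented by the relations of \<open>B\<close> together with those from \<open>K\<close>\<close>
  let ?S = "S \<union> a ` K"
  have S': "finite ?S" "?S \<subseteq> ?J \<rightarrow> carrier R" using S K(1) a by auto
  have "(\<lambda>k. g (e k)) \<in> solutions F ?J ?S"
  proof -
    have "(\<lambda>k. g (e k)) \<in> solutions F ?J S"
      using S(2) by (intro solutions_mod_hom[OF g mods[OF B] F _ presented_solution[OF pr]]) auto
    moreover have "lincomb F ?J (a x) (\<lambda>k. g (e k)) = \<zero>\<^bsub>F\<^esub>" if "x \<in> K" for x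
      using left_mod_hom_lincomb[OF g mods[OF B] F a[OF that] e] xa[OF that] K(3)[OF that] by simp
    ultimately show ?thesis by (auto simp: solutions_def)
  qed
  from solutions_factorD[OF fac S' this] obtain C c h where C: "C \<in> \<B>" and c: "c \<in> solutions C ?J ?S" and h: "h \<in> mod_hom R C F"
    and gh0: "\<forall>k\<in>{..<n}. g (e k) = h (c k)" by (elim bexE) (rule that)
  have gh: "g (e k) = h (c k)" if "k \<in> ?J" for k using gh0 that by simp
  have "c \<in> solutions C ?J S" using c by (simp add: solutions_def)
  from presented_universal[OF mods[OF B] mods[OF C] pr this] obtain w
    where w: "w \<in> mod_hom R B C" and we: "\<And>k. k \<in> ?J \<Longrightarrow> w (e k) = c k" by auto
  have "h (w x) = g x" if "x \<in> carrier B" for x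
    by (rule presented_hom_eqI[OF pr mods[OF B] F mod_hom_compose[OF w h] g _ that]) (simp add: we gh)
  moreover have "w x = \<zero>\<^bsub>C\<^esub>" if x: "x \<in> K" for x
  proof -
    have "w x = lincomb C ?J (a x) (\<lambda>k. w (e k))"
      using left_mod_hom_lincomb[OF w mods[OF B] mods[OF C] a[OF x] e] xa[OF x] by simp
    also have "\<dots> = lincomb C ?J (a x) c"
      using c by (intro lincomb_cong[OF _ we mods[OF C] a[OF x]]) (auto simp: solutions_def)
    also have "\<dots> = \<zero>\<^bsub>C\<^esub>" using c x by (simp add: solutions_def)
    finally show ?thesis .
  qed
  ultimately show ?thesis using C w h by (intro bexI conjI ballI)
qed

section \<open>Limits of functions into the rationals modulo integers\<close>

text \<open>
  An additive extension of the limit along a filter, as a Banach limit is for bounded sequences.  A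
  function may take arbitrary values outside a member of the filter, so that maps that make sense only
  eventually need no case distinction.
\<close>

definition QZ_limit :: "'l filter \<Rightarrow> (('l \<Rightarrow> rat set) \<Rightarrow> rat set) \<Rightarrow> bool"
  where "QZ_limit \<Phi> L \<longleftrightarrow>
    (\<forall>f. L f \<in> carrier QZ) \<and>
    (\<forall>f g. (\<forall>\<^sub>F l in \<Phi>. f l = g l) \<longrightarrow> L f = L g) \<and>
    (\<forall>f g. (\<forall>\<^sub>F l in \<Phi>. f l \<in> carrier QZ) \<longrightarrow> (\<forall>\<^sub>F l in \<Phi>. g l \<in> carrier QZ) \<longrightarrow>
      L (\<lambda>l. f l \<otimes>\<^bsub>QZ\<^esub> g l) = L f \<otimes>\<^bsub>QZ\<^esub> L g) \<and>
    (\<forall>q\<in>carrier QZ. L (\<lambda>_. q) = q)"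

text \<open>
  On functions that are eventually constant the limit is a partial homomorphism, single-valued as
  the filter is proper.  It extends to all functions by injectivity of \<open>\<rat>/\<int>\<close>.
\<close>

proposition QZ_limit_exists:
  assumes "\<Phi> \<noteq> bot"
  shows "\<exists>L. QZ_limit \<Phi> L"
proof -
  let ?G = "product_group UNIV (\<lambda>_::'a. QZ)"
  interpret G: comm_group ?G
    by (rule comm_group.intro)
      (auto simp: comm_monoid_def comm_monoid_axioms_def QZ.m_comm product_group group.is_monoid QZ.is_group PiE_iff)
  have ev: "q = r" if "\<forall>\<^sub>F l in \<Phi>. f l = q" "\<forall>\<^sub>F l in \<Phi>. f l = r" for f :: "'a \<Rightarrow> rat set" and q r
  proof -
    have "\<forall>\<^sub>F l in \<Phi>. q = r" using that by eventually_elim simp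
    then show ?thesis using assms by (simp add: eventually_const_iff)
  qed
  \<comment> \<open>the graph of the limit on eventually constant functions\<close>
  let ?\<Gamma> = "{(f, q). f \<in> carrier ?G \<and> q \<in> carrier QZ \<and> (\<forall>\<^sub>F l in \<Phi>. f l = q)}"
  have "subgroup ?\<Gamma> (?G \<times>\<times> QZ)"
  proof
    show "?\<Gamma> \<subseteq> carrier (?G \<times>\<times> QZ)" by auto
    show "\<one>\<^bsub>?G \<times>\<times> QZ\<^esub> \<in> ?\<Gamma>" by auto
  next
    fix x y assume "x \<in> ?\<Gamma>" "y \<in> ?\<Gamma>"
    then obtain f q g r where xy: "x = (f, q)" "y = (g, r)" and
      m: "f \<in> carrier ?G" "g \<in> carrier ?G" "q \<in> carrier QZ" "r \<in> carrier QZ"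
      and e: "\<forall>\<^sub>F l in \<Phi>. f l = q" "\<forall>\<^sub>F l in \<Phi>. g l = r" by auto
    from e have "\<forall>\<^sub>F l in \<Phi>. (f \<otimes>\<^bsub>?G\<^esub> g) l = q \<otimes>\<^bsub>QZ\<^esub> r" by eventually_elim simp
    then show "x \<otimes>\<^bsub>?G \<times>\<times> QZ\<^esub> y \<in> ?\<Gamma>"
      using m G.m_closed[OF m(1,2)] by (simp add: xy)
  next
    fix x assume "x \<in> ?\<Gamma>"
    then show "inv\<^bsub>?G \<times>\<times> QZ\<^esub> x \<in> ?\<Gamma>"
      using G.is_group QZ.is_group
      by (cases x) (auto simp: PiE_iff inv_product_group elim: eventually_mono)
  qed
  moreover have "q = \<one>\<^bsub>QZ\<^esub>" if "(\<one>\<^bsub>?G\<^esub>, q) \<in> ?\<Gamma>" for q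
    using that ev[of "\<one>\<^bsub>?G\<^esub>" q "\<one>\<^bsub>QZ\<^esub>"] by auto
  ultimately have "partial_char ?G ?\<Gamma>" by (simp add: partial_char_def)
  from partial_char_extends[OF G.comm_group_axioms this] obtain \<psi>
    where \<psi>: "\<psi> \<in> hom ?G QZ"
      and \<psi>_ev: "\<And>f q. \<lbrakk>f \<in> carrier ?G; q \<in> carrier QZ; \<forall>\<^sub>F l in \<Phi>. f l = q\<rbrakk> \<Longrightarrow> \<psi> f = q"
    by auto
  interpret \<psi>: group_hom ?G QZ \<psi>
    using \<psi> by (simp add: group_hom_def group_hom_axioms_def G.is_group QZ.is_group)
  \<comment> \<open>\<open>tr\<close> turns an arbitrary function into a \<open>\<rat>/\<int>\<close>-valued one\<close>
  define tr where "tr f l = (if f l \<in> carrier QZ then f l else \<one>\<^bsub>QZ\<^esub>)" for f :: "'a \<Rightarrow> rat set" and l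
  have tr: "tr f \<in> carrier ?G" for f by (auto simp: tr_def)
  have cong: "\<psi> f = \<psi> g" if "f \<in> carrier ?G" "g \<in> carrier ?G" "\<forall>\<^sub>F l in \<Phi>. f l = g l" for f g
  proof -
    have g: "g l \<in> carrier QZ" for l using that(2) by auto
    have "\<psi> (f \<otimes>\<^bsub>?G\<^esub> inv\<^bsub>?G\<^esub> g) = \<one>\<^bsub>QZ\<^esub>"
    proof (rule \<psi>_ev)
      show "\<forall>\<^sub>F l in \<Phi>. (f \<otimes>\<^bsub>?G\<^esub> inv\<^bsub>?G\<^esub> g) l = \<one>\<^bsub>QZ\<^esub>"
        using that(3) by eventually_elim (use that g QZ.is_group in \<open>auto simp: inv_product_group PiE_iff\<close>)
    qed (use that in auto)
    moreover have "\<psi> (f \<otimes>\<^bsub>?G\<^esub> inv\<^bsub>?G\<^esub> g) = \<psi> f \<otimes>\<^bsub>QZ\<^esub> \<psi> (inv\<^bsub>?G\<^esub> g)"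
      using that by (intro \<psi>.hom_mult G.inv_closed)
    moreover have "\<psi> (inv\<^bsub>?G\<^esub> g) = inv\<^bsub>QZ\<^esub> \<psi> g"
      using that(2) by (rule \<psi>.hom_inv)
    moreover have "\<psi> f \<in> carrier QZ" "\<psi> g \<in> carrier QZ" using \<psi> that by (auto intro: hom_in_carrier)
    ultimately show ?thesis by (metis QZ.inv_closed QZ.inv_equality QZ.inv_inv)
  qed
  have "QZ_limit \<Phi> (\<lambda>f. \<psi> (tr f))"
    unfolding QZ_limit_def
  proof (intro conjI allI impI ballI)
    show "\<psi> (tr f) \<in> carrier QZ" for f using \<psi> tr by (rule hom_in_carrier)
    show "\<psi> (tr f) = \<psi> (tr g)" if "\<forall>\<^sub>F l in \<Phi>. f l = g l" for f g
      using that by (intro cong tr) (auto simp: tr_def elim: eventually_mono)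
    show "\<psi> (tr (\<lambda>_. q)) = q" if "q \<in> carrier QZ" for q
      using that by (intro \<psi>_ev tr) (auto simp: tr_def)
    fix f g assume f: "\<forall>\<^sub>F l in \<Phi>. f l \<in> carrier QZ" and g: "\<forall>\<^sub>F l in \<Phi>. g l \<in> carrier QZ"
    have "\<psi> (tr (\<lambda>l. f l \<otimes>\<^bsub>QZ\<^esub> g l)) = \<psi> (tr f \<otimes>\<^bsub>?G\<^esub> tr g)"
      by (rule cong) (use f g tr in \<open>auto simp: tr_def elim: eventually_elim2\<close>)
    also have "\<dots> = \<psi> (tr f) \<otimes>\<^bsub>QZ\<^esub> \<psi> (tr g)"
      by (intro \<psi>.hom_mult tr)
    finally show "\<psi> (tr (\<lambda>l. f l \<otimes>\<^bsub>QZ\<^esub> g l)) = \<psi> (tr f) \<otimes>\<^bsub>QZ\<^esub> \<psi> (tr g)" .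
  qed
  then show ?thesis by blast
qed

lemma QZ_limitD:
  assumes "QZ_limit \<Phi> L"
  shows "L f \<in> carrier QZ"
    and "\<forall>\<^sub>F l in \<Phi>. f l = g l \<Longrightarrow> L f = L g"
    and "\<lbrakk>\<forall>\<^sub>F l in \<Phi>. f l \<in> carrier QZ; \<forall>\<^sub>F l in \<Phi>. g l \<in> carrier QZ\<rbrakk> \<Longrightarrow>
      L (\<lambda>l. f l \<otimes>\<^bsub>QZ\<^esub> g l) = L f \<otimes>\<^bsub>QZ\<^esub> L g"
    and "q \<in> carrier QZ \<Longrightarrow> L (\<lambda>_. q) = q"
  using assms unfolding QZ_limit_def by simp_all

lemma QZ_limit_add:
  assumes "QZ_limit \<Phi> L"
    and "\<forall>\<^sub>F l in \<Phi>. f l \<in> carrier QZ \<and> g l \<in> carrier QZ \<and> e l = f l \<otimes>\<^bsub>QZ\<^esub> g l"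
  shows "L e = L f \<otimes>\<^bsub>QZ\<^esub> L g"
proof -
  have "L e = L (\<lambda>l. f l \<otimes>\<^bsub>QZ\<^esub> g l)"
    using assms(2) by (intro QZ_limitD(2)[OF assms(1)]) (auto elim: eventually_mono)
  also have "\<dots> = L f \<otimes>\<^bsub>QZ\<^esub> L g"
    using assms(2) by (intro QZ_limitD(3)[OF assms(1)]) (auto elim: eventually_mono)
  finally show ?thesis .
qed

section \<open>Character modules of filtered colimits\<close>

text \<open>
  Every finite diagram in a filtered category has a cocone: a common target exists for the objects, and each
  of the finitely many arrows is made to commute by one coequalising step.
\<close>

lemma (in filtered_category) finite_cocone:
  assumes "finite A" "A \<subseteq> Obj C" "finite V" "V \<subseteq> Arr C"
    and "\<And>v. v \<in> V \<Longrightarrow> Dom C v \<in> A \<and> Cod C v \<in> A"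
  shows "\<exists>k\<in>Obj C. \<exists>u. (\<forall>i\<in>A. u i \<in> Hom_set C i k) \<and> (\<forall>v\<in>V. Comp C (u (Cod C v)) v = u (Dom C v))"
  using assms(3-5)
proof (induction V rule: finite_induct)
  case empty
  from assms(1,2) have "\<exists>k\<in>Obj C. \<exists>u. \<forall>i\<in>A. u i \<in> Hom_set C i k"
  proof (induction A rule: finite_induct)
    case empty
    then show ?case using nonempty by auto
  next
    case (insert i A)
    then obtain k u where k: "k \<in> Obj C" and u: "\<And>j. j \<in> A \<Longrightarrow> u j \<in> Hom_set C j k" by auto
    obtain l a b where l: "l \<in> Obj C" and a: "a \<in> Hom_set C k l" and b: "b \<in> Hom_set C i l"
      using upper_bound[of k i] k insert.prems by auto
    have "\<forall>j\<in>insert i A. (\<lambda>j. if j = i then b else Comp C a (u j)) j \<in> Hom_set C j l"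
      using b comp_hom[OF u a] by auto
    then show ?case using l by (intro bexI[of _ l] exI[of _ "\<lambda>j. if j = i then b else Comp C a (u j)"])
  qed
  then show ?case by simp
next
  case (insert v V)
  then have "\<exists>k\<in>Obj C. \<exists>u. (\<forall>i\<in>A. u i \<in> Hom_set C i k) \<and> (\<forall>v\<in>V. Comp C (u (Cod C v)) v = u (Dom C v))"
    by simp
  then obtain k u where k: "k \<in> Obj C" and u0: "\<forall>i\<in>A. u i \<in> Hom_set C i k"
    and uV0: "\<forall>v\<in>V. Comp C (u (Cod C v)) v = u (Dom C v)" by (elim bexE exE conjE) (rule that)
  note u = bspec[OF u0] and uV = bspec[OF uV0]
  have hom: "w \<in> Hom_set C (Dom C w) (Cod C w)" if "w \<in> insert v V" for w
    using insert.prems(1) that by (auto simp: Hom_set_def)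
  have DC: "Dom C w \<in> A" "Cod C w \<in> A" if "w \<in> insert v V" for w using insert.prems(2) that by auto
  obtain l w where l: "l \<in> Obj C" and w: "w \<in> Hom_set C k l"
    and eq: "Comp C w (Comp C (u (Cod C v)) v) = Comp C w (u (Dom C v))"
    using coequalize[OF comp_hom[OF hom u[OF DC(2)]] u[OF DC(1)]] by blast
  have "Comp C (Comp C w (u (Cod C v'))) v' = Comp C w (u (Dom C v'))" if v': "v' \<in> insert v V" for v'
    using comp_assoc[OF hom[OF v'] u[OF DC(2)[OF v']] w] eq uV v' by auto
  then show ?case
    using l comp_hom[OF u w] by (intro bexI[of _ l] exI[of _ "\<lambda>i. Comp C w (u i)"]) auto
qed

definition arrow_cocones :: "('i, 'a) small_cat \<Rightarrow> 'a \<Rightarrow> ('i \<times> ('i \<Rightarrow> 'a)) set"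
  where "arrow_cocones C v = {(k, u). k \<in> Obj C \<and> u (Dom C v) \<in> Hom_set C (Dom C v) k \<and>
    u (Cod C v) \<in> Hom_set C (Cod C v) k \<and> Comp C (u (Cod C v)) v = u (Dom C v)}"

text \<open>
  A point \<open>(k, u)\<close> approximates a cocone on the whole category, with vertex \<open>k\<close> and components
  \<open>u i : i \<rightarrow> k\<close>; moving along the filter makes it a cocone on more and more arrows.  For directed
  posets it amounts to the filter of tails; in general, the point has to record the arrows, because
  there is no canonical arrow \<open>i \<rightarrow> k\<close>.
\<close>

definition cocone_filter :: "('i, 'a) small_cat \<Rightarrow> ('i \<times> ('i \<Rightarrow> 'a)) filter"
  where "cocone_filter C = (INF v\<in>Arr C. principal (arrow_cocones C v))"

lemma eventually_cocone_filter:
  assumes "v \<in> Arr C"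
  shows "\<forall>\<^sub>F (k, u) in cocone_filter C. k \<in> Obj C \<and>
    u (Dom C v) \<in> Hom_set C (Dom C v) k \<and> u (Cod C v) \<in> Hom_set C (Cod C v) k \<and>
    Comp C (u (Cod C v)) v = u (Dom C v)"
  unfolding cocone_filter_def
  by (rule eventually_INF1[OF assms]) (auto simp: eventually_principal arrow_cocones_def)

lemma (in small_category) eventually_cocone_filter_obj:
  assumes "i \<in> Obj C"
  shows "\<forall>\<^sub>F (k, u) in cocone_filter C. k \<in> Obj C \<and> u i \<in> Hom_set C i k"
proof -
  have "Ident C i \<in> Arr C" "Dom C (Ident C i) = i" "Cod C (Ident C i) = i"
    using ident_hom[OF assms] by (auto simp: Hom_set_def)
  with eventually_cocone_filter[of "Ident C i" C] show ?thesis
    by (auto elim!: eventually_mono)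
qed

lemma (in filtered_category) cocone_filter_nontrivial: "cocone_filter C \<noteq> bot"
  unfolding cocone_filter_def
proof (rule INF_filter_not_bot)
  fix V assume V: "V \<subseteq> Arr C" "finite V"
  have "\<exists>k\<in>Obj C. \<exists>u. (\<forall>i\<in>Dom C ` V \<union> Cod C ` V. u i \<in> Hom_set C i k) \<and>
      (\<forall>v\<in>V. Comp C (u (Cod C v)) v = u (Dom C v))"
    using V dom_obj cod_obj by (intro finite_cocone) auto
  then obtain k u where k: "k \<in> Obj C" and u: "\<And>i. i \<in> Dom C ` V \<union> Cod C ` V \<Longrightarrow> u i \<in> Hom_set C i k"
    and uV: "\<And>v. v \<in> V \<Longrightarrow> Comp C (u (Cod C v)) v = u (Dom C v)" by blast
  then have "(k, u) \<in> (\<Inter>v\<in>V. arrow_cocones C v)" by (auto simp: arrow_cocones_def)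
  then show "(INF v\<in>V. principal (arrow_cocones C v)) \<noteq> bot"
    unfolding INF_principal_finite[OF V(2)] principal_eq_bot_iff by blast
qed

lemma evaluation_mod_hom:
  assumes M: "left_module R M"
  shows "(\<lambda>x. \<lambda>c\<in>carrier (character_module M). c x) \<in>
    mod_hom R M (character_module (character_module M))"
proof -
  interpret M: left_module R M by fact
  interpret C: right_module R "character_module M" using M by (rule right_module_character_module)
  have sm: "(a \<odot>\<^bsub>character_module M\<^esub> c) x = c (a \<odot>\<^bsub>M\<^esub> x)" if "x \<in> carrier M" for a c x
    using that by (simp add: character_module_simps(4))
  have ad: "(c \<oplus>\<^bsub>character_module M\<^esub> d) x = c x \<otimes>\<^bsub>QZ\<^esub> d x" if "x \<in> carrier M" for c d x
    using that by (simp add: character_module_simps(3))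
  show ?thesis
  proof (rule mod_homI)
    fix x assume x: "x \<in> carrier M"
    show "(\<lambda>c\<in>carrier (character_module M). c x) \<in> carrier (character_module (character_module M))"
      unfolding character_module_simps(1)[of _ "character_module M"]
      using x character_closed[OF _ x]
      by (auto intro!: homI simp: ad)
    show "(\<lambda>c\<in>carrier (character_module M). c (a \<odot>\<^bsub>M\<^esub> x)) =
        a \<odot>\<^bsub>character_module (character_module M)\<^esub> (\<lambda>c\<in>carrier (character_module M). c x)"
      if a: "a \<in> carrier R" for a
      unfolding character_module_simps(4)[of "character_module M"]
      using C.smult_closed[OF a] sm[OF x] by (auto intro!: restrict_ext)
    fix y assume y: "y \<in> carrier M"
    show "(\<lambda>c\<in>carrier (character_module M). c (x \<oplus>\<^bsub>M\<^esub> y)) =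
        (\<lambda>c\<in>carrier (character_module M). c x) \<oplus>\<^bsub>character_module (character_module M)\<^esub>
        (\<lambda>c\<in>carrier (character_module M). c y)"
      unfolding character_module_simps(3)[of "character_module M"]
      using character_add[OF _ x y] by (auto intro!: restrict_ext)
  qed
qed

lemma character_module_dual_hom:
  assumes j: "j \<in> mod_hom R M N"
    and smult: "\<And>a x. \<lbrakk>a \<in> carrier R; x \<in> carrier M\<rbrakk> \<Longrightarrow> a \<odot>\<^bsub>M\<^esub> x \<in> carrier M"
    and add: "\<And>x y. \<lbrakk>x \<in> carrier M; y \<in> carrier M\<rbrakk> \<Longrightarrow> x \<oplus>\<^bsub>M\<^esub> y \<in> carrier M"
  shows "(\<lambda>f. \<lambda>x\<in>carrier M. f (j x)) \<in> mod_hom R (character_module N) (character_module M)"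
proof (rule mod_homI)
  note jc = mod_hom_closed[OF j]
  fix f assume f: "f \<in> carrier (character_module N)"
  show "(\<lambda>x\<in>carrier M. f (j x)) \<in> carrier (character_module M)"
    unfolding character_module_simps(1)
    using character_closed[OF f jc] character_add[OF f jc jc]
    by (auto intro!: homI simp: mod_hom_add[OF j] add)
  show "(\<lambda>x\<in>carrier M. (a \<odot>\<^bsub>character_module N\<^esub> f) (j x)) =
      a \<odot>\<^bsub>character_module M\<^esub> (\<lambda>x\<in>carrier M. f (j x))" if "a \<in> carrier R" for a
    unfolding character_module_simps(4)
    using that jc smult by (auto intro!: restrict_ext simp: mod_hom_smult[OF j])
  fix g
  show "(\<lambda>x\<in>carrier M. (f \<oplus>\<^bsub>character_module N\<^esub> g) (j x)) =
      (\<lambda>x\<in>carrier M. f (j x)) \<oplus>\<^bsub>character_module M\<^esub> (\<lambda>x\<in>carrier M. g (j x))"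
    unfolding character_module_simps(3) using jc by (auto intro!: restrict_ext)
qed

text \<open>
  The retraction \<open>p\<close> is adjoint to the map \<open>h\<close> from the colimit that is induced by the cocone \<open>g\<close> of
  generalised limits.
\<close>

theorem filtered_colimit_character_module:
  fixes C :: "('i, 'a) small_cat" and F :: "('r, 'f, 'z) module_scheme"
    and D :: "'i \<Rightarrow> ('r, 'b, 'y) module_scheme"
  assumes C: "filtered_category C" and dia: "module_diagram C R D T" and F: "left_module R F"
    and iso: "mod_iso R (colim R C D T) F"
  shows "is_direct_summand R (character_module F)
    (product_module (Obj C) (\<lambda>i. character_module (D i)))"
proof -
  interpret F: left_module R F by fact
  interpret filtered_category C by fact
  interpret module_diagram C R D T by fact
  note R = F.R.ring_axioms
  interpret K: left_module R "colim R C D T" by (rule left_module_colim[OF R])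
  interpret CF: right_module R "character_module F" using F by (rule right_module_character_module)
  have CD: "right_module R (character_module (D i))" if "i \<in> Obj C" for i
    using right_module_character_module[OF obj_module[OF that]] .
  let ?P = "product_module (Obj C) (\<lambda>i. character_module (D i))"
  interpret P: right_module R ?P using R CD by (rule right_module_product_module)
  let ?N = "character_module ?P"
  have N: "left_module R ?N" by (rule left_module_character_module) (rule P.right_module_axioms)
  interpret N: left_module R ?N by (rule N)
  obtain \<phi> where \<phi>: "\<phi> \<in> mod_hom R (colim R C D T) F"
    and bij: "bij_betw \<phi> (carrier (colim R C D T)) (carrier F)"
    using iso unfolding mod_iso_def by (elim bexE) (rule that)
  let ?\<psi> = "inv_into (carrier (colim R C D T)) \<phi>"
  have \<psi>: "?\<psi> \<in> mod_hom R F (colim R C D T)"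
    by (rule mod_hom_inv_into[OF \<phi> bij K.M.a_closed K.smult_closed])
  have \<phi>\<psi>: "\<phi> (?\<psi> x) = x" if "x \<in> carrier F" for x
    using bij that by (rule bij_betw_inv_into_right)
  obtain L where L: "QZ_limit (cocone_filter C) L"
    using QZ_limit_exists[OF cocone_filter_nontrivial] by (elim exE) (rule that)
  note LD = QZ_limitD[OF L]
  have tc: "t k z \<in> carrier QZ" if "t \<in> carrier ?P" "k \<in> Obj C" "z \<in> carrier (D k)" for t k z
    using that by (auto simp: product_module_simps(1) intro!: character_closed[where M="D k"])
  have tadd: "t k (z \<oplus>\<^bsub>D k\<^esub> z') = t k z \<otimes>\<^bsub>QZ\<^esub> t k z'"
    if "t \<in> carrier ?P" "k \<in> Obj C" "z \<in> carrier (D k)" "z' \<in> carrier (D k)" for t k z z'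
    using that(2-4) PiE_mem[OF that(1)[unfolded product_module_simps(1)] that(2)]
    by (intro character_add)
  have Pops: "(t \<oplus>\<^bsub>?P\<^esub> t') k z = t k z \<otimes>\<^bsub>QZ\<^esub> t' k z" "(a \<odot>\<^bsub>?P\<^esub> t) k z = t k (a \<odot>\<^bsub>D k\<^esub> z)"
    if "k \<in> Obj C" "z \<in> carrier (D k)" for t t' a k z
    using that by (simp_all add: product_module_simps(3,4) character_module_simps(3,4))
  have Tc: "T v z \<in> carrier (D k)" if "v \<in> Hom_set C i k" "z \<in> carrier (D i)" for v i k z
    using mod_hom_closed[OF arr_hom[OF that(1)] that(2)] .
  note ev = eventually_cocone_filter_obj
  define g where "g i b = (\<lambda>t\<in>carrier ?P. L (\<lambda>(k, u). t k (T (u i) b)))" for i b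
  have g_hom: "g i \<in> mod_hom R (D i) ?N" if i: "i \<in> Obj C" for i
  proof (rule mod_homI)
    interpret Di: left_module R "D i" by (rule obj_module[OF i])
    fix b assume b: "b \<in> carrier (D i)"
    have add_t: "L (\<lambda>(k, u). (t \<oplus>\<^bsub>?P\<^esub> t') k (T (u i) b)) =
        L (\<lambda>(k, u). t k (T (u i) b)) \<otimes>\<^bsub>QZ\<^esub> L (\<lambda>(k, u). t' k (T (u i) b))"
      if "t \<in> carrier ?P" "t' \<in> carrier ?P" for t t'
      using ev[OF i] by (intro QZ_limit_add[OF L])
        (auto elim!: eventually_mono simp: Pops(1)[OF _ Tc[OF _ b]] tc[OF that(1) _ Tc[OF _ b]] tc[OF that(2) _ Tc[OF _ b]])
    show "g i b \<in> carrier ?N"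
      unfolding g_def character_module_simps(1)
      using add_t LD(1) by (auto intro!: homI)
    show "g i (a \<odot>\<^bsub>D i\<^esub> b) = a \<odot>\<^bsub>?N\<^esub> g i b" if a: "a \<in> carrier R" for a
      unfolding g_def character_module_simps(4)[of ?P]
    proof (rule restrict_ext)
      fix t assume t: "t \<in> carrier ?P"
      have "L (\<lambda>(k, u). t k (T (u i) (a \<odot>\<^bsub>D i\<^esub> b))) = L (\<lambda>(k, u). (a \<odot>\<^bsub>?P\<^esub> t) k (T (u i) b))"
        using ev[OF i] by (intro LD(2))
          (auto elim!: eventually_mono simp: Pops(2)[OF _ Tc[OF _ b]] mod_hom_smult[OF arr_hom a b])
      then show "L (\<lambda>(k, u). t k (T (u i) (a \<odot>\<^bsub>D i\<^esub> b))) =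
          (\<lambda>t\<in>carrier ?P. L (\<lambda>(k, u). t k (T (u i) b))) (a \<odot>\<^bsub>?P\<^esub> t)"
        using P.smult_closed[OF a t] by simp
    qed
    fix b' assume b': "b' \<in> carrier (D i)"
    show "g i (b \<oplus>\<^bsub>D i\<^esub> b') = g i b \<oplus>\<^bsub>?N\<^esub> g i b'"
      unfolding g_def character_module_simps(3)[of ?P]
    proof (rule restrict_ext)
      fix t assume t: "t \<in> carrier ?P"
      have "L (\<lambda>(k, u). t k (T (u i) (b \<oplus>\<^bsub>D i\<^esub> b'))) =
          L (\<lambda>(k, u). t k (T (u i) b)) \<otimes>\<^bsub>QZ\<^esub> L (\<lambda>(k, u). t k (T (u i) b'))"
        using ev[OF i] by (intro QZ_limit_add[OF L])
          (auto elim!: eventually_mono simp: tc[OF t _ Tc[OF _ b]] tc[OF t _ Tc[OF _ b']]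
            mod_hom_add[OF arr_hom b b'] tadd[OF t _ Tc[OF _ b] Tc[OF _ b']])
      then show "L (\<lambda>(k, u). t k (T (u i) (b \<oplus>\<^bsub>D i\<^esub> b'))) =
          (\<lambda>t\<in>carrier ?P. L (\<lambda>(k, u). t k (T (u i) b))) t \<otimes>\<^bsub>QZ\<^esub>
          (\<lambda>t\<in>carrier ?P. L (\<lambda>(k, u). t k (T (u i) b'))) t"
        using t by simp
    qed
  qed
  have g_cocone: "g j (T v b) = g i b" if v: "v \<in> Hom_set C i j" and b: "b \<in> carrier (D i)" for i j v b
    unfolding g_def
  proof (rule restrict_ext)
    fix t :: "'i \<Rightarrow> 'b \<Rightarrow> rat set"
    have vA: "v \<in> Arr C" "Dom C v = i" "Cod C v = j" using v by (auto simp: Hom_set_def)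
    have "\<forall>\<^sub>F (k, u) in cocone_filter C. t k (T (u j) (T v b)) = t k (T (u i) b)"
      using eventually_cocone_filter[OF vA(1)]
    proof (rule eventually_mono, clarify)
      fix k u assume "u (Cod C v) \<in> Hom_set C (Cod C v) k" "Comp C (u (Cod C v)) v = u (Dom C v)"
      then show "t k (T (u j) (T v b)) = t k (T (u i) b)"
        using map_comp[OF v _ b, of "u j" k] by (simp add: vA)
    qed
    then show "L (\<lambda>(k, u). t k (T (u j) (T v b))) = L (\<lambda>(k, u). t k (T (u i) b))"
      by (intro LD(2)) (simp add: case_prod_unfold)
  qed
  have "\<exists>h\<in>mod_hom R (colim R C D T) ?N.
      \<forall>i\<in>Obj C. \<forall>x\<in>carrier (D i). h (colim_inj R C D T i x) = g i x"
    by (rule colim_universal(1)[OF N g_hom g_cocone])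
  then obtain h where h: "h \<in> mod_hom R (colim R C D T) ?N"
    and hg: "\<forall>i\<in>Obj C. \<forall>x\<in>carrier (D i). h (colim_inj R C D T i x) = g i x"
    by (elim bexE) (rule that)
  define j where "j c = (\<lambda>i\<in>Obj C. \<lambda>b\<in>carrier (D i). c (\<phi> (colim_inj R C D T i b)))"
    for c :: "'f \<Rightarrow> rat set"
  have inj: "(\<lambda>b. \<phi> (colim_inj R C D T i b)) \<in> mod_hom R (D i) F" if "i \<in> Obj C" for i
    by (rule mod_hom_compose[OF colim_inj_cocone(1)[OF R that] \<phi>])
  have j_hom: "j \<in> mod_hom R (character_module F) ?P"
  proof (rule mod_homI)
    have ji: "(\<lambda>c. \<lambda>b\<in>carrier (D i). c (\<phi> (colim_inj R C D T i b))) \<in>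
        mod_hom R (character_module F) (character_module (D i))" if i: "i \<in> Obj C" for i
    proof -
      interpret Di: left_module R "D i" by (rule obj_module[OF i])
      show ?thesis by (rule character_module_dual_hom[OF inj[OF i] Di.smult_closed Di.M.a_closed])
    qed
    fix c assume c: "c \<in> carrier (character_module F)"
    show "j c \<in> carrier ?P"
      using mod_hom_closed[OF ji c] by (simp add: j_def product_module_simps(1))
    show "j (a \<odot>\<^bsub>character_module F\<^esub> c) = a \<odot>\<^bsub>?P\<^esub> j c" if "a \<in> carrier R" for a
      unfolding product_module_simps(4) using mod_hom_smult[OF ji that c]
      by (auto simp: j_def intro!: restrict_ext)
    fix c' assume c': "c' \<in> carrier (character_module F)"
    show "j (c \<oplus>\<^bsub>character_module F\<^esub> c') = j c \<oplus>\<^bsub>?P\<^esub> j c'"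
      unfolding product_module_simps(3) using mod_hom_add[OF ji c c']
      by (auto simp: j_def intro!: restrict_ext)
  qed
  define p where "p t = (\<lambda>x\<in>carrier F. h (?\<psi> x) t)" for t
  have h\<psi>: "(\<lambda>x. h (?\<psi> x)) \<in> mod_hom R F ?N" by (rule mod_hom_compose[OF \<psi> h])
  have p_hom: "p \<in> mod_hom R ?P (character_module F)"
  proof (rule mod_homI)
    fix t assume t: "t \<in> carrier ?P"
    show "p t \<in> carrier (character_module F)"
      unfolding character_module_simps(1)
      using t character_closed[OF mod_hom_closed[OF h\<psi>] t]
      by (auto intro!: homI simp: p_def mod_hom_add[OF h\<psi>] character_module_simps(3))
    show "p (a \<odot>\<^bsub>?P\<^esub> t) = a \<odot>\<^bsub>character_module F\<^esub> p t" if a: "a \<in> carrier R" for a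
      unfolding character_module_simps(4)[of F] p_def
      using t by (auto intro!: restrict_ext simp: F.smult_closed[OF a] mod_hom_smult[OF h\<psi> a] character_module_simps(4))
    fix t' assume t': "t' \<in> carrier ?P"
    show "p (t \<oplus>\<^bsub>?P\<^esub> t') = p t \<oplus>\<^bsub>character_module F\<^esub> p t'"
      unfolding character_module_simps(3)[of F] p_def
      using character_add[OF mod_hom_closed[OF h\<psi>] t t'] by (auto intro!: restrict_ext)
  qed
  have pj: "p (j c) = c" if c: "c \<in> carrier (character_module F)" for c
  proof -
    let ?FF = "character_module (character_module F)"
    have FF: "left_module R ?FF" by (rule left_module_character_module) (rule CF.right_module_axioms)
    have e1: "(\<lambda>y. \<lambda>c\<in>carrier (character_module F). h y (j c)) \<in> mod_hom R (colim R C D T) ?FF"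
      using mod_hom_compose[OF h character_module_dual_hom[OF j_hom CF.smult_closed CF.M.a_closed]] .
    have e2: "(\<lambda>y. \<lambda>c\<in>carrier (character_module F). c (\<phi> y)) \<in> mod_hom R (colim R C D T) ?FF"
      by (rule mod_hom_compose[OF \<phi> evaluation_mod_hom[OF F]])
    \<comment> \<open>\<open>h\<close> followed by the dual of \<open>j\<close> is the evaluation map of \<open>F\<close> after \<open>\<phi>\<close>: both induce \<open>g'\<close>\<close>
    define g' where "g' i b = (\<lambda>c\<in>carrier (character_module F). c (\<phi> (colim_inj R C D T i b)))" for i b
    have g'_hom: "g' i \<in> mod_hom R (D i) ?FF" if "i \<in> Obj C" for i
      unfolding g'_def by (rule mod_hom_compose[OF inj[OF that] evaluation_mod_hom[OF F]])
    have g'_cocone: "g' j (T v b) = g' i b" if "v \<in> Hom_set C i j" "b \<in> carrier (D i)" for i j v b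
      using colim_inj_cocone(2)[OF R that] by (simp add: g'_def)
    have eq: "(\<lambda>c\<in>carrier (character_module F). h (colim_inj R C D T i b) (j c)) =
        (\<lambda>c\<in>carrier (character_module F). c (\<phi> (colim_inj R C D T i b)))"
      if i: "i \<in> Obj C" and b: "b \<in> carrier (D i)" for i b
    proof (rule restrict_ext)
      fix c assume c: "c \<in> carrier (character_module F)"
      have "h (colim_inj R C D T i b) (j c) = L (\<lambda>(k, u). j c k (T (u i) b))"
        using hg i b mod_hom_closed[OF j_hom c] by (simp add: g_def)
      also have "\<dots> = L (\<lambda>_. c (\<phi> (colim_inj R C D T i b)))"
        using ev[OF i] by (intro LD(2))
          (auto elim!: eventually_mono simp: j_def Tc[OF _ b] colim_inj_cocone(2)[OF R _ b])
      also have "\<dots> = c (\<phi> (colim_inj R C D T i b))"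
        by (rule LD(4)[OF character_closed[OF c mod_hom_closed[OF inj[OF i] b]]])
      finally show "h (colim_inj R C D T i b) (j c) = c (\<phi> (colim_inj R C D T i b))" .
    qed
    show ?thesis
    proof (rule extensionalityI)
      show "p (j c) \<in> extensional (carrier F)" by (simp add: p_def)
      show "c \<in> extensional (carrier F)" using c by (simp add: character_module_simps(1))
      fix x assume x: "x \<in> carrier F"
      have "(\<lambda>c\<in>carrier (character_module F). h (?\<psi> x) (j c)) =
          (\<lambda>c\<in>carrier (character_module F). c (\<phi> (?\<psi> x)))"
        by (rule colim_universal(2)[OF FF g'_hom g'_cocone e1 e2 eq mod_hom_closed[OF \<psi> x]])
      from fun_cong[OF this, of c] show "p (j c) x = c x"
        using c x by (simp add: p_def \<phi>\<psi>)
    qed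
  qed
  show ?thesis
    unfolding direct_summand_iff_retract[OF CF.right_module_axioms P.right_module_axioms]
    using j_hom p_hom pj by (intro bexI[of _ j] bexI[of _ p] ballI)
qed

section \<open>Recognising filtered colimits\<close>

text \<open>
  Filteredness brings two elements of the diagram to a common module.  So the two conditions
  determine when images in \<open>F\<close> coincide, and sending such an image to the corresponding element of
  the colimit inverts the canonical homomorphism.
\<close>

lemma filtered_colimit_recognition:
  fixes C :: "('i, 'a) small_cat" and F :: "('r, 'f, 'z) module_scheme"
    and D :: "'i \<Rightarrow> ('r, 'b, 'y) module_scheme"
  assumes C: "filtered_category C" and dia: "module_diagram C R D T" and F: "left_module R F"
    and \<gamma>: "\<And>i. i \<in> Obj C \<Longrightarrow> \<gamma> i \<in> mod_hom R (D i) F"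
    and cocone: "\<And>i j u x. \<lbrakk>u \<in> Hom_set C i j; x \<in> carrier (D i)\<rbrakk> \<Longrightarrow> \<gamma> j (T u x) = \<gamma> i x"
    and surj: "\<And>x. x \<in> carrier F \<Longrightarrow> \<exists>i\<in>Obj C. \<exists>b\<in>carrier (D i). \<gamma> i b = x"
    and kill: "\<And>i b. \<lbrakk>i \<in> Obj C; b \<in> carrier (D i); \<gamma> i b = \<zero>\<^bsub>F\<^esub>\<rbrakk> \<Longrightarrow>
      \<exists>j. \<exists>u\<in>Hom_set C i j. T u b = \<zero>\<^bsub>D j\<^esub>"
  shows "mod_iso R (colim R C D T) F"
proof -
  interpret F: left_module R F by fact
  interpret filtered_category C by fact
  interpret module_diagram C R D T by fact
  note R = F.R.ring_axioms
  interpret K: left_module R "colim R C D T" by (rule left_module_colim[OF R])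
  let ?\<iota> = "colim_inj R C D T"
  note \<iota> = colim_inj_cocone(1)[OF R] and \<iota>_cocone = colim_inj_cocone(2)[OF R]
  have Tc: "T v z \<in> carrier (D k)" if "v \<in> Hom_set C i k" "z \<in> carrier (D i)" for v i k z
    using mod_hom_closed[OF arr_hom[OF that(1)] that(2)] .
  have Hobj: "i \<in> Obj C" "k \<in> Obj C" if "v \<in> Hom_set C i k" for v i k
    using that dom_obj cod_obj by (auto simp: Hom_set_def)
  have key: "?\<iota> i b = ?\<iota> j b'"
    if i: "i \<in> Obj C" and b: "b \<in> carrier (D i)" and j: "j \<in> Obj C" and b': "b' \<in> carrier (D j)"
      and eq: "\<gamma> i b = \<gamma> j b'" for i b j b'
  proof -
    obtain k u v where k: "k \<in> Obj C" and u: "u \<in> Hom_set C i k" and v: "v \<in> Hom_set C j k"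
      using upper_bound[OF i j] by blast
    interpret Dk: left_module R "D k" by (rule obj_module[OF k])
    note ag = Dk.M.abelian_group_axioms
    let ?d = "T u b \<oplus>\<^bsub>D k\<^esub> \<ominus>\<^bsub>D k\<^esub> T v b'"
    have d: "?d \<in> carrier (D k)" using Tc[OF u b] Tc[OF v b'] by simp
    have "\<gamma> k ?d = \<gamma> i b \<oplus>\<^bsub>F\<^esub> \<ominus>\<^bsub>F\<^esub> \<gamma> j b'"
      using Tc[OF u b] Tc[OF v b'] cocone[OF u b] cocone[OF v b']
      by (simp add: mod_hom_add[OF \<gamma>[OF k]] mod_hom_minus[OF \<gamma>[OF k] ag F.M.abelian_group_axioms])
    also have "\<dots> = \<zero>\<^bsub>F\<^esub>" using mod_hom_closed[OF \<gamma>[OF j] b'] by (simp add: eq F.M.r_neg)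
    finally obtain l w where w: "w \<in> Hom_set C k l" and wd: "T w ?d = \<zero>\<^bsub>D l\<^esub>"
      using kill[OF k d] by auto
    interpret Dl: left_module R "D l" by (rule obj_module[OF Hobj(2)[OF w]])
    have "T w (T u b) \<oplus>\<^bsub>D l\<^esub> \<ominus>\<^bsub>D l\<^esub> T w (T v b') = \<zero>\<^bsub>D l\<^esub>"
      using wd Tc[OF u b] Tc[OF v b']
      by (simp add: mod_hom_add[OF arr_hom[OF w]] mod_hom_minus[OF arr_hom[OF w] ag Dl.M.abelian_group_axioms])
    then have "T w (T u b) = T w (T v b')"
      using Tc[OF w Tc[OF u b]] Tc[OF w Tc[OF v b']]
      by (metis Dl.M.a_inv_closed Dl.M.minus_equality Dl.M.minus_minus)
    then show ?thesis
      using \<iota>_cocone[OF w Tc[OF u b]] \<iota>_cocone[OF w Tc[OF v b']] \<iota>_cocone[OF u b] \<iota>_cocone[OF v b']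
      by simp
  qed
  have "\<exists>h\<in>mod_hom R (colim R C D T) F. \<forall>i\<in>Obj C. \<forall>x\<in>carrier (D i). h (?\<iota> i x) = \<gamma> i x"
    by (rule colim_universal(1)[OF F \<gamma> cocone])
  then obtain h where h: "h \<in> mod_hom R (colim R C D T) F"
    and h0: "\<forall>i\<in>Obj C. \<forall>x\<in>carrier (D i). h (?\<iota> i x) = \<gamma> i x" by (elim bexE) (rule that)
  have h\<gamma>: "h (?\<iota> i x) = \<gamma> i x" if "i \<in> Obj C" "x \<in> carrier (D i)" for i x
    using h0 that by simp
  \<comment> \<open>the inverse of \<open>h\<close>\<close>
  define \<kappa> where "\<kappa> x = (SOME y. \<exists>i\<in>Obj C. \<exists>b\<in>carrier (D i). \<gamma> i b = x \<and> y = ?\<iota> i b)" for x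
  have \<kappa>: "\<kappa> (\<gamma> i b) = ?\<iota> i b" if "i \<in> Obj C" "b \<in> carrier (D i)" for i b
    unfolding \<kappa>_def
  proof (rule some_equality)
    show "\<exists>i'\<in>Obj C. \<exists>b'\<in>carrier (D i'). \<gamma> i' b' = \<gamma> i b \<and> ?\<iota> i b = ?\<iota> i' b'"
      using that by auto
    fix y assume "\<exists>i'\<in>Obj C. \<exists>b'\<in>carrier (D i'). \<gamma> i' b' = \<gamma> i b \<and> y = ?\<iota> i' b'"
    then show "y = ?\<iota> i b" using key[OF that] by (elim bexE conjE) simp
  qed
  have \<kappa>_hom: "\<kappa> \<in> mod_hom R F (colim R C D T)"
  proof (rule mod_homI)
    fix x assume "x \<in> carrier F"
    then obtain i b where i: "i \<in> Obj C" and b: "b \<in> carrier (D i)" and x: "x = \<gamma> i b"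
      using surj by blast
    interpret Di: left_module R "D i" by (rule obj_module[OF i])
    show "\<kappa> x \<in> carrier (colim R C D T)"
      using mod_hom_closed[OF \<iota>[OF i] b] by (simp add: x \<kappa>[OF i b])
    show "\<kappa> (a \<odot>\<^bsub>F\<^esub> x) = a \<odot>\<^bsub>colim R C D T\<^esub> \<kappa> x" if a: "a \<in> carrier R" for a
      using \<kappa>[OF i Di.smult_closed[OF a b]]
      by (simp add: x \<kappa>[OF i b] mod_hom_smult[OF \<iota>[OF i] a b] mod_hom_smult[OF \<gamma>[OF i] a b])
    fix x' assume "x' \<in> carrier F"
    then obtain j b' where j: "j \<in> Obj C" and b': "b' \<in> carrier (D j)" and x': "x' = \<gamma> j b'"
      using surj by blast
    obtain k u v where k: "k \<in> Obj C" and u: "u \<in> Hom_set C i k" and v: "v \<in> Hom_set C j k"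
      using upper_bound[OF i j] by blast
    interpret Dk: left_module R "D k" by (rule obj_module[OF k])
    note c = Tc[OF u b] Tc[OF v b']
    have "\<kappa> (\<gamma> k (T u b \<oplus>\<^bsub>D k\<^esub> T v b')) = ?\<iota> k (T u b \<oplus>\<^bsub>D k\<^esub> T v b')"
      using c by (intro \<kappa>[OF k]) simp
    then show "\<kappa> (x \<oplus>\<^bsub>F\<^esub> x') = \<kappa> x \<oplus>\<^bsub>colim R C D T\<^esub> \<kappa> x'"
      by (simp add: x x' \<kappa>[OF i b] \<kappa>[OF j b'] mod_hom_add[OF \<iota>[OF k] c] mod_hom_add[OF \<gamma>[OF k] c]
          cocone[OF u b] cocone[OF v b'] \<iota>_cocone[OF u b] \<iota>_cocone[OF v b'])
  qed
  have id: "(\<lambda>y. y) \<in> mod_hom R (colim R C D T) (colim R C D T)" by (rule mod_homI) simp_all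
  have \<kappa>h: "\<kappa> (h y) = y" if y: "y \<in> carrier (colim R C D T)" for y
  proof (rule colim_universal(2)[OF K.left_module_axioms \<iota> \<iota>_cocone mod_hom_compose[OF h \<kappa>_hom] id _ y])
    show "\<kappa> (h (?\<iota> i x)) = ?\<iota> i x" if "i \<in> Obj C" "x \<in> carrier (D i)" for i x
      using that by (simp add: h\<gamma> \<kappa>)
  qed
  have "bij_betw h (carrier (colim R C D T)) (carrier F)"
  proof (rule bij_betw_imageI)
    show "inj_on h (carrier (colim R C D T))" by (rule inj_on_inverseI[of _ \<kappa>]) (rule \<kappa>h)
    show "h ` carrier (colim R C D T) = carrier F"
    proof
      show "h ` carrier (colim R C D T) \<subseteq> carrier F" using mod_hom_closed[OF h] by auto
      show "carrier F \<subseteq> h ` carrier (colim R C D T)"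
      proof
        fix x assume "x \<in> carrier F"
        then obtain i b where i: "i \<in> Obj C" and b: "b \<in> carrier (D i)" and x: "x = \<gamma> i b"
          using surj by blast
        show "x \<in> h ` carrier (colim R C D T)"
          using h\<gamma>[OF i b] mod_hom_closed[OF \<iota>[OF i] b] by (intro image_eqI[of _ h "?\<iota> i b"]) (simp_all add: x)
      qed
    qed
  qed
  then show ?thesis unfolding mod_iso_def using h by (rule bexI)
qed

section \<open>The category of modules over a given module\<close>

text \<open>
  The maps are extensional so that arrows with the same effect on elements are equal, as the
  laws of a category require.
\<close>

definition slice_hom ::
  "('r, 'q) ring_scheme \<Rightarrow> ('i \<Rightarrow> ('r, 'b, 'y) module_scheme) \<Rightarrow> ('i \<Rightarrow> 'b \<Rightarrow> 'f) \<Rightarrow> 'i \<Rightarrow> 'i \<Rightarrow> ('b \<Rightarrow> 'b) set"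
  where "slice_hom R D \<gamma> i j = {w \<in> mod_hom R (D i) (D j).
    w \<in> extensional (carrier (D i)) \<and> (\<forall>x\<in>carrier (D i). \<gamma> j (w x) = \<gamma> i x)}"

text \<open>
  The category of modules over \<open>F\<close>: an object \<open>i\<close> stands for the homomorphism \<open>\<gamma> i : D i \<rightarrow> F\<close>, and the
  injection \<open>e\<close> encodes an arrow by its source, target and underlying map.
\<close>

definition slice_category ::
  "('r, 'q) ring_scheme \<Rightarrow> 'i set \<Rightarrow> ('i \<Rightarrow> ('r, 'b, 'y) module_scheme) \<Rightarrow> ('i \<Rightarrow> 'b \<Rightarrow> 'f) \<Rightarrow>
    ('i \<times> 'i \<times> ('b \<Rightarrow> 'b) \<Rightarrow> 'a) \<Rightarrow> ('i, 'a) small_cat"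
  where "slice_category R Ob D \<gamma> e =
    \<lparr>Obj = Ob,
     Arr = e ` {(i, j, w). i \<in> Ob \<and> j \<in> Ob \<and> w \<in> slice_hom R D \<gamma> i j},
     Dom = (\<lambda>a. fst (inv_into UNIV e a)),
     Cod = (\<lambda>a. fst (snd (inv_into UNIV e a))),
     Ident = (\<lambda>i. e (i, i, \<lambda>x\<in>carrier (D i). x)),
     Comp = (\<lambda>v u. e (fst (inv_into UNIV e u), fst (snd (inv_into UNIV e v)),
       \<lambda>x\<in>carrier (D (fst (inv_into UNIV e u))). snd (snd (inv_into UNIV e v)) (snd (snd (inv_into UNIV e u)) x)))\<rparr>"

definition slice_map :: "('i \<times> 'i \<times> ('b \<Rightarrow> 'b) \<Rightarrow> 'a) \<Rightarrow> 'a \<Rightarrow> 'b \<Rightarrow> 'b"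
  where "slice_map e a = snd (snd (inv_into UNIV e a))"

lemma slice_hom_simps:
  assumes "w \<in> slice_hom R D \<gamma> i j"
  shows "w \<in> mod_hom R (D i) (D j)" "w \<in> extensional (carrier (D i))"
    and "x \<in> carrier (D i) \<Longrightarrow> \<gamma> j (w x) = \<gamma> i x"
    and "x \<in> carrier (D i) \<Longrightarrow> w x \<in> carrier (D j)"
  using assms mod_hom_closed[of w R "D i" "D j" x] by (auto simp: slice_hom_def)

lemma slice_hom_restrictI:
  assumes "left_module R (D i)" "w \<in> mod_hom R (D i) (D j)"
    and "\<And>x. x \<in> carrier (D i) \<Longrightarrow> \<gamma> j (w x) = \<gamma> i x"
  shows "restrict w (carrier (D i)) \<in> slice_hom R D \<gamma> i j"
proof -
  have "restrict w (carrier (D i)) \<in> mod_hom R (D i) (D j)"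
    by (rule mod_hom_cong[OF assms(2) _ assms(1)]) simp
  then show ?thesis using assms(3) by (simp add: slice_hom_def)
qed

lemma Hom_set_slice_category:
  assumes "inj e"
  shows "a \<in> Hom_set (slice_category R Ob D \<gamma> e) i j \<longleftrightarrow>
    (\<exists>w. a = e (i, j, w) \<and> i \<in> Ob \<and> j \<in> Ob \<and> w \<in> slice_hom R D \<gamma> i j)"
  by (auto simp: Hom_set_def slice_category_def inv_f_f[OF assms])

lemma slice_category_arrowI:
  assumes "inj e" "i \<in> Ob" "j \<in> Ob" "w \<in> slice_hom R D \<gamma> i j"
  shows "e (i, j, w) \<in> Hom_set (slice_category R Ob D \<gamma> e) i j"
  unfolding Hom_set_slice_category[OF assms(1)] using assms by blast

lemma slice_category_simps:
  assumes "inj e"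
  shows "Obj (slice_category R Ob D \<gamma> e) = Ob"
    and "Ident (slice_category R Ob D \<gamma> e) i = e (i, i, \<lambda>x\<in>carrier (D i). x)"
    and "Comp (slice_category R Ob D \<gamma> e) (e (j', k, z)) (e (i, j, w)) =
      e (i, k, \<lambda>x\<in>carrier (D i). z (w x))"
    and "slice_map e (e (i, j, w)) = w"
  by (simp_all add: slice_category_def slice_map_def inv_f_f[OF assms])

lemma slice_hom_compose:
  assumes "left_module R (D i)" "w \<in> slice_hom R D \<gamma> i j" "z \<in> slice_hom R D \<gamma> j k"
  shows "(\<lambda>x\<in>carrier (D i). z (w x)) \<in> slice_hom R D \<gamma> i k"
proof (rule slice_hom_restrictI[where D=D and i=i, OF assms(1)])
  show "(\<lambda>x. z (w x)) \<in> mod_hom R (D i) (D k)"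
    by (rule mod_hom_compose[OF slice_hom_simps(1)[OF assms(2)] slice_hom_simps(1)[OF assms(3)]])
  show "\<gamma> k (z (w x)) = \<gamma> i x" if "x \<in> carrier (D i)" for x
    using that by (simp add: slice_hom_simps(3,4)[OF assms(2)] slice_hom_simps(3)[OF assms(3)])
qed

lemma module_diagram_slice_category:
  assumes e: "inj e" and D: "\<And>i. i \<in> Ob \<Longrightarrow> left_module R (D i)"
  shows "module_diagram (slice_category R Ob D \<gamma> e) R D (slice_map e)"
proof -
  let ?C = "slice_category R Ob D \<gamma> e"
  note H = Hom_set_slice_category[OF e] and S = slice_category_simps[OF e]
  have "small_category ?C"
  proof
    show "Dom ?C u \<in> Obj ?C" "Cod ?C u \<in> Obj ?C" if "u \<in> Arr ?C" for u
      using that by (auto simp: slice_category_def inv_f_f[OF e])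
    show "Ident ?C i \<in> Hom_set ?C i i" if "i \<in> Obj ?C" for i
    proof -
      have "(\<lambda>x. x) \<in> mod_hom R (D i) (D i)" by (rule mod_homI) simp_all
      then have "(\<lambda>x\<in>carrier (D i). x) \<in> slice_hom R D \<gamma> i i"
        using that by (intro slice_hom_restrictI D) (simp_all add: S)
      then show ?thesis using that slice_category_arrowI[OF e, of i Ob i] by (simp add: S)
    qed
  next
    fix u i j v k assume "u \<in> Hom_set ?C i j" "v \<in> Hom_set ?C j k"
    then obtain u' v' where uv: "u = e (i, j, u')" "v = e (j, k, v')" and ob: "i \<in> Ob" "k \<in> Ob"
      and u': "u' \<in> slice_hom R D \<gamma> i j" and v': "v' \<in> slice_hom R D \<gamma> j k" by (auto simp: H)
    show "Comp ?C v u \<in> Hom_set ?C i k"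
      unfolding uv S by (rule slice_category_arrowI[OF e ob slice_hom_compose[OF D[OF ob(1)] u' v']])
  next
    fix u i j assume "u \<in> Hom_set ?C i j"
    then obtain w where u: "u = e (i, j, w)" and w: "w \<in> slice_hom R D \<gamma> i j" by (auto simp: H)
    note w' = slice_hom_simps[OF w]
    have "(\<lambda>x\<in>carrier (D i). (\<lambda>x\<in>carrier (D j). x) (w x)) = w"
      by (rule extensionalityI[OF _ w'(2)]) (simp_all add: w'(4))
    then show "Comp ?C (Ident ?C j) u = u" by (simp add: u S)
    have "(\<lambda>x\<in>carrier (D i). w ((\<lambda>x\<in>carrier (D i). x) x)) = w"
      by (rule extensionalityI[OF _ w'(2)]) simp_all
    then show "Comp ?C u (Ident ?C i) = u" by (simp add: u S)
  next
    fix u i j v k w l assume "u \<in> Hom_set ?C i j" "v \<in> Hom_set ?C j k" "w \<in> Hom_set ?C k l"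
    then obtain u' v' w' where e: "u = e (i, j, u')" "v = e (j, k, v')" "w = e (k, l, w')"
      and u': "u' \<in> slice_hom R D \<gamma> i j" by (auto simp: H)
    have "(\<lambda>x\<in>carrier (D i). w' ((\<lambda>x\<in>carrier (D i). v' (u' x)) x)) =
        (\<lambda>x\<in>carrier (D i). (\<lambda>x\<in>carrier (D j). w' (v' x)) (u' x))"
      by (rule restrict_ext) (simp add: slice_hom_simps(4)[OF u'])
    then show "Comp ?C w (Comp ?C v u) = Comp ?C (Comp ?C w v) u" by (simp add: e S)
  qed
  moreover have "module_diagram_axioms ?C R D (slice_map e)"
  proof (rule module_diagram_axioms.intro)
    show "left_module R (D i)" if "i \<in> Obj ?C" for i using that D by (simp add: S)
    show "slice_map e u \<in> mod_hom R (D i) (D j)" if "u \<in> Hom_set ?C i j" for u i j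
      using that slice_hom_simps(1) by (auto simp: H S)
    show "slice_map e (Ident ?C i) x = x" if "x \<in> carrier (D i)" for i x
      using that by (simp add: S)
    show "slice_map e (Comp ?C v u) x = slice_map e v (slice_map e u x)"
      if "u \<in> Hom_set ?C i j" "v \<in> Hom_set ?C j k" "x \<in> carrier (D i)" for u i j v k x
      using that by (auto simp: H S)
  qed
  ultimately show ?thesis by (simp add: module_diagram_def)
qed

text \<open>
  The category of pairs \<open>(B, g)\<close> with \<open>B \<in> \<B>\<close> and \<open>g : B \<rightarrow> F\<close> has upper bounds by direct sums.
  Parallel arrows are coequalised, and elements with image \<open>0\<close> are killed,
  by \<open>solutions_factor_kill\<close>.
\<close>

theorem solutions_factor_imp_lim_closure:
  fixes R :: "('r, 'q) ring_scheme" and F :: "('r, 'f) module" and \<B> :: "('r, 'b) module set"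
    and e :: "('r, 'b) module \<times> ('b \<Rightarrow> 'f) \<Rightarrow> 'i" and e' :: "'i \<times> 'i \<times> ('b \<Rightarrow> 'b) \<Rightarrow> 'a"
  assumes e: "inj e" and e': "inj e'"
    and fp: "\<And>B. B \<in> \<B> \<Longrightarrow> finitely_presented R B" and add: "additive_subcategory R \<B>"
    and F: "left_module R F" and fac: "solutions_factor R \<B> F"
  shows "F \<in> lim_closure TYPE('i) TYPE('a) R \<B>"
proof -
  have mods: "left_module R B" if "B \<in> \<B>" for B using fp[OF that] by (simp add: finitely_presented_def)
  have mods0: "\<forall>B\<in>\<B>. left_module R B" using mods by simp
  interpret F: left_module R F by fact
  define D where "D i = fst (inv_into UNIV e i)" for i
  define \<gamma> where "\<gamma> i = snd (inv_into UNIV e i)" for i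
  define Ob where "Ob = e ` {(B, g). B \<in> \<B> \<and> g \<in> mod_hom R B F}"
  have Ob: "D i \<in> \<B>" "\<gamma> i \<in> mod_hom R (D i) F" if "i \<in> Ob" for i
    using that by (auto simp: Ob_def D_def \<gamma>_def inv_f_f[OF e])
  have ex: "\<exists>i\<in>Ob. D i = B \<and> \<gamma> i = g" if "B \<in> \<B>" "g \<in> mod_hom R B F" for B g
    by (rule bexI[of _ "e (B, g)"]) (use that in \<open>auto simp: Ob_def D_def \<gamma>_def inv_f_f[OF e]\<close>)
  let ?C = "slice_category R Ob D \<gamma> e'" and ?T = "slice_map e'"
  note H = Hom_set_slice_category[OF e'] and S = slice_category_simps[OF e']
  have dia: "module_diagram ?C R D ?T"
    by (rule module_diagram_slice_category[OF e' mods[OF Ob(1)]])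
  have arrow: "\<exists>k\<in>Ob. D k = B \<and> \<gamma> k = g \<and> e' (i, k, restrict w (carrier (D i))) \<in> Hom_set ?C i k"
    if i: "i \<in> Ob" and B: "B \<in> \<B>" "g \<in> mod_hom R B F" and w: "w \<in> mod_hom R (D i) B"
      and gw: "\<And>x. x \<in> carrier (D i) \<Longrightarrow> g (w x) = \<gamma> i x" for i B g w
  proof -
    obtain k where k: "k \<in> Ob" "D k = B" "\<gamma> k = g" using ex[OF B] by auto
    have "restrict w (carrier (D i)) \<in> slice_hom R D \<gamma> i k"
      using w gw k by (intro slice_hom_restrictI mods[OF Ob(1)[OF i]]) simp_all
    from slice_category_arrowI[OF e' i k(1) this] show ?thesis
      using k by (intro bexI[of _ k] conjI)
  qed
  have fil: "filtered_category ?C"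
  proof -
    interpret small_category ?C using dia by (simp add: module_diagram_def)
    show ?thesis
    proof
      obtain Z where "Z \<in> \<B>" using add unfolding additive_subcategory_def by blast
      moreover have "(\<lambda>_. \<zero>\<^bsub>F\<^esub>) \<in> mod_hom R Z F"
        by (intro mod_homI) (simp_all add: F.smult_zero_right)
      ultimately have "Ob \<noteq> {}" by (auto simp: Ob_def)
      then show "Obj ?C \<noteq> {}" by (simp add: S)
    next
      fix i j assume "i \<in> Obj ?C" "j \<in> Obj ?C"
      then have i: "i \<in> Ob" and j: "j \<in> Ob" by (simp_all add: S)
      obtain P m n g where P: "P \<in> \<B>" and m: "m \<in> mod_hom R (D i) P" and n: "n \<in> mod_hom R (D j) P"
        and g: "g \<in> mod_hom R P F" and gm: "\<And>x. x \<in> carrier (D i) \<Longrightarrow> g (m x) = \<gamma> i x"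
        and gn: "\<And>x. x \<in> carrier (D j) \<Longrightarrow> g (n x) = \<gamma> j x"
        using additive_biproduct[OF add mods0 Ob(1)[OF i] Ob(1)[OF j] F Ob(2)[OF i] Ob(2)[OF j]] by blast
      obtain k where k: "k \<in> Ob" "D k = P" "\<gamma> k = g"
        and mk: "e' (i, k, restrict m (carrier (D i))) \<in> Hom_set ?C i k"
        using arrow[OF i P g m gm] by auto
      have "restrict n (carrier (D j)) \<in> slice_hom R D \<gamma> j k"
        using n gn k by (intro slice_hom_restrictI mods[OF Ob(1)[OF j]]) simp_all
      from slice_category_arrowI[OF e' j k(1) this]
      have "e' (j, k, restrict n (carrier (D j))) \<in> Hom_set ?C j k" .
      then show "\<exists>k\<in>Obj ?C. Hom_set ?C i k \<noteq> {} \<and> Hom_set ?C j k \<noteq> {}"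
        using mk k(1) by (intro bexI[of _ k]) (auto simp: S)
    next
      fix u v i j assume "u \<in> Hom_set ?C i j" "v \<in> Hom_set ?C i j"
      then obtain u' v' where uv: "u = e' (i, j, u')" "v = e' (i, j, v')" and i: "i \<in> Ob" and j: "j \<in> Ob"
        and u': "u' \<in> slice_hom R D \<gamma> i j" and v': "v' \<in> slice_hom R D \<gamma> i j" by (auto simp: H)
      note us = slice_hom_simps[OF u'] and vs = slice_hom_simps[OF v']
      interpret Dj: left_module R "D j" by (rule mods[OF Ob(1)[OF j]])
      note ag = Dj.M.abelian_group_axioms
      obtain n S' x where pr: "presented R (D i) {..<n::nat} S' x"
        using finitely_presentedD[OF fp[OF Ob(1)[OF i]]] .
      have xc: "x k \<in> carrier (D i)" if "k \<in> {..<n}" for k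
        using pr that by (auto simp: presented_def)
      \<comment> \<open>\<open>u'\<close> and \<open>v'\<close> agree after \<open>w\<close> as soon as \<open>w\<close> kills their differences on generators\<close>
      define d where "d k = u' (x k) \<oplus>\<^bsub>D j\<^esub> \<ominus>\<^bsub>D j\<^esub> v' (x k)" for k
      have dc: "d k \<in> carrier (D j)" if "k \<in> {..<n}" for k
        using us(4)[OF xc[OF that]] vs(4)[OF xc[OF that]] by (simp add: d_def)
      have d0: "\<gamma> j (d k) = \<zero>\<^bsub>F\<^esub>" if "k \<in> {..<n}" for k
        using us(3,4)[OF xc[OF that]] vs(3,4)[OF xc[OF that]] mod_hom_closed[OF Ob(2)[OF i] xc[OF that]]
        by (simp add: d_def mod_hom_add[OF Ob(2)[OF j]] F.M.r_neg
            mod_hom_minus[OF Ob(2)[OF j] ag F.M.abelian_group_axioms])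
      have "\<exists>B\<in>\<B>. \<exists>w\<in>mod_hom R (D j) B. \<exists>h\<in>mod_hom R B F.
          (\<forall>x\<in>carrier (D j). h (w x) = \<gamma> j x) \<and> (\<forall>x\<in>d ` {..<n}. w x = \<zero>\<^bsub>B\<^esub>)"
        by (rule solutions_factor_kill[OF fac fp F Ob(1)[OF j] Ob(2)[OF j]]) (use dc d0 in auto)
      then obtain B w h where B: "B \<in> \<B>" and w: "w \<in> mod_hom R (D j) B" and h: "h \<in> mod_hom R B F"
        and hw: "\<And>x. x \<in> carrier (D j) \<Longrightarrow> h (w x) = \<gamma> j x"
        and wd: "\<And>k. k \<in> {..<n} \<Longrightarrow> w (d k) = \<zero>\<^bsub>B\<^esub>" by blast
      interpret B: left_module R B by (rule mods[OF B])
      have "w (u' (x k)) = w (v' (x k))" if "k \<in> {..<n}" for k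
      proof -
        have c: "u' (x k) \<in> carrier (D j)" "v' (x k) \<in> carrier (D j)"
          using us(4)[OF xc[OF that]] vs(4)[OF xc[OF that]] by auto
        then have "w (u' (x k)) \<oplus>\<^bsub>B\<^esub> \<ominus>\<^bsub>B\<^esub> w (v' (x k)) = \<zero>\<^bsub>B\<^esub>"
          using wd[OF that]
          by (simp add: d_def mod_hom_add[OF w] mod_hom_minus[OF w ag B.M.abelian_group_axioms])
        then show ?thesis
          using mod_hom_closed[OF w c(1)] mod_hom_closed[OF w c(2)]
          by (metis B.M.a_inv_closed B.M.minus_equality B.M.minus_minus)
      qed
      then have wuv: "w (u' z) = w (v' z)" if "z \<in> carrier (D i)" for z
        by (rule presented_hom_eqI[OF pr mods[OF Ob(1)[OF i]] mods[OF B]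
            mod_hom_compose[OF us(1) w] mod_hom_compose[OF vs(1) w] _ that])
      obtain k where k: "k \<in> Ob"
        and wk: "e' (j, k, restrict w (carrier (D j))) \<in> Hom_set ?C j k"
        using arrow[OF j B h w hw] by auto
      have "(\<lambda>z\<in>carrier (D i). restrict w (carrier (D j)) (u' z)) =
          (\<lambda>z\<in>carrier (D i). restrict w (carrier (D j)) (v' z))"
        by (rule restrict_ext) (simp add: us(4) vs(4) wuv)
      then have "Comp ?C (e' (j, k, restrict w (carrier (D j)))) u =
          Comp ?C (e' (j, k, restrict w (carrier (D j)))) v"
        by (simp add: uv S)
      then show "\<exists>k\<in>Obj ?C. \<exists>w\<in>Hom_set ?C j k. Comp ?C w u = Comp ?C w v"
        using k wk by (intro bexI[of _ k] bexI[of _ "e' (j, k, restrict w (carrier (D j)))"]) (simp_all add: S)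
    qed
  qed
  have "mod_iso R (colim R ?C D ?T) F"
  proof (rule filtered_colimit_recognition[OF fil dia F, where \<gamma>=\<gamma>])
    show "\<gamma> i \<in> mod_hom R (D i) F" if "i \<in> Obj ?C" for i using that Ob(2) by (simp add: S)
    show "\<gamma> j (?T u x) = \<gamma> i x" if "u \<in> Hom_set ?C i j" "x \<in> carrier (D i)" for i j u x
      using that slice_hom_simps(3) by (auto simp: H S)
  next
    fix x assume x: "x \<in> carrier F"
    \<comment> \<open>an element is a solution of the empty system in one unknown\<close>
    have "(\<lambda>_. x) \<in> solutions F {..<1::nat} {}" using x by (simp add: solutions_def)
    from solutions_factorD[OF fac _ _ this]
    obtain B b g where B: "B \<in> \<B>" and b: "b \<in> solutions B {..<1::nat} {}" and g: "g \<in> mod_hom R B F"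
      and xb: "x = g (b 0)" by auto
    obtain i where i: "i \<in> Ob" "D i = B" "\<gamma> i = g" using ex[OF B g] by auto
    have "b 0 \<in> carrier B" using b by (auto simp: solutions_def)
    then show "\<exists>i\<in>Obj ?C. \<exists>b\<in>carrier (D i). \<gamma> i b = x"
      using i xb by (intro bexI[of _ i] bexI[of _ "b 0"]) (simp_all add: S)
  next
    fix i b assume "i \<in> Obj ?C" and b: "b \<in> carrier (D i)" and b0: "\<gamma> i b = \<zero>\<^bsub>F\<^esub>"
    then have i: "i \<in> Ob" by (simp add: S)
    have "\<exists>B\<in>\<B>. \<exists>w\<in>mod_hom R (D i) B. \<exists>h\<in>mod_hom R B F.
        (\<forall>x\<in>carrier (D i). h (w x) = \<gamma> i x) \<and> (\<forall>x\<in>{b}. w x = \<zero>\<^bsub>B\<^esub>)"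
      by (rule solutions_factor_kill[OF fac fp F Ob(1)[OF i] Ob(2)[OF i]]) (use b b0 in auto)
    then obtain B w h where B: "B \<in> \<B>" and w: "w \<in> mod_hom R (D i) B" and h: "h \<in> mod_hom R B F"
      and hw: "\<And>x. x \<in> carrier (D i) \<Longrightarrow> h (w x) = \<gamma> i x" and wb: "w b = \<zero>\<^bsub>B\<^esub>" by blast
    obtain k where "D k = B" and k: "e' (i, k, restrict w (carrier (D i))) \<in> Hom_set ?C i k"
      using arrow[OF i B h w hw] by auto
    then show "\<exists>j. \<exists>u\<in>Hom_set ?C i j. ?T u b = \<zero>\<^bsub>D j\<^esub>"
      using wb b by (intro exI[of _ k] bexI[of _ "e' (i, k, restrict w (carrier (D i)))"]) (simp_all add: S)
  qed
  moreover have "\<forall>i\<in>Obj ?C. D i \<in> \<B>" using Ob(1) by (simp add: S)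
  ultimately show ?thesis unfolding lim_closure_def using F fil dia by blast
qed

section \<open>Filtered colimits and direct summands of products\<close>

theorem theoremD:
  fixes R :: "('r, 'q) ring_scheme"
    and \<B> :: "('r, 'b) module set"
    and F :: "('r, 'f) module"
    and e :: "('r, 'b) module \<times> ('b \<Rightarrow> 'f) \<Rightarrow> 'i"
    and e' :: "'i \<times> 'i \<times> ('b \<Rightarrow> 'b) \<Rightarrow> 'a"
  assumes "ring R"
    and "\<forall>B\<in>\<B>. finitely_presented R B"
    and "additive_subcategory R \<B>"
    and "left_module R F"
    and "inj e" and "inj e'"
  shows "F \<in> lim_closure TYPE('i) TYPE('a) R \<B> \<longleftrightarrow>
    character_module F \<in> char_product_summands TYPE('i) R \<B>"
proof
  have CF: "right_module R (character_module F)"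
    using assms(4) by (rule right_module_character_module)
  {
    assume "F \<in> lim_closure TYPE('i) TYPE('a) R \<B>"
    then obtain C :: "('i, 'a) small_cat" and D :: "'i \<Rightarrow> ('r, 'b) module" and T where
      C: "filtered_category C" "module_diagram C R D T" "mod_iso R (colim R C D T) F"
      and D: "\<forall>i\<in>Obj C. D i \<in> \<B>"
      unfolding lim_closure_def by blast
    have "is_direct_summand R (character_module F)
        (product_module (Obj C) (\<lambda>i. character_module (D i)))"
      by (rule filtered_colimit_character_module[OF C(1,2) assms(4) C(3)])
    then show "character_module F \<in> char_product_summands TYPE('i) R \<B>"
      unfolding char_product_summands_def using CF D by blast
  next
    assume "character_module F \<in> char_product_summands TYPE('i) R \<B>"
    then obtain I :: "'i set" and D :: "'i \<Rightarrow> ('r, 'b) module" where D: "\<forall>i\<in>I. D i \<in> \<B>"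
      and summand: "is_direct_summand R (character_module F)
        (product_module I (\<lambda>i. character_module (D i)))"
      unfolding char_product_summands_def by blast
    have "right_module R (character_module (D i))" if "i \<in> I" for i
      using assms(2) D that
      by (intro right_module_character_module) (simp add: finitely_presented_def)
    then have P: "right_module R (product_module I (\<lambda>i. character_module (D i)))"
      by (rule right_module_product_module[OF assms(1)])
    obtain j p where j: "j \<in> mod_hom R (character_module F) (product_module I (\<lambda>i. character_module (D i)))"
      and p: "p \<in> mod_hom R (product_module I (\<lambda>i. character_module (D i))) (character_module F)"
      and pj: "\<And>c. c \<in> carrier (character_module F) \<Longrightarrow> p (j c) = c"
      using summand unfolding direct_summand_iff_retract[OF CF P] by blast
    have "solutions_factor R \<B> F"
      unfolding solutions_factor_def
    proof (intro allI impI ballI)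
      fix n :: nat and S y
      assume S: "finite S" "S \<subseteq> {..<n} \<rightarrow> carrier R" and y: "y \<in> solutions F {..<n} S"
      show "\<exists>B\<in>\<B>. \<exists>b\<in>solutions B {..<n} S. \<exists>g\<in>mod_hom R B F. \<forall>k\<in>{..<n}. y k = g (b k)"
        by (rule summand_solutions_factor[OF _ assms(3,4) _ j p pj finite_lessThan S y])
          (use assms(2) D in auto)
    qed
    then show "F \<in> lim_closure TYPE('i) TYPE('a) R \<B>"
      using assms(2) by (intro solutions_factor_imp_lim_closure[OF assms(5,6) _ assms(3,4)]) simp_all
  }
qed

end
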